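(* Let $n\ge 4$ be even, and let $K_n\subset\mathbb{R}^n$ be the body of revolution with radial function $\rho_K$. Assume that $K_n$ is the intersection body of a star body $L\subset\mathbb{R}^n$. If $L$ is equator-convex and $\rho_L\in C^1$, then $K_{n+2}$ is also an intersection body of a star body. If $L$ is not equator-convex, then $K_{n+2}$ is not an intersection body.
   Context: All bodies are origin-symmetric, and star bodies have continuous radial functions $\rho_L(\xi)=\max\{a:a\xi\in L\}$, $\xi\in S^{n-1}$. Bodies of revolution in $\mathbb{R}^n$ are about the $x_n$-axis, and their radial functions are regarded as functions of the angle $\varphi$ from the $x_n$-axis. Given a function $\rho_K(\varphi)$, $0\le\varphi\le\pi/2$, $K_n$ denotes the origin-symmetric body of revolution in $\mathbb{R}^n$ whose radial function is $\rho_K$ (extended by $\rho_K(\pi-\varphi)=\rho_K(\varphi)$); thus $K_{n+2}$ is the body of revolution in $\mathbb{R}^{n+2}$ with the same function $\rho_K(\varphi)$. $L$ is a body of revolution about the $x_n$-axis. $K$ is the intersection body of the star body $L\subset\mathbb{R}^n$ if $\rho_K(\xi)=\mathrm{Vol}_{n-1}(L\cap\xi^\perp)=\frac1{n-1}\int_{S^{n-1}\cap\xi^\perp}\rho_L^{n-1}(\theta)\,d\theta$ for all $\xi\in S^{n-1}$; $K$ is an intersection body of a star body if such an $L$ exists. More generally, a star body $K\subset\mathbb{R}^n$ is an intersection body if there is an even non-negative finite Borel measure $\mu$ on $S^{n-1}$ such that $\int_{S^{n-1}}\rho_K(\xi)g(\xi)\,d\xi=\int_{S^{n-1}}Rg(\xi)\,d\mu(\xi)$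 for every continuous $g$ on $S^{n-1}$, where $Rg(\xi)=\int_{S^{n-1}\cap\xi^\perp}g(\theta)\,d\theta$. A body of revolution $L\subset\mathbb{R}^n$ is equator-convex if its intersection with every hyperplane parallel to the equator of $L$ (i.e. perpendicular to the axis of revolution) is convex. Equivalently, in the two-dimensional cross-section through the axis, every line perpendicular to the axis meets the body in a line segment (possibly degenerate or empty).
   Formalization: "ρ_L ∈ C^1" is read as C^1 in t = cos φ on [0,1], so ρ_L'(φ)/sin φ must have a finite limit at the pole; with C^1 in φ alone the first claim fails, e.g. ρ_L = 1 − (1/2)(sin φ)^{3/2}. Radial functions of star bodies may vanish in some directions. *)

theory Defs
  imports "HOL-Analysis.Analysis"
begin

definition radial_fun :: "'a::real_normed_vector set \<Rightarrow> 'a \<Rightarrow> real" where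
  "radial_fun L \<xi> = Sup {a. a *\<^sub>R \<xi> \<in> L}"

text \<open>
  All star bodies are origin-symmetric. The radial function is continuous and nonnegative; it may
  vanish in some directions, i.e. the origin need not be an interior point. By compactness the
  supremum in \<^const>\<open>radial_fun\<close> is attained.
\<close>

definition star_body :: "'a::euclidean_space set \<Rightarrow> bool" where
  "star_body L \<longleftrightarrow>
     compact L \<and> interior L \<noteq> {} \<and>
     0 \<in> L \<and> (\<forall>x\<in>L. closed_segment 0 x \<subseteq> L) \<and>
     (\<forall>x\<in>L. - x \<in> L) \<and>
     continuous_on (sphere 0 1) (radial_fun L)"

text \<open>
  For a unit vector \<open>\<xi>\<close>, \<open>hyperplane_measure \<xi>\<close> is \<open>(n-1)\<close>-dimensional Lebesgue measure on the
  hyperplane orthogonal to \<open>\<xi>\<close>, viewed as a measure on the whole space: a subset of the hyperplane is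
  measured by the \<open>n\<close>-dimensional volume of the cylinder of height 1 over it.
\<close>

definition hyperplane_measure :: "'a::euclidean_space \<Rightarrow> 'a measure" where
  "hyperplane_measure \<xi> =
     distr (restrict_space lborel {x. 0 \<le> x \<bullet> \<xi> \<and> x \<bullet> \<xi> \<le> 1}) borel (\<lambda>x. x - (x \<bullet> \<xi>) *\<^sub>R \<xi>)"

text \<open>
  If \<open>M\<close> is Lebesgue measure on a \<open>d\<close>-dimensional subspace, then \<open>sphere_measure d M\<close> is the surface
  measure of the unit sphere of that subspace: a set \<open>A\<close> on the sphere has surface area \<open>d\<close> times the
  volume of the cone \<open>{r \<theta> | \<theta> \<in> A, 0 < r < 1}\<close>.  Note that \<open>sgn x = x / norm x\<close>.
\<close>

definition sphere_measure :: "nat \<Rightarrow> 'a::euclidean_space measure \<Rightarrow> 'a measure" where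
  "sphere_measure d M =
     scale_measure (of_nat d)
       (distr (restrict_space M (ball 0 1 - {0})) (restrict_space borel (sphere 0 1)) sgn)"

definition spherical_radon :: "('a::euclidean_space \<Rightarrow> real) \<Rightarrow> 'a \<Rightarrow> real" where
  "spherical_radon g \<xi> =
     (\<integral>\<theta>. g \<theta> \<partial>sphere_measure (DIM('a) - 1) (hyperplane_measure \<xi>))"

definition intersection_body_of :: "'a::euclidean_space set \<Rightarrow> 'a set \<Rightarrow> bool" where
  "intersection_body_of K L \<longleftrightarrow>
     star_body K \<and> star_body L \<and>
     (\<forall>\<xi>\<in>sphere 0 1. radial_fun K \<xi> = measure (hyperplane_measure \<xi>) (L \<inter> {x. x \<bullet> \<xi> = 0}))"

definition intersection_body :: "'a::euclidean_space set \<Rightarrow> bool" where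
  "intersection_body K \<longleftrightarrow>
     star_body K \<and>
     (\<exists>\<mu>. sets \<mu> = sets (restrict_space borel (sphere 0 1)) \<and> finite_measure \<mu> \<and>
          (\<forall>A\<in>sets \<mu>. emeasure \<mu> (uminus ` A) = emeasure \<mu> A) \<and>
          (\<forall>g :: 'a \<Rightarrow> real. continuous_on (sphere 0 1) g \<longrightarrow>
             (\<integral>\<xi>. radial_fun K \<xi> * g \<xi> \<partial>sphere_measure DIM('a) lborel) =
             (\<integral>\<xi>. spherical_radon g \<xi> \<partial>\<mu>)))"

text \<open>
  The axis of revolution is the \<open>k\<close>-th coordinate axis. For a unit vector \<open>\<xi>\<close>,
  \<open>arccos \<bar>\<xi> $ k\<bar>\<close> is the angle \<open>\<phi> \<in> [0, \<pi>/2]\<close> between \<open>\<xi>\<close> and the axis; the absolute value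
  implements the extension \<open>\<rho> (\<pi> - \<phi>) = \<rho> \<phi>\<close>.
\<close>

definition revolution_body :: "'n::finite \<Rightarrow> (real \<Rightarrow> real) \<Rightarrow> (real^'n) set" where
  "revolution_body k \<rho> =
     {r *\<^sub>R \<xi> | r \<xi>. \<xi> \<in> sphere 0 1 \<and> 0 \<le> r \<and> r \<le> \<rho> (arccos \<bar>\<xi> $ k\<bar>)}"

lemma radial_fun_revolution_body:
  assumes "\<forall>\<phi>\<in>{0..pi/2}. 0 \<le> \<rho> \<phi>" and "\<xi> \<in> sphere 0 1"
  shows "radial_fun (revolution_body k \<rho>) \<xi> = \<rho> (arccos \<bar>\<xi> $ k\<bar>)"
proof -
  let ?c = "\<rho> (arccos \<bar>\<xi> $ k\<bar>)"
  have n: "norm \<xi> = 1" using assms(2) by simp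
  then have "\<bar>\<xi> $ k\<bar> \<le> 1" using component_le_norm_cart[of \<xi> k] by simp
  then have c: "0 \<le> ?c" 
    using arccos_lbound[of "\<bar>\<xi> $ k\<bar>"] arccos_le_pi2[of "\<bar>\<xi> $ k\<bar>"]
    by (intro assms(1)[rule_format]) auto
  have "{a. a *\<^sub>R \<xi> \<in> revolution_body k \<rho>} = {- ?c..?c}"
  proof (intro set_eqI iffI)
    fix a assume "a \<in> {a. a *\<^sub>R \<xi> \<in> revolution_body k \<rho>}"
    then obtain r \<eta> where h: "a *\<^sub>R \<xi> = r *\<^sub>R \<eta>" "norm \<eta> = 1" "0 \<le> r" "r \<le> \<rho> (arccos \<bar>\<eta> $ k\<bar>)"
      by (auto simp: revolution_body_def)
    have r: "\<bar>a\<bar> = r" using arg_cong[OF h(1), of norm] n h(2,3) by simp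
    show "a \<in> {- ?c..?c}"
    proof (cases "r = 0")
      case True then show ?thesis using r c by auto
    next
      case False
      have "\<bar>a\<bar> * \<bar>\<xi> $ k\<bar> = r * \<bar>\<eta> $ k\<bar>"
        using arg_cong[OF h(1), of "\<lambda>x. \<bar>x $ k\<bar>"] h(3) by (simp add: abs_mult)
      then have "\<bar>\<xi> $ k\<bar> = \<bar>\<eta> $ k\<bar>" using r False by simp
      then show ?thesis using h(4) r by auto
    qed
  next
    fix a assume a: "a \<in> {- ?c..?c}"
    have "a *\<^sub>R \<xi> = \<bar>a\<bar> *\<^sub>R (if 0 \<le> a then \<xi> else - \<xi>)" by auto
    moreover have "\<bar>(if 0 \<le> a then \<xi> else - \<xi>) $ k\<bar> = \<bar>\<xi> $ k\<bar>" by auto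
    ultimately show "a \<in> {a. a *\<^sub>R \<xi> \<in> revolution_body k \<rho>}"
      using n a unfolding revolution_body_def mem_Collect_eq
      by (intro exI[of _ "\<bar>a\<bar>"] exI[of _ "if 0 \<le> a then \<xi> else - \<xi>"]) auto
  qed
  then show ?thesis using c by (simp add: radial_fun_def)
qed

definition body_of_revolution :: "'n::finite \<Rightarrow> (real^'n) set \<Rightarrow> bool" where
  "body_of_revolution k L \<longleftrightarrow>
     (\<forall>f. orthogonal_transformation f \<and> f (axis k 1) = axis k 1 \<longrightarrow> f ` L = L)"

definition equator_convex :: "'n::finite \<Rightarrow> (real^'n) set \<Rightarrow> bool" where
  "equator_convex k L \<longleftrightarrow> (\<forall>h. convex (L \<inter> {x. x $ k = h}))"

text \<open>
  Continuous differentiability of the radial function is taken in the variable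
  \<open>t = cos \<phi> = \<bar>\<xi> $ k\<bar>\<close> on \<open>[0, 1]\<close>, one-sided at the end points. In terms of the angle this means
  \<open>\<rho> \<in> C\<^sup>1[0, \<pi>/2]\<close> and that \<open>\<rho>' \<phi> / sin \<phi>\<close> has a finite limit as \<open>\<phi> \<rightarrow> 0\<close> (automatic for
  a radial function that is twice differentiable at the poles). Differentiability in \<open>\<phi>\<close> alone does
  not suffice for the passage from dimension \<open>n\<close> to \<open>n + 2\<close>: for
  \<open>\<rho> \<phi> = 1 - (sin \<phi>) powr (3/2) / 2\<close> the body with the intersection function of
  the corresponding \<open>L\<close> is, in dimension \<open>n + 2\<close>, generated only by an unbounded radial function.
\<close>

definition C1_radial :: "'n::finite \<Rightarrow> (real^'n) set \<Rightarrow> bool" where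
  "C1_radial k L \<longleftrightarrow>
     (\<exists>f f'. (\<forall>\<xi>\<in>sphere 0 1. radial_fun L \<xi> = f \<bar>\<xi> $ k\<bar>) \<and>
             (\<forall>t\<in>{0..1}. (f has_real_derivative f' t) (at t within {0..1})) \<and>
             continuous_on {0..1} f')"

end

theory Submission
  imports Defs
begin

text \<open>
  Let \<open>f\<close> be the radial function of \<open>L\<close> as a function of \<open>t = \<bar>\<xi> $ k\<bar>\<close>, let \<open>n = 2 q + 2\<close> be the dimension
  and \<open>G = f ^ (n - 1)\<close>. In polar coordinates on the hyperplane, \<open>\<rho>\<^sub>K\<close> at a direction with
  \<open>s = sqrt (1 - t\<^sup>2)\<close> is a positive multiple of \<open>\<integral>v\<in>{0..1}. (1 - v\<^sup>2) ^ (q - 1) * G (s v)\<close>. Integrating by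
  parts, this is a multiple of \<open>\<integral>v\<in>{0..1}. (1 - v\<^sup>2) ^ q * F (s v)\<close> with
  \<open>F = (n - 1) G + t G' = (n - 1) f ^ (n - 2) * (t f)'\<close>, which is the formula for the intersection body in
  dimension \<open>n + 2\<close> of the body with radial function a multiple of \<open>F powr (1 / (n + 1))\<close>. Equator-convexity
  of \<open>L\<close> says exactly that \<open>t f(t)\<close>, the height of a boundary point above the equator, is nondecreasing,
  i.e. that \<open>F \<ge> 0\<close>.

  If \<open>t f(t)\<close> decreases somewhere, then \<open>F\<close> exists only as a distribution, and it is tested against
  zonal functions. For even \<open>n\<close> the spherical Radon transform of \<open>\<gamma> \<bar>\<xi> $ k\<bar>\<close> in dimension \<open>n + 2\<close> is, in the
  variable \<open>y = s\<^sup>2\<close>, an iterated integral of integer order, so \<open>\<gamma>\<close> can be found explicitly from a prescribed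
  transform by differentiating polynomials. With the transform proportional to \<open>(1 - y) ^ q * S y\<close>, \<open>S\<close> a
  smooth step, pairing \<open>\<gamma>\<close> with \<open>\<rho>\<^sub>K\<close> gives an average of \<open>(t f(t)) ^ (n - 1)\<close> over the short interval on which
  \<open>S\<close> rises. The difference of two such functions has a nonnegative transform but a negative pairing,
  so no nonnegative measure can represent \<open>K\<close> in dimension \<open>n + 2\<close>.
\<close>

section \<open>Orthogonal maps and Lebesgue measure\<close>

text \<open>With \<open>y = w\<^sup>2\<close> and
  \<open>w = sqrt (1 - (\<xi> $ k')\<^sup>2)\<close>, the Radon transform of \<open>\<gamma>\<close>
  in dimension \<open>2 q + 4\<close> is a positive multiple of \<open>h y / w ^ (2 q + 1)\<close>,
  where \<open>h y\<close> integrates \<open>\<gamma> t * (y - t\<^sup>2) ^ q\<close> over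
  \<open>[0, w]\<close>. By Fubini, the pairing with the radial function of \<open>K\<close>
  integrates \<open>G \<tau>\<close> against the integral of
  \<open>\<gamma> t * (1 - t\<^sup>2) * (y - t\<^sup>2) ^ (q - 1)\<close> at
  \<open>y = 1 - \<tau>\<^sup>2\<close>. Since
  \<open>1 - t\<^sup>2 = (1 - y) + (y - t\<^sup>2)\<close>, the latter is
  \<open>(1 - y) * h' y / q + h y\<close>. This operator annihilates \<open>(1 - y) ^ q\<close>,
  which is where that factor of the prescribed transform comes from: for
  \<open>h y = (1 - y) ^ q * S y\<close> only the derivative of \<open>S\<close> survives, with
  weight \<open>\<tau> ^ (2 q + 2) / q\<close>. One factor \<open>\<tau>\<close> belongs to the
  change of variable, the others turn \<open>G\<close> into a power of the height. As
  \<open>y = 1 - \<tau>\<^sup>2\<close> reverses the order, the step placed at the larger cosine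
  rises earlier in \<open>y\<close> and dominates the other; this fixes the sign of the
  difference.\<close>

lemma orthogonal_swap:
  fixes a b :: "'a::euclidean_space"
  assumes "norm a = norm b"
  obtains T where "orthogonal_transformation T" "T a = b" "\<And>c. c \<bullet> a = c \<bullet> b \<Longrightarrow> T c = c"
proof -
  define d where "d = a - b"
  \<comment> \<open>The reflection in the hyperplane orthogonal to \<open>a - b\<close>. For
    \<open>a = b\<close> the vector \<open>d\<close> is 0 and \<open>T\<close> is the
    identity.\<close>
  define T where "T x = x - (2 * (x \<bullet> d) / (d \<bullet> d)) *\<^sub>R d" for x
  have ab: "a \<bullet> a = b \<bullet> b" using assms by (simp add: norm_eq)
  have "linear T"
    unfolding T_def by (intro linearI) (simp_all add: algebra_simps add_divide_distrib)
  moreover have "norm (T x) = norm x" for x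
  proof -
    have "T x \<bullet> T x = x \<bullet> x"
    proof (cases "d \<bullet> d = 0")
      case False
      then show ?thesis
        by (simp add: T_def inner_diff_left inner_diff_right inner_commute field_simps power2_eq_square)
    qed (simp add: T_def)
    then show ?thesis by (simp add: norm_eq)
  qed
  ultimately have 1: "orthogonal_transformation T" by (simp add: orthogonal_transformation)
  have "d \<bullet> d = 2 * (a \<bullet> d)"
    using ab by (simp add: d_def inner_diff_left inner_diff_right inner_commute)
  then have 2: "T a = b"
    by (cases "d \<bullet> d = 0") (simp_all add: T_def d_def)
  have 3: "T c = c" if "c \<bullet> a = c \<bullet> b" for c
    using that by (simp add: T_def d_def inner_diff_right)
  from 1 2 3 show ?thesis by (rule that)
qed

text \<open>
  Uniqueness of Haar measure in miniature: integrate \<open>A x * h (x + T y)\<close>, with \<open>A\<close> the indicator of the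
  unit ball, in both orders.
\<close>

lemma nn_integral_lborel_orthogonal:
  fixes T :: "'a::euclidean_space \<Rightarrow> 'a"
  assumes T: "orthogonal_transformation T" and [measurable]: "h \<in> borel_measurable borel"
  shows "(\<integral>\<^sup>+x. h (T x) \<partial>lborel) = (\<integral>\<^sup>+x. h x \<partial>lborel)"
proof -
  have lin: "linear T" using T by (simp add: orthogonal_transformation_linear)
  have [measurable]: "T \<in> borel_measurable borel"
    using lin by (intro borel_measurable_continuous_onI linear_continuous_on) (simp add: linear_conv_bounded_linear)
  have shift: "(\<integral>\<^sup>+y. f (c + y) \<partial>lborel) = (\<integral>\<^sup>+y. f y \<partial>lborel)"
    if [measurable]: "f \<in> borel_measurable borel" for f :: "'a \<Rightarrow> ennreal" and c
    by (subst (2) lborel_distr_plus[of c, symmetric]) (simp add: nn_integral_distr)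
  define A where "A = (indicator (ball 0 1) :: 'a \<Rightarrow> ennreal)"
  have [measurable]: "A \<in> borel_measurable borel" by (simp add: A_def borel_measurable_indicator)
  define V where "V = emeasure lborel (ball (0::'a) 1)"
  \<comment> \<open>The factor \<open>V\<close> is cancelled at the end, so it must be neither 0 nor
    infinite.\<close>
  have "unit_ball_vol (real DIM('a)) \<noteq> 0" by (metis less_irrefl of_nat_0_le_iff unit_ball_vol_pos)
  then have V: "V \<noteq> 0" "V \<noteq> \<infinity>"
    by (auto simp: V_def emeasure_lborel_ball_finite less_top emeasure_ball)
  have A1: "(\<integral>\<^sup>+x. A x \<partial>lborel) = V" by (simp add: A_def V_def)
  have A2: "(\<integral>\<^sup>+y. A (x - T y) \<partial>lborel) = V" for x
  proof -
    obtain z where z: "x = T z"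
      using orthogonal_transformation_surj[OF T] by (metis surjD)
    have "A (x - T y) = indicator (ball z 1) y" for y
      using T by (simp add: A_def z orthogonal_transformation_norm indicator_def dist_norm
          flip: linear_diff[OF lin])
    then show ?thesis by (simp add: V_def emeasure_ball)
  qed
  have A3: "(\<integral>\<^sup>+y. A x * h (T y) \<partial>lborel) = (\<integral>\<^sup>+y. A x * h (x + T y) \<partial>lborel)" for x
  proof -
    obtain z where z: "x = T z"
      using orthogonal_transformation_surj[OF T] by (metis surjD)
    show ?thesis
      using shift[of "\<lambda>y. A x * h (T y)" z] by (simp add: linear_add[OF lin] z)
  qed
  have A4: "(\<integral>\<^sup>+x. A x * h (x + T y) \<partial>lborel) = (\<integral>\<^sup>+x. A (x - T y) * h x \<partial>lborel)" for y
    using shift[of "\<lambda>x. A (x - T y) * h x" "T y"] by (simp add: add.commute)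
  have "V * (\<integral>\<^sup>+y. h (T y) \<partial>lborel) = (\<integral>\<^sup>+x. \<integral>\<^sup>+y. A x * h (T y) \<partial>lborel \<partial>lborel)"
    by (simp add: nn_integral_cmult nn_integral_multc A1)
  also have "\<dots> = (\<integral>\<^sup>+x. \<integral>\<^sup>+y. A x * h (x + T y) \<partial>lborel \<partial>lborel)"
    by (simp add: A3)
  also have "\<dots> = (\<integral>\<^sup>+y. \<integral>\<^sup>+x. A x * h (x + T y) \<partial>lborel \<partial>lborel)"
    by (rule lborel_pair.Fubini') measurable
  also have "\<dots> = (\<integral>\<^sup>+y. \<integral>\<^sup>+x. A (x - T y) * h x \<partial>lborel \<partial>lborel)"
    by (simp add: A4)
  also have "\<dots> = (\<integral>\<^sup>+x. \<integral>\<^sup>+y. A (x - T y) * h x \<partial>lborel \<partial>lborel)"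
    by (rule lborel_pair.Fubini') measurable
  also have "\<dots> = V * (\<integral>\<^sup>+x. h x \<partial>lborel)"
    by (simp add: nn_integral_cmult nn_integral_multc A2)
  finally show ?thesis using V by (simp add: ennreal_mult_cancel_left)
qed

text \<open>Both measures give \<open>{..x}\<close> the volume of the ball of radius
  \<open>x\<close> in dimension \<open>m\<close>, and half-lines form an intersection-stable
  generator. The density is the area of the sphere of radius \<open>r\<close>.\<close>

lemma distr_norm_PiM_lborel:
  fixes I :: "'i set"
  assumes "finite I" "I \<noteq> {}"
  defines "m \<equiv> card I"
  shows "distr (Pi\<^sub>M I (\<lambda>_. lborel)) borel (\<lambda>z. sqrt (\<Sum>i\<in>I. (z i)\<^sup>2)) =
    density lborel (\<lambda>r. ennreal (m * unit_ball_vol m * r ^ (m - 1)) * indicator {0..} r)" (is "?M = ?N")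
proof (rule measure_eqI_generator_eq[where A = "\<lambda>i::nat. {..real i}" and \<Omega> = UNIV and E = "range (\<lambda>x. {..x})"])
  have m: "m > 0" using assms by (simp add: m_def card_gt_0_iff)
  let ?P = "Pi\<^sub>M I (\<lambda>_. lborel :: real measure)"
  let ?s = "\<lambda>z. sqrt (\<Sum>i\<in>I. (z i)\<^sup>2) :: real"
  have [measurable]: "?s \<in> borel_measurable ?P" using assms by measurable
  have M: "emeasure ?M {..x} = (if x \<ge> 0 then ennreal (unit_ball_vol m * x ^ m) else 0)" for x
  proof -
    have pos: "emeasure ?M {..x} = ennreal (unit_ball_vol m * x ^ m)" if "x > 0" for x
    proof -
      have "emeasure ?M {..x} = emeasure ?P ({f. ?s f \<le> x} \<inter> space ?P)"
        by (subst emeasure_distr) (auto simp: vimage_def)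
      then show ?thesis using emeasure_cball_aux[OF assms(1) that] by (simp add: m_def)
    qed
    \<comment> \<open>\<open>emeasure_cball_aux\<close> needs a positive radius. The value at radius
      0 is therefore squeezed below the volume \<open>e\<close> of a small ball, for every
      \<open>e > 0\<close>.\<close>
    have zero: "emeasure ?M {..0} = 0"
    proof -
      have "emeasure ?M {..0} \<le> ennreal e" if "e > 0" for e
      proof -
        let ?x = "root m (e / unit_ball_vol m)"
        have x: "?x > 0" using that m by (simp add: unit_ball_vol_pos)
        have "emeasure ?M {..0} \<le> emeasure ?M {..?x}" using x by (intro emeasure_mono) auto
        also have "\<dots> = ennreal e"
          using pos[OF x] m that unit_ball_vol_pos[of m]
          by (simp add: real_root_pow_pos2 less_imp_neq[symmetric])
        finally show ?thesis .
      qed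
      then show ?thesis by (metis ennreal_le_epsilon add_0 le_zero_eq)
    qed
    have neg: "emeasure ?M {..x} = 0" if "x < 0" for x
      using emeasure_mono[of "{..x}" "{..0}" ?M] that zero by auto
    show ?thesis using pos[of x] zero neg[of x] m by (cases "x = 0") auto
  qed
  have N: "emeasure ?N {..x} = (if x \<ge> 0 then ennreal (unit_ball_vol m * x ^ m) else 0)" for x
  proof -
    have "emeasure ?N {..x} = (\<integral>\<^sup>+r. ennreal (m * unit_ball_vol m * r ^ (m - 1)) * indicator {0..x} r \<partial>lborel)"
      by (subst emeasure_density) (auto intro!: nn_integral_cong split: split_indicator)
    also have "\<dots> = (if x \<ge> 0 then ennreal (unit_ball_vol m * x ^ m) else 0)"
    proof (cases "x \<ge> 0")
      case True
      have "(\<integral>\<^sup>+r. ennreal (m * unit_ball_vol m * r ^ (m - 1)) * indicator {0..x} r \<partial>lborel)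
        = ennreal (unit_ball_vol m * x ^ m - unit_ball_vol m * 0 ^ m)"
        using True by (intro nn_integral_FTC_Icc) (auto intro!: derivative_eq_intros simp: unit_ball_vol_nonneg)
      then show ?thesis using True m by simp
    qed simp
    finally show ?thesis .
  qed
  show "Int_stable (range (\<lambda>x::real. {..x}))"
    by (auto simp: Int_stable_def)
  show "emeasure ?M X = emeasure ?N X" if "X \<in> range (\<lambda>x. {..x})" for X
    using that M N by auto
  show "sets ?M = sigma_sets UNIV (range (\<lambda>x. {..x}))" "sets ?N = sigma_sets UNIV (range (\<lambda>x. {..x}))"
    by (simp_all add: borel_eq_atMost)
  show "(\<Union>i. {..real i}) = UNIV" using real_arch_simple by auto
  show "emeasure ?M {..real i} \<noteq> \<infinity>" for i by (simp add: M)
qed auto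

text \<open>Cylindrical coordinates: Fubini separates the coordinate \<open>i\<close>, and the
  others enter only through their norm, whose distribution is known.\<close>

lemma nn_integral_PiM_axis_norm:
  fixes I :: "'i set"
  assumes I: "finite I" "I \<noteq> {}" "i \<notin> I" and \<Phi>[measurable]: "case_prod \<Phi> \<in> borel_measurable (borel \<Otimes>\<^sub>M borel)"
  defines "m \<equiv> card I"
  shows "(\<integral>\<^sup>+z. \<Phi> (z i) (sqrt (\<Sum>j\<in>I. (z j)\<^sup>2)) \<partial>Pi\<^sub>M (insert i I) (\<lambda>_. lborel)) =
    ennreal (m * unit_ball_vol m) *
      (\<integral>\<^sup>+u. \<integral>\<^sup>+r. ennreal (r ^ (m - 1)) * indicator {0..} r * \<Phi> u r \<partial>lborel \<partial>lborel)"
proof -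
  interpret product_sigma_finite "\<lambda>_::'i. lborel :: real measure" ..
  let ?c = "m * unit_ball_vol m"
  have c: "?c \<ge> 0" by (simp add: unit_ball_vol_nonneg)
  have meas: "(\<lambda>z. \<Phi> (z i) (sqrt (\<Sum>j\<in>I. (z j)\<^sup>2))) \<in> borel_measurable (Pi\<^sub>M (insert i I) (\<lambda>_. lborel))"
    using I by measurable
  have [measurable]: "\<Phi> u \<in> borel_measurable borel" for u
    by measurable
  have "(\<integral>\<^sup>+z. \<Phi> (z i) (sqrt (\<Sum>j\<in>I. (z j)\<^sup>2)) \<partial>Pi\<^sub>M (insert i I) (\<lambda>_. lborel)) =
      (\<integral>\<^sup>+u. \<integral>\<^sup>+z. \<Phi> u (sqrt (\<Sum>j\<in>I. ((z(i := u)) j)\<^sup>2)) \<partial>Pi\<^sub>M I (\<lambda>_. lborel) \<partial>lborel)"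
    using product_nn_integral_insert_rev[OF I(1,3) meas] by simp
  also have "\<dots> = (\<integral>\<^sup>+u. \<integral>\<^sup>+z. \<Phi> u (sqrt (\<Sum>j\<in>I. (z j)\<^sup>2)) \<partial>Pi\<^sub>M I (\<lambda>_. lborel) \<partial>lborel)"
    using I by (intro nn_integral_cong arg_cong2[where f=\<Phi>] arg_cong[where f=sqrt] sum.cong) auto
  also have "\<dots> = (\<integral>\<^sup>+u. \<integral>\<^sup>+r. \<Phi> u r \<partial>distr (Pi\<^sub>M I (\<lambda>_. lborel)) borel (\<lambda>z. sqrt (\<Sum>i\<in>I. (z i)\<^sup>2)) \<partial>lborel)"
    using I by (subst nn_integral_distr) auto
  also have "\<dots> = (\<integral>\<^sup>+u. \<integral>\<^sup>+r. ennreal (?c * r ^ (m - 1)) * indicator {0..} r * \<Phi> u r \<partial>lborel \<partial>lborel)"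
    using I by (simp add: distr_norm_PiM_lborel nn_integral_density m_def mult.assoc)
  also have "\<dots> = (\<integral>\<^sup>+u. \<integral>\<^sup>+r. ennreal ?c * (ennreal (r ^ (m - 1)) * indicator {0..} r * \<Phi> u r) \<partial>lborel \<partial>lborel)"
    using c by (intro nn_integral_cong) (auto simp: ennreal_mult mult.assoc split: split_indicator)
  also have "\<dots> = ennreal ?c * (\<integral>\<^sup>+u. \<integral>\<^sup>+r. ennreal (r ^ (m - 1)) * indicator {0..} r * \<Phi> u r \<partial>lborel \<partial>lborel)"
    by (simp add: nn_integral_cmult)
  finally show ?thesis by simp
qed

section \<open>Polar coordinates for zonal functions\<close>

lemma nn_integral_lborel_abs:
  fixes h :: "real \<Rightarrow> ennreal"
  assumes [measurable]: "h \<in> borel_measurable borel"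
  shows "(\<integral>\<^sup>+u. h \<bar>u\<bar> \<partial>lborel) = 2 * (\<integral>\<^sup>+u. indicator {0..} u * h u \<partial>lborel)"
proof -
  have "(\<integral>\<^sup>+u. h \<bar>u\<bar> \<partial>lborel) = (\<integral>\<^sup>+u. indicator {0..} u * h u + indicator {..0} u * h (-u) \<partial>lborel)"
    by (rule nn_integral_cong_AE, rule AE_mp[OF AE_lborel_singleton[of 0]])
       (auto intro!: AE_I2 split: split_indicator)
  also have "\<dots> = (\<integral>\<^sup>+u. indicator {0..} u * h u \<partial>lborel) + (\<integral>\<^sup>+u. indicator {..0} u * h (-u) \<partial>lborel)"
    by (rule nn_integral_add) measurable
  also have "(\<integral>\<^sup>+u. indicator {..0} u * h (-u) \<partial>lborel) = (\<integral>\<^sup>+u. indicator {0..} u * h u \<partial>lborel)"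
    by (subst nn_integral_real_affine[where c="-1" and t=0]) (auto intro!: nn_integral_cong split: split_indicator)
  finally show ?thesis by (simp add: mult_2)
qed

text \<open>The factor \<open>r / sqrt (1 - v\<^sup>2) ^ 3\<close> is the derivative of
  \<open>u = r v / sqrt (1 - v\<^sup>2)\<close>. This map is singular at \<open>v = 1\<close>; the
  support bound \<open>B\<close> confines the substitution to a compact interval
  \<open>[0, b]\<close> with \<open>b < 1\<close>.\<close>

lemma nn_integral_polar_inner:
  fixes \<Psi> :: "real \<Rightarrow> real \<Rightarrow> ennreal"
  assumes [measurable]: "case_prod \<Psi> \<in> borel_measurable (borel \<Otimes>\<^sub>M borel)"
    and supp: "\<And>R v. R \<ge> B \<Longrightarrow> \<Psi> R v = 0" and r: "r > 0"
  shows "(\<integral>\<^sup>+u. indicator {0..} u * \<Psi> (sqrt (u\<^sup>2 + r\<^sup>2)) (u / sqrt (u\<^sup>2 + r\<^sup>2)) \<partial>lborel) =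
    (\<integral>\<^sup>+v. indicator {0..<1} v * (ennreal (r / sqrt (1 - v\<^sup>2) ^ 3) * \<Psi> (r / sqrt (1 - v\<^sup>2)) v) \<partial>lborel)"
proof (cases "r < B")
  case False
  have "\<Psi> (sqrt (u\<^sup>2 + r\<^sup>2)) (u / sqrt (u\<^sup>2 + r\<^sup>2)) = 0" for u
    using False r by (intro supp) (meson le_add_same_cancel2 not_le order_trans real_le_rsqrt zero_le_power2)
  moreover have "\<Psi> (r / sqrt (1 - v\<^sup>2)) v = 0" if "v \<in> {0..<1}" for v
  proof (rule supp)
    have "0 < 1 - v\<^sup>2" "1 - v\<^sup>2 \<le> 1" using that by (auto simp: power_less_one_iff abs_square_less_1)
    then have "r \<le> r / sqrt (1 - v\<^sup>2)" using r by (simp add: field_simps)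
    then show "B \<le> r / sqrt (1 - v\<^sup>2)" using False by simp
  qed
  ultimately have "(\<integral>\<^sup>+v. indicator {0..<1} v * (ennreal (r / sqrt (1 - v\<^sup>2) ^ 3) * \<Psi> (r / sqrt (1 - v\<^sup>2)) v) \<partial>lborel) =
      (\<integral>\<^sup>+u. indicator {0..} u * \<Psi> (sqrt (u\<^sup>2 + r\<^sup>2)) (u / sqrt (u\<^sup>2 + r\<^sup>2)) \<partial>lborel)"
    by (intro nn_integral_cong) (auto split: split_indicator)
  then show ?thesis by simp
next
  case True
  \<comment> \<open>For fixed \<open>r < B\<close> the radius
    \<open>sqrt (u\<^sup>2 + r\<^sup>2)\<close> reaches \<open>B\<close> at \<open>u = a\<close>,
    where the cosine of the angle to the axis is \<open>b = a / B\<close>.\<close>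
  define a where "a = sqrt (B\<^sup>2 - r\<^sup>2)"
  define b where "b = a / B"
  define g where "g v = r * v / sqrt (1 - v\<^sup>2)" for v
  have B: "B > 0" using True r by simp
  have rB: "r\<^sup>2 < B\<^sup>2" using True r by (simp add: power_strict_mono)
  have a: "0 < a" "a\<^sup>2 = B\<^sup>2 - r\<^sup>2" using rB by (simp_all add: a_def)
  have b2: "1 - b\<^sup>2 = (r / B)\<^sup>2" using B by (simp add: b_def power_divide a field_simps)
  have b0: "0 < b" using a B by (simp add: b_def)
  have b1: "b < 1"
  proof -
    have "b\<^sup>2 < 1" using b2 r B by (smt (verit) divide_pos_pos zero_less_power)
    then show ?thesis using b0 by (simp add: abs_square_less_1)
  qed
  have w: "0 < sqrt (1 - v\<^sup>2)" "(sqrt (1 - v\<^sup>2))\<^sup>2 = 1 - v\<^sup>2" if "0 \<le> v" "v < 1" for v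
    using that by (auto simp: abs_square_less_1 abs_square_le_1)
  have gb: "g b = a"
  proof -
    have "sqrt (1 - b\<^sup>2) = r / B" using b2 r B by (simp add: real_sqrt_unique)
    then show ?thesis using r B by (simp add: g_def b_def)
  qed
  have deriv: "(g has_real_derivative r / sqrt (1 - v\<^sup>2) ^ 3) (at v)" if "v \<in> {0..b}" for v
  proof -
    let ?w = "sqrt (1 - v\<^sup>2)"
    have v: "0 \<le> v" "v < 1" using that b1 by auto
    have w2: "?w * ?w = 1 - v * v" and w0: "?w > 0" and w0': "1 - v\<^sup>2 > 0" 
      using w[OF v] by (simp_all add: power2_eq_square)
    have "(g has_real_derivative (r * ?w - r * v * (inverse ?w / 2 * (- 2 * v))) / (?w * ?w)) (at v)"
      unfolding g_def using w0 w0' by (auto intro!: derivative_eq_intros simp: power2_eq_square)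
    also have "(r * ?w - r * v * (inverse ?w / 2 * (- 2 * v))) / (?w * ?w) = r * (?w * ?w + v * v) / ?w ^ 3"
      using w0 by (simp add: divide_simps power3_eq_cube) (simp add: algebra_simps)
    also have "\<dots> = r / ?w ^ 3" using w2 by simp
    finally show ?thesis .
  qed
  have gv: "sqrt ((g v)\<^sup>2 + r\<^sup>2) = r / sqrt (1 - v\<^sup>2)" "g v / (r / sqrt (1 - v\<^sup>2)) = v"
    if "0 \<le> v" "v < 1" for v
  proof -
    have "(g v)\<^sup>2 + r\<^sup>2 = (r / sqrt (1 - v\<^sup>2))\<^sup>2"
      using w[OF that] by (simp add: g_def power_divide power_mult_distrib divide_simps) (simp add: algebra_simps)
    then show "sqrt ((g v)\<^sup>2 + r\<^sup>2) = r / sqrt (1 - v\<^sup>2)" using w[OF that] r by (simp add: real_sqrt_unique)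
    show "g v / (r / sqrt (1 - v\<^sup>2)) = v" using w[OF that] r by (simp add: g_def)
  qed
  let ?F = "\<lambda>u. \<Psi> (sqrt (u\<^sup>2 + r\<^sup>2)) (u / sqrt (u\<^sup>2 + r\<^sup>2))"
  have "(\<integral>\<^sup>+u. indicator {0..} u * ?F u \<partial>lborel) = (\<integral>\<^sup>+u. ?F u * indicator {g 0..g b} u \<partial>lborel)"
  proof (rule nn_integral_cong)
    fix u
    have "?F u = 0" if "u > a"
    proof (rule supp)
      have "a\<^sup>2 < u\<^sup>2" using that a by (intro power_strict_mono) auto
      then show "B \<le> sqrt (u\<^sup>2 + r\<^sup>2)" using a(2) by (intro real_le_rsqrt) simp
    qed
    then show "indicator {0..} u * ?F u = ?F u * indicator {g 0..g b} u"
      by (auto simp: gb g_def[of 0] split: split_indicator)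
  qed
  also have "\<dots> = (\<integral>\<^sup>+v. ?F (g v) * ennreal (r / sqrt (1 - v\<^sup>2) ^ 3) * indicator {0..b} v \<partial>lborel)"
  proof (rule nn_integral_substitution_aux[OF _ _ deriv _ _ b0])
    have [simp]: "v\<^sup>2 \<noteq> 1" if "0 \<le> v" "v \<le> b" for v
      using w(1)[of v] that b1 by auto
    show "continuous_on {0..b} (\<lambda>v. r / sqrt (1 - v\<^sup>2) ^ 3)"
      by (intro continuous_intros) auto
    show "0 \<le> r / sqrt (1 - v\<^sup>2) ^ 3" if "v \<in> {0..b}" for v
      using w[of v] that b1 r by auto
  qed auto
  also have "\<dots> = (\<integral>\<^sup>+v. indicator {0..<1} v * (ennreal (r / sqrt (1 - v\<^sup>2) ^ 3) * \<Psi> (r / sqrt (1 - v\<^sup>2)) v) \<partial>lborel)"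
  proof (rule nn_integral_cong)
    fix v
    show "?F (g v) * ennreal (r / sqrt (1 - v\<^sup>2) ^ 3) * indicator {0..b} v =
       indicator {0..<1} v * (ennreal (r / sqrt (1 - v\<^sup>2) ^ 3) * \<Psi> (r / sqrt (1 - v\<^sup>2)) v)"
    proof (cases "0 \<le> v \<and> v < 1")
      case True
      have "\<Psi> (r / sqrt (1 - v\<^sup>2)) v = 0" if "v > b"
      proof (rule supp)
        have "b\<^sup>2 < v\<^sup>2" using that b0 by (intro power_strict_mono) auto
        then have "1 - v\<^sup>2 \<le> (r / B)\<^sup>2" using b2 by simp
        then have "sqrt (1 - v\<^sup>2) \<le> r / B" using r B by (simp add: real_le_lsqrt)
        then show "B \<le> r / sqrt (1 - v\<^sup>2)" using w[of v] True B by (simp add: field_simps)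
      qed
      then show ?thesis using True gv[of v] b1 by (auto simp: mult.commute split: split_indicator)
    next
      case False
      then show ?thesis using b1 by (auto split: split_indicator)
    qed
  qed
  finally show ?thesis .
qed

text \<open>
  Substituting \<open>u = r v / sqrt (1 - v\<^sup>2)\<close> for fixed \<open>r\<close> makes \<open>v\<close> the cosine of the angle to the axis and
  keeps all exponents natural numbers.
\<close>

lemma nn_integral_polar:
  fixes \<Psi> :: "real \<Rightarrow> real \<Rightarrow> ennreal"
  assumes m: "m \<ge> 2" and [measurable]: "case_prod \<Psi> \<in> borel_measurable (borel \<Otimes>\<^sub>M borel)"
    and supp: "\<And>R v. R \<ge> B \<Longrightarrow> \<Psi> R v = 0"
  shows "(\<integral>\<^sup>+u. \<integral>\<^sup>+r. ennreal (r ^ (m - 1)) * indicator {0..} r *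
            \<Psi> (sqrt (u\<^sup>2 + r\<^sup>2)) (\<bar>u\<bar> / sqrt (u\<^sup>2 + r\<^sup>2)) \<partial>lborel \<partial>lborel) =
    2 * (\<integral>\<^sup>+v. indicator {0..1} v * ennreal (sqrt (1 - v\<^sup>2) ^ (m - 2)) *
         (\<integral>\<^sup>+R. indicator {0..} R * ennreal (R ^ m) * \<Psi> R v \<partial>lborel) \<partial>lborel)"
proof -
  let ?F = "\<lambda>r u. \<Psi> (sqrt (u\<^sup>2 + r\<^sup>2)) (\<bar>u\<bar> / sqrt (u\<^sup>2 + r\<^sup>2))"
  let ?w = "\<lambda>v::real. sqrt (1 - v\<^sup>2)"
  obtain k where k: "m = Suc (Suc k)" using m by (metis add_2_eq_Suc le_Suc_ex)
  have "(\<integral>\<^sup>+u. \<integral>\<^sup>+r. ennreal (r ^ (m - 1)) * indicator {0..} r * ?F r u \<partial>lborel \<partial>lborel) =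
     (\<integral>\<^sup>+r. \<integral>\<^sup>+u. ennreal (r ^ (m - 1)) * indicator {0..} r * ?F r u \<partial>lborel \<partial>lborel)"
    by (rule lborel_pair.Fubini') measurable
  also have "\<dots> = (\<integral>\<^sup>+r. 2 * (\<integral>\<^sup>+v. ennreal (r ^ (m - 1)) * indicator {0<..} r * (indicator {0..<1} v *
        (ennreal (r / ?w v ^ 3) * \<Psi> (r / ?w v) v)) \<partial>lborel) \<partial>lborel)"
  proof (rule nn_integral_cong)
    fix r :: real
    show "(\<integral>\<^sup>+u. ennreal (r ^ (m - 1)) * indicator {0..} r * ?F r u \<partial>lborel) =
      2 * (\<integral>\<^sup>+v. ennreal (r ^ (m - 1)) * indicator {0<..} r * (indicator {0..<1} v *
        (ennreal (r / ?w v ^ 3) * \<Psi> (r / ?w v) v)) \<partial>lborel)"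
    proof (cases "r > 0")
      case True
      have "(\<integral>\<^sup>+u. ?F r u \<partial>lborel) = 2 * (\<integral>\<^sup>+u. indicator {0..} u * \<Psi> (sqrt (u\<^sup>2 + r\<^sup>2)) (u / sqrt (u\<^sup>2 + r\<^sup>2)) \<partial>lborel)"
        using nn_integral_lborel_abs[of "\<lambda>u. \<Psi> (sqrt (u\<^sup>2 + r\<^sup>2)) (u / sqrt (u\<^sup>2 + r\<^sup>2))"] by simp
      then show ?thesis using True
        by (simp add: nn_integral_polar_inner[OF assms(2) supp] nn_integral_cmult) (simp add: mult.left_commute)
    next
      case False
      then show ?thesis using k by (cases "r = 0") auto
    qed
  qed
  also have "\<dots> = 2 * (\<integral>\<^sup>+r. \<integral>\<^sup>+v. ennreal (r ^ (m - 1)) * indicator {0<..} r * (indicator {0..<1} v *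
        (ennreal (r / ?w v ^ 3) * \<Psi> (r / ?w v) v)) \<partial>lborel \<partial>lborel)"
    by (rule nn_integral_cmult) measurable
  also have "(\<integral>\<^sup>+r. \<integral>\<^sup>+v. ennreal (r ^ (m - 1)) * indicator {0<..} r * (indicator {0..<1} v *
        (ennreal (r / ?w v ^ 3) * \<Psi> (r / ?w v) v)) \<partial>lborel \<partial>lborel) =
     (\<integral>\<^sup>+v. \<integral>\<^sup>+r. ennreal (r ^ (m - 1)) * indicator {0<..} r * (indicator {0..<1} v *
        (ennreal (r / ?w v ^ 3) * \<Psi> (r / ?w v) v)) \<partial>lborel \<partial>lborel)"
    by (rule lborel_pair.Fubini') measurable
  also have "\<dots> = (\<integral>\<^sup>+v. indicator {0..1} v * ennreal (?w v ^ (m - 2)) *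
         (\<integral>\<^sup>+R. indicator {0..} R * ennreal (R ^ m) * \<Psi> R v \<partial>lborel) \<partial>lborel)"
  proof (rule nn_integral_cong_AE, rule AE_mp[OF AE_lborel_singleton[of 1]], intro AE_I2 impI)
    fix v :: real assume v1: "v \<noteq> 1"
    show "(\<integral>\<^sup>+r. ennreal (r ^ (m - 1)) * indicator {0<..} r * (indicator {0..<1} v *
        (ennreal (r / ?w v ^ 3) * \<Psi> (r / ?w v) v)) \<partial>lborel) = indicator {0..1} v * ennreal (?w v ^ (m - 2)) *
         (\<integral>\<^sup>+R. indicator {0..} R * ennreal (R ^ m) * \<Psi> R v \<partial>lborel)"
    proof (cases "0 \<le> v \<and> v < 1")
      case True
      then have w: "?w v > 0" by (simp add: abs_square_less_1)
      have "(\<integral>\<^sup>+r. ennreal (r ^ (m - 1)) * indicator {0<..} r * (indicator {0..<1} v *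
        (ennreal (r / ?w v ^ 3) * \<Psi> (r / ?w v) v)) \<partial>lborel) =
        (\<integral>\<^sup>+r. ennreal (r ^ (m - 1)) * indicator {0<..} r *
        (ennreal (r / ?w v ^ 3) * \<Psi> (r / ?w v) v) \<partial>lborel)" using True by simp
      \<comment> \<open>For fixed \<open>v\<close> substitute
        \<open>r = sqrt (1 - v\<^sup>2) * R\<close>. The exponents of the root add up to
        \<open>1 + (m - 1) + 1 - 3 = m - 2\<close>.\<close>
      also have "\<dots> = ennreal \<bar>?w v\<bar> * (\<integral>\<^sup>+R. ennreal ((0 + ?w v * R) ^ (m - 1)) * indicator {0<..} (0 + ?w v * R) *
        (ennreal ((0 + ?w v * R) / ?w v ^ 3) * \<Psi> ((0 + ?w v * R) / ?w v) v) \<partial>lborel)"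
        using w by (intro nn_integral_real_affine) auto
      also have "\<dots> = (\<integral>\<^sup>+R. ennreal (?w v) * (ennreal ((0 + ?w v * R) ^ (m - 1)) * indicator {0<..} (0 + ?w v * R) *
        (ennreal ((0 + ?w v * R) / ?w v ^ 3) * \<Psi> ((0 + ?w v * R) / ?w v) v)) \<partial>lborel)"
        using w by (simp add: nn_integral_cmult)
      also have "\<dots> = (\<integral>\<^sup>+R. ennreal (?w v ^ (m - 2)) * (indicator {0..} R * ennreal (R ^ m) * \<Psi> R v) \<partial>lborel)"
      proof (rule nn_integral_cong)
        fix R :: real
        show "ennreal (?w v) * (ennreal ((0 + ?w v * R) ^ (m - 1)) * indicator {0<..} (0 + ?w v * R) *
          (ennreal ((0 + ?w v * R) / ?w v ^ 3) * \<Psi> ((0 + ?w v * R) / ?w v) v)) =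
          ennreal (?w v ^ (m - 2)) * (indicator {0..} R * ennreal (R ^ m) * \<Psi> R v)"
        proof (cases "R > 0")
          case R: True
          have "c * ((c * R) ^ (m - 1) * (c * R / c ^ 3)) = c ^ (m - 2) * R ^ m" if "c > 0" for c :: real
            using that by (simp add: k power_mult_distrib power3_eq_cube field_simps)
          from this[OF w]
          have "?w v * ((?w v * R) ^ (m - 1) * (?w v * R / ?w v ^ 3)) = ?w v ^ (m - 2) * R ^ m" .
          then have "ennreal (?w v) * (ennreal ((?w v * R) ^ (m - 1)) * ennreal (?w v * R / ?w v ^ 3)) =
             ennreal (?w v ^ (m - 2)) * ennreal (R ^ m)"
            using w R by (simp flip: ennreal_mult')
          then show ?thesis using w R by (simp add: mult.assoc[symmetric])
        next
          case False
          then show ?thesis using w k by (cases "R = 0") (auto simp: mult_less_0_iff zero_less_mult_iff)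
        qed
      qed
      finally show ?thesis using True by (simp add: nn_integral_cmult)
    next
      case False
      then show ?thesis using v1 by auto
    qed
  qed
  finally show ?thesis .
qed

section \<open>Zonal integrals over the whole space and over slabs\<close>

lemma nn_integral_lborel_coordinates:
  fixes h :: "'a::euclidean_space \<Rightarrow> ennreal"
  assumes [measurable]: "h \<in> borel_measurable borel"
  shows "(\<integral>\<^sup>+x. h x \<partial>lborel) = (\<integral>\<^sup>+z. h (\<Sum>b\<in>Basis. z b *\<^sub>R b) \<partial>Pi\<^sub>M Basis (\<lambda>_. lborel))"
  by (subst lborel_eq) (simp add: nn_integral_distr)

lemma inner_sum_Basis:
  fixes z :: "'a::euclidean_space \<Rightarrow> real"
  assumes "b \<in> Basis"
  shows "(\<Sum>i\<in>Basis. z i *\<^sub>R i) \<bullet> b = z b"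
  using assms by (simp add: inner_sum_left inner_Basis if_distrib sum.delta cong: if_cong)

lemma norm_sum_Basis:
  fixes z :: "'a::euclidean_space \<Rightarrow> real"
  shows "norm (\<Sum>i\<in>Basis. z i *\<^sub>R i) = sqrt (\<Sum>b\<in>Basis. (z b)\<^sup>2)"
  by (subst norm_eq_sqrt_inner, subst euclidean_inner) (simp add: inner_sum_Basis power2_eq_square)

text \<open>\<open>C\<close> is twice the area of the unit sphere in dimension \<open>N - 1\<close>:
  each parallel of latitude is such a sphere up to scaling, and it occurs at the heights
  \<open>u\<close> and \<open>- u\<close>.\<close>

lemma nn_integral_lborel_zonal:
  fixes k :: "'n::finite"
  defines "N \<equiv> CARD('n)"
  defines "C \<equiv> 2 * (real (N - 1) * unit_ball_vol (real (N - 1)))"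
  assumes N: "N \<ge> 3" and [measurable]: "case_prod \<Psi> \<in> borel_measurable (borel \<Otimes>\<^sub>M borel)"
    and supp: "\<And>R v. R \<ge> B \<Longrightarrow> \<Psi> R v = 0"
  shows "(\<integral>\<^sup>+x. \<Psi> (norm x) (\<bar>(x::real^'n) $ k\<bar> / norm x) \<partial>lborel) =
    ennreal C * (\<integral>\<^sup>+v. indicator {0..1} v * ennreal (sqrt (1 - v\<^sup>2) ^ (N - 3)) *
         (\<integral>\<^sup>+R. indicator {0..} R * ennreal (R ^ (N - 1)) * \<Psi> R v \<partial>lborel) \<partial>lborel)"
proof -
  define e where "e = (axis k 1 :: real^'n)"
  define A where "A = Basis - {e}"
  have e: "e \<in> Basis" by (simp add: e_def axis_in_Basis_iff)
  have ins: "Basis = insert e A" "e \<notin> A" "finite A" using e by (auto simp: A_def)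
  have cA: "card A = N - 1" using e by (simp add: A_def N_def)
  have xe: "x $ k = x \<bullet> e" for x by (simp add: e_def inner_axis)
  have nz: "A \<noteq> {}" using cA N by auto
  have sB: "(\<Sum>b\<in>Basis. (z b)\<^sup>2) = (z e)\<^sup>2 + (\<Sum>b\<in>A. (z b)\<^sup>2)" for z :: "real^'n \<Rightarrow> real"
    using ins(2,3) by (subst ins(1)) simp
  define \<Phi> where "\<Phi> u r = \<Psi> (sqrt (u\<^sup>2 + r\<^sup>2)) (\<bar>u\<bar> / sqrt (u\<^sup>2 + r\<^sup>2))" for u r
  have [measurable]: "case_prod \<Phi> \<in> borel_measurable (borel \<Otimes>\<^sub>M borel)"
    unfolding \<Phi>_def by measurable
  have [measurable]: "(\<lambda>x. \<Psi> (norm x) (\<bar>x \<bullet> e\<bar> / norm x)) \<in> borel_measurable borel"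
    by measurable
  have "(\<integral>\<^sup>+x. \<Psi> (norm x) (\<bar>(x::real^'n) $ k\<bar> / norm x) \<partial>lborel) =
    (\<integral>\<^sup>+z. \<Phi> (z e) (sqrt (\<Sum>b\<in>A. (z b)\<^sup>2)) \<partial>Pi\<^sub>M (insert e A) (\<lambda>_. lborel))"
    unfolding xe
    by (subst nn_integral_lborel_coordinates) 
       (use e in \<open>auto simp: inner_sum_Basis norm_sum_Basis sB \<Phi>_def sum_nonneg simp flip: ins(1)\<close>)
  also have "\<dots> = ennreal (card A * unit_ball_vol (card A)) *
      (\<integral>\<^sup>+u. \<integral>\<^sup>+r. ennreal (r ^ (card A - 1)) * indicator {0..} r * \<Phi> u r \<partial>lborel \<partial>lborel)"
    using ins nz by (intro nn_integral_PiM_axis_norm) auto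
  also have "\<dots> = ennreal (card A * unit_ball_vol (card A)) * (2 * (\<integral>\<^sup>+v. indicator {0..1} v * ennreal (sqrt (1 - v\<^sup>2) ^ (N - 3)) *
         (\<integral>\<^sup>+R. indicator {0..} R * ennreal (R ^ (N - 1)) * \<Psi> R v \<partial>lborel) \<partial>lborel))"
    unfolding \<Phi>_def cA using nn_integral_polar[of "N - 1" \<Psi> B] N supp by (simp add: numeral_eq_Suc)
  also have "\<dots> = ennreal C * (\<integral>\<^sup>+v. indicator {0..1} v * ennreal (sqrt (1 - v\<^sup>2) ^ (N - 3)) *
         (\<integral>\<^sup>+R. indicator {0..} R * ennreal (R ^ (N - 1)) * \<Psi> R v \<partial>lborel) \<partial>lborel)"
    by (simp add: C_def cA ennreal_mult unit_ball_vol_nonneg mult_ac)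
  finally show ?thesis .
qed

text \<open>\<open>w\<close> is the normalised projection of the axis to the hyperplane orthogonal
  to \<open>\<xi>\<close>; the projection has length \<open>sqrt (1 - (\<xi> $ k)\<^sup>2)\<close>.
  If \<open>\<xi>\<close> is a pole, the projection vanishes and any unit vector of the hyperplane
  serves, because both sides of the last equation are 0.\<close>

lemma ex_orthonormal_axis:
  fixes \<xi> :: "real^'n"
  assumes \<xi>: "norm \<xi> = 1" and n: "CARD('n) \<ge> 2"
  obtains w where "norm w = 1" "w \<bullet> \<xi> = 0"
    "\<And>y. y \<bullet> \<xi> = 0 \<Longrightarrow> y $ k = sqrt (1 - (\<xi> $ k)\<^sup>2) * (y \<bullet> w)"
proof -
  define d where "d = axis k 1 - (\<xi> $ k) *\<^sub>R \<xi>"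
  have xk: "x $ k = x \<bullet> axis k 1" for x :: "real^'n" by (simp add: inner_axis)
  have \<xi>\<xi>: "\<xi> \<bullet> \<xi> = 1" using \<xi> by (simp add: norm_eq_1)
  have d\<xi>: "d \<bullet> \<xi> = 0" by (simp add: d_def inner_diff_left \<xi>\<xi> inner_axis' )
  have dd: "d \<bullet> d = 1 - (\<xi> $ k)\<^sup>2"
    by (simp add: d_def inner_diff_left inner_diff_right \<xi>\<xi> inner_axis inner_axis' power2_eq_square)
  then have nd: "norm d = sqrt (1 - (\<xi> $ k)\<^sup>2)" by (simp add: norm_eq_sqrt_inner)
  have yd: "y \<bullet> d = y $ k" if "y \<bullet> \<xi> = 0" for y
    using that by (simp add: d_def inner_diff_right inner_axis)
  show ?thesis
  proof (cases "d = 0")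
    case False
    show ?thesis
      by (rule that[of "sgn d"]) (use False in \<open>auto simp: norm_sgn sgn_div_norm d\<xi> yd simp flip: nd\<close>)
  next
    case True
    have "1 < DIM(real^'n)" using n by simp
    then obtain w0 where w0: "w0 \<noteq> 0" "orthogonal \<xi> w0"
      using orthogonal_to_vector_exists[of \<xi>] by auto
    show ?thesis
      by (rule that[of "sgn w0"]) (use True w0 yd nd in \<open>auto simp: norm_sgn sgn_div_norm orthogonal_def inner_commute\<close>)
  qed
qed

lemma ex_other_index:
  fixes k :: "'n::finite"
  assumes "CARD('n) \<ge> 2"
  obtains j where "j \<noteq> k"
proof -
  have "UNIV \<noteq> {k}"
  proof
    assume "UNIV = {k}"
    then have "CARD('n) = card {k}" by metis
    then show False using assms by simp
  qed
  then show ?thesis using that by blast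
qed

text \<open>An orthogonal map makes the normal \<open>\<xi>\<close> and the vector \<open>w\<close>
  of the hyperplane closest to the axis into coordinate directions. What remains are cylindrical
  coordinates in dimension \<open>n - 1\<close>, in which the component along the original axis is
  \<open>s\<close> times the new axial coordinate.\<close>

lemma nn_integral_slab_zonal:
  fixes k :: "'n::finite" and \<xi> :: "real^'n"
  defines "n \<equiv> CARD('n)"
  defines "C \<equiv> 2 * (real (n - 2) * unit_ball_vol (real (n - 2)))"
  defines "pr \<equiv> \<lambda>x. x - (x \<bullet> \<xi>) *\<^sub>R \<xi>"
  assumes n: "n \<ge> 4" and \<xi>: "norm \<xi> = 1"
    and [measurable]: "case_prod \<Psi> \<in> borel_measurable (borel \<Otimes>\<^sub>M borel)"
    and supp: "\<And>R v. R \<ge> B \<Longrightarrow> \<Psi> R v = 0"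
  shows "(\<integral>\<^sup>+x. indicator {0..1} (x \<bullet> \<xi>) * \<Psi> (norm (pr x)) (\<bar>pr x $ k\<bar> / norm (pr x)) \<partial>lborel) =
    ennreal C * (\<integral>\<^sup>+v. indicator {0..1} v * ennreal (sqrt (1 - v\<^sup>2) ^ (n - 4)) *
         (\<integral>\<^sup>+R. indicator {0..} R * ennreal (R ^ (n - 2)) * \<Psi> R (sqrt (1 - (\<xi> $ k)\<^sup>2) * v) \<partial>lborel) \<partial>lborel)"
proof -
  interpret product_sigma_finite "\<lambda>_::real^'n. lborel :: real measure" ..
  define s where "s = sqrt (1 - (\<xi> $ k)\<^sup>2)"
  have "\<bar>\<xi> $ k\<bar> \<le> 1" using component_le_norm_cart[of \<xi> k] \<xi> by simp
  then have s0: "s \<ge> 0" by (simp add: s_def abs_square_le_1)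
  obtain w where w: "norm w = 1" "w \<bullet> \<xi> = 0" "\<And>y. y \<bullet> \<xi> = 0 \<Longrightarrow> y $ k = s * (y \<bullet> w)"
    using ex_orthonormal_axis[OF \<xi>, of k] n unfolding n_def s_def by auto
  obtain j where j: "j \<noteq> k"
    using ex_other_index[of k] n unfolding n_def by auto
  define e where "e = (axis j 1 :: real^'n)"
  define e' where "e' = (axis k 1 :: real^'n)"
  have ee': "e \<bullet> e' = 0" "e \<noteq> e'" using j by (auto simp: e_def e'_def inner_axis_axis axis_eq_axis)
  have e1: "norm e = 1" "norm e' = 1" "e \<in> Basis" "e' \<in> Basis" by (auto simp: e_def e'_def axis_in_Basis_iff)
  \<comment> \<open>\<open>T1\<close> takes \<open>e\<close> to \<open>\<xi>\<close>;
    \<open>T2\<close> fixes \<open>e\<close> and takes \<open>e'\<close> to the preimage of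
    \<open>w\<close> under \<open>T1\<close>. Their composite carries the orthonormal pair
    \<open>e\<close>, \<open>e'\<close> to \<open>\<xi>\<close>, \<open>w\<close>.\<close>
  obtain T1 where T1: "orthogonal_transformation T1" "T1 e = \<xi>"
    using orthogonal_swap[of e \<xi>] e1 \<xi> by auto
  obtain w1 where w1: "T1 w1 = w" using orthogonal_transformation_surj[OF T1(1)] by (metis surjD)
  have w1': "norm w1 = 1" "e \<bullet> w1 = 0"
    using w(1,2) T1 w1 by (metis orthogonal_transformation_norm, metis inner_commute orthogonal_transformation_def)
  obtain T2 where T2: "orthogonal_transformation T2" "T2 e' = w1" "T2 e = e"
    using orthogonal_swap[of e' w1] e1 w1' ee' by metis
  define T where "T = T1 \<circ> T2"
  have T: "orthogonal_transformation T" "T e = \<xi>" "T e' = w"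
    using T1 T2 w1 by (auto simp: T_def orthogonal_transformation_compose)
  have Ti: "T x \<bullet> T y = x \<bullet> y" for x y using T(1) by (simp add: orthogonal_transformation_def)
  have lin: "linear T" using T(1) by (simp add: orthogonal_transformation_linear)
  define q where "q x = x - (x \<bullet> e) *\<^sub>R e" for x
  have Tx: "T x \<bullet> \<xi> = x \<bullet> e" for x using Ti[of x e] T(2) by simp
  have pr: "pr (T x) = T (q x)" for x
    by (simp add: pr_def q_def Tx linear_diff[OF lin] linear_scale[OF lin] T(2))
  have npr: "norm (pr (T x)) = norm (q x)" for x
    using T(1) by (simp add: pr orthogonal_transformation_norm)
  have prk: "pr (T x) $ k = s * (x \<bullet> e')" for x
  proof -
    have "pr (T x) \<bullet> \<xi> = 0" using \<xi> by (simp add: pr_def inner_diff_left norm_eq_1)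
    then have "pr (T x) $ k = s * (T (q x) \<bullet> T e')" using w(3) by (simp add: pr T(3))
    then show ?thesis by (simp add: Ti q_def inner_diff_left ee')
  qed
  define A where "A = Basis - {e, e'}"
  have ins: "Basis = insert e (insert e' A)" "e \<notin> insert e' A" "e' \<notin> A" "finite A" "finite (insert e' A)"
    using e1 ee' by (auto simp: A_def)
  have cA: "card A = n - 2" using e1 ee' by (simp add: A_def n_def card_Diff_subset)
  have nz: "A \<noteq> {}" using cA n by auto
  define \<Phi> where "\<Phi> u r = \<Psi> (sqrt (u\<^sup>2 + r\<^sup>2)) (s * (\<bar>u\<bar> / sqrt (u\<^sup>2 + r\<^sup>2)))" for u r
  have [measurable]: "case_prod \<Phi> \<in> borel_measurable (borel \<Otimes>\<^sub>M borel)"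
    unfolding \<Phi>_def by measurable
  have prm[measurable]: "pr \<in> borel_measurable borel" unfolding pr_def by measurable
  have prk': "pr x $ k = pr x \<bullet> e'" for x by (simp add: e'_def inner_axis)
  have [measurable]: "q \<in> borel_measurable borel" unfolding q_def by measurable
  have nq: "norm (q x) = sqrt ((x \<bullet> e')\<^sup>2 + (\<Sum>b\<in>A. (x \<bullet> b)\<^sup>2))" for x
  proof -
    have "q x \<bullet> b = (if b = e then 0 else x \<bullet> b)" if "b \<in> Basis" for b
      using that e1 by (auto simp: q_def inner_diff_left inner_Basis)
    then have "(\<Sum>b\<in>Basis. (q x \<bullet> b) * (q x \<bullet> b)) = (\<Sum>b\<in>Basis. if b = e then 0 else (x \<bullet> b)\<^sup>2)"
      by (intro sum.cong) (auto simp: power2_eq_square)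
    also have "\<dots> = (x \<bullet> e')\<^sup>2 + (\<Sum>b\<in>A. if b = e then 0 else (x \<bullet> b)\<^sup>2)"
      using ins(2-4) ee' by (subst ins(1)) auto
    also have "(\<Sum>b\<in>A. if b = e then 0 else (x \<bullet> b)\<^sup>2) = (\<Sum>b\<in>A. (x \<bullet> b)\<^sup>2)" using ins by (intro sum.cong) auto
    finally show ?thesis by (subst norm_eq_sqrt_inner, subst euclidean_inner) simp
  qed
  have "(\<integral>\<^sup>+x. indicator {0..1} (x \<bullet> \<xi>) * \<Psi> (norm (pr x)) (\<bar>pr x $ k\<bar> / norm (pr x)) \<partial>lborel) =
    (\<integral>\<^sup>+x. indicator {0..1} (T x \<bullet> \<xi>) * \<Psi> (norm (pr (T x))) (\<bar>pr (T x) $ k\<bar> / norm (pr (T x))) \<partial>lborel)"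
    unfolding prk' by (rule nn_integral_lborel_orthogonal[OF T(1), symmetric]) measurable
  also have "\<dots> = (\<integral>\<^sup>+x. indicator {0..1} (x \<bullet> e) * \<Phi> (x \<bullet> e') (sqrt (\<Sum>b\<in>A. (x \<bullet> b)\<^sup>2)) \<partial>lborel)"
    using s0 by (simp add: Tx npr prk nq \<Phi>_def sum_nonneg abs_mult)
  also have "\<dots> = (\<integral>\<^sup>+z. indicator {0..1} (z e) * \<Phi> (z e') (sqrt (\<Sum>b\<in>A. (z b)\<^sup>2)) \<partial>Pi\<^sub>M (insert e (insert e' A)) (\<lambda>_. lborel))"
  proof (subst nn_integral_lborel_coordinates, goal_cases)
    case 2
    have "(\<Sum>b\<in>A. ((\<Sum>i\<in>Basis. z i *\<^sub>R i) \<bullet> b)\<^sup>2) = (\<Sum>b\<in>A. (z b)\<^sup>2)" for z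
      by (intro sum.cong) (auto simp: inner_sum_Basis A_def)
    then show ?case using e1 by (simp add: inner_sum_Basis flip: ins(1))
  qed measurable
  \<comment> \<open>The coordinate along the normal is split off; as the slab has height 1, it
    contributes the factor 1.\<close>
  also have "\<dots> = (\<integral>\<^sup>+y. \<integral>\<^sup>+z. indicator {0..1} ((z(e := y)) e) * \<Phi> ((z(e := y)) e') (sqrt (\<Sum>b\<in>A. ((z(e := y)) b)\<^sup>2))
      \<partial>Pi\<^sub>M (insert e' A) (\<lambda>_. lborel) \<partial>lborel)"
  proof (rule product_nn_integral_insert_rev)
    let ?P = "Pi\<^sub>M (insert e (insert e' A)) (\<lambda>_. lborel :: real measure)"
    have [measurable]: "(\<lambda>z. z e) \<in> borel_measurable ?P" "(\<lambda>z. z e') \<in> borel_measurable ?P"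
      "(\<lambda>z. \<Sum>b\<in>A. (z b)\<^sup>2) \<in> borel_measurable ?P"
      using measurable_component_singleton[of _ "insert e (insert e' A)" "\<lambda>_. lborel :: real measure"]
      by (auto intro!: borel_measurable_sum borel_measurable_power)
    show "(\<lambda>z. indicator {0..1} (z e) * \<Phi> (z e') (sqrt (\<Sum>b\<in>A. (z b)\<^sup>2))) \<in> borel_measurable ?P"
      by measurable
  qed (use ins in auto)
  also have "\<dots> = (\<integral>\<^sup>+y. \<integral>\<^sup>+z. indicator {0..1} (y::real) * \<Phi> (z e') (sqrt (\<Sum>b\<in>A. (z b)\<^sup>2))
      \<partial>Pi\<^sub>M (insert e' A) (\<lambda>_. lborel) \<partial>lborel)"
  proof -
    have "(\<Sum>b\<in>A. ((z(e := y)) b)\<^sup>2) = (\<Sum>b\<in>A. (z b)\<^sup>2)" for z :: "real^'n \<Rightarrow> real" and y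
      using ins by (intro sum.cong) auto
    then show ?thesis using ee' by simp
  qed
  also have "\<dots> = (\<integral>\<^sup>+z. \<Phi> (z e') (sqrt (\<Sum>b\<in>A. (z b)\<^sup>2)) \<partial>Pi\<^sub>M (insert e' A) (\<lambda>_. lborel))"
    by (simp add: nn_integral_cmult nn_integral_multc)
  also have "\<dots> = ennreal (card A * unit_ball_vol (card A)) *
      (\<integral>\<^sup>+u. \<integral>\<^sup>+r. ennreal (r ^ (card A - 1)) * indicator {0..} r * \<Phi> u r \<partial>lborel \<partial>lborel)"
    using ins nz by (intro nn_integral_PiM_axis_norm) auto
  also have "\<dots> = ennreal (card A * unit_ball_vol (card A)) * (2 * (\<integral>\<^sup>+v. indicator {0..1} v * ennreal (sqrt (1 - v\<^sup>2) ^ (n - 4)) *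
         (\<integral>\<^sup>+R. indicator {0..} R * ennreal (R ^ (n - 2)) * \<Psi> R (s * v) \<partial>lborel) \<partial>lborel))"
    unfolding \<Phi>_def cA using nn_integral_polar[of "n - 2" "\<lambda>R v. \<Psi> R (s * v)" B] n supp by (simp add: numeral_eq_Suc)
  also have "\<dots> = ennreal C * (\<integral>\<^sup>+v. indicator {0..1} v * ennreal (sqrt (1 - v\<^sup>2) ^ (n - 4)) *
         (\<integral>\<^sup>+R. indicator {0..} R * ennreal (R ^ (n - 2)) * \<Psi> R (s * v) \<partial>lborel) \<partial>lborel)"
    by (simp add: C_def cA ennreal_mult unit_ball_vol_nonneg mult_ac)
  finally show ?thesis by (simp add: s_def)
qed

section \<open>Sphere measures and hyperplane sections of zonal data\<close>

lemma nn_integral_hyperplane_measure: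
  fixes \<xi> :: "'a::euclidean_space"
  assumes [measurable]: "h \<in> borel_measurable borel"
  shows "(\<integral>\<^sup>+y. h y \<partial>hyperplane_measure \<xi>) =
    (\<integral>\<^sup>+x. indicator {0..1} (x \<bullet> \<xi>) * h (x - (x \<bullet> \<xi>) *\<^sub>R \<xi>) \<partial>lborel)"
proof -
  have [measurable]: "{x. 0 \<le> x \<bullet> \<xi> \<and> x \<bullet> \<xi> \<le> 1} \<in> sets borel" by measurable
  have "(\<integral>\<^sup>+y. h y \<partial>hyperplane_measure \<xi>) = (\<integral>\<^sup>+x. h (x - (x \<bullet> \<xi>) *\<^sub>R \<xi>)
      \<partial>restrict_space lborel {x. 0 \<le> x \<bullet> \<xi> \<and> x \<bullet> \<xi> \<le> 1})"
    unfolding hyperplane_measure_def by (subst nn_integral_distr) (auto intro!: measurable_restrict_space1)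
  also have "\<dots> = (\<integral>\<^sup>+x. indicator {0..1} (x \<bullet> \<xi>) * h (x - (x \<bullet> \<xi>) *\<^sub>R \<xi>) \<partial>lborel)"
    by (subst nn_integral_restrict_space) (auto intro!: nn_integral_cong split: split_indicator)
  finally show ?thesis .
qed

lemma sets_hyperplane_measure [simp]: "sets (hyperplane_measure \<xi>) = sets borel"
  by (simp add: hyperplane_measure_def)

lemma sets_sphere_measure [simp]: "sets (sphere_measure d M) = sets (restrict_space borel (sphere 0 1))"
  by (simp add: sphere_measure_def)

lemma measurable_sphere_measure [simp]:
  "measurable (sphere_measure d M) N = measurable (restrict_space borel (sphere 0 1)) N"
  by (rule measurable_cong_sets) simp_all

lemma nn_integral_sphere_measure:
  fixes M :: "'a::euclidean_space measure"
  assumes M[measurable_cong]: "sets M = sets borel" and h[measurable]: "h \<in> borel_measurable borel"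
  shows "(\<integral>\<^sup>+\<theta>. h \<theta> \<partial>sphere_measure d M) =
    ennreal d * (\<integral>\<^sup>+x. indicator {0<..<1} (norm x) * h (sgn x) \<partial>M)"
proof -
  have hm: "h \<in> borel_measurable (distr (restrict_space M (ball 0 1 - {0})) (restrict_space borel (sphere 0 (1::real))) sgn)"
    unfolding measurable_distr_eq1 by (rule measurable_restrict_space1[OF h])
  have "sgn \<in> restrict_space M (ball 0 1 - {0}) \<rightarrow>\<^sub>M restrict_space borel (sphere 0 (1::real))"
  proof (rule measurable_restrict_space3)
    have "(\<lambda>x::'a. x /\<^sub>R norm x) \<in> borel_measurable M" by measurable
    then show "sgn \<in> borel_measurable M" by (simp add: sgn_div_norm[abs_def])
  qed (auto simp: norm_sgn)
  then have "(\<integral>\<^sup>+\<theta>. h \<theta> \<partial>distr (restrict_space M (ball 0 1 - {0})) (restrict_space borel (sphere 0 1)) sgn) =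
     (\<integral>\<^sup>+x. h (sgn x) \<partial>restrict_space M (ball 0 1 - {0}))"
    by (rule nn_integral_distr[OF _ hm])
  also have "\<dots> = (\<integral>\<^sup>+x. indicator {0<..<1} (norm x) * h (sgn x) \<partial>M)"
    using sets_eq_imp_space_eq[OF M] M
    by (subst nn_integral_restrict_space) (auto intro!: nn_integral_cong split: split_indicator)
  finally show ?thesis
    unfolding sphere_measure_def ennreal_of_nat_eq_real_of_nat
    by (subst nn_integral_scale_measure[OF hm]) simp
qed

section \<open>Image of the sphere measures under the cosine of the angle to the axis\<close>

lemma nn_integral_power_Icc:
  fixes b :: real
  assumes "0 \<le> b"
  shows "(\<integral>\<^sup>+R. ennreal (R ^ j) * indicator {0..b} R \<partial>lborel) = ennreal (b ^ Suc j / real (Suc j))"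
proof -
  have "(\<integral>\<^sup>+R. ennreal (R ^ j) * indicator {0..b} R \<partial>lborel) =
      ennreal (b ^ Suc j / real (Suc j) - 0 ^ Suc j / real (Suc j))"
    using assms DERIV_cdivide[OF DERIV_pow[of "Suc j"], where c = "real (Suc j)"]
    by (intro nn_integral_FTC_Icc) (auto simp del: of_nat_Suc power_Suc)
  then show ?thesis by simp
qed

text \<open>The radial integral over the cones that define \<open>sphere_measure d\<close>, for
  \<open>j = d - 1\<close>; its value cancels the factor \<open>d\<close>.\<close>

lemma nn_integral_power_Ioo:
  assumes "j > 0"
  shows "(\<integral>\<^sup>+R. indicator {0..} R * ennreal (R ^ j) * (indicator {0<..<1} R * c) \<partial>lborel) = ennreal (1 / Suc j) * c"
proof -
  have "(\<integral>\<^sup>+R. indicator {0..} R * ennreal (R ^ j) * (indicator {0<..<1} R * c) \<partial>lborel) =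
      (\<integral>\<^sup>+R. ennreal (R ^ j) * indicator {0..1} R * c \<partial>lborel)"
    by (rule nn_integral_cong_AE, rule AE_mp[OF AE_lborel_singleton[of 1]])
       (use assms in \<open>auto intro!: AE_I2 split: split_indicator\<close>)
  also have "\<dots> = ennreal (1 / Suc j) * c"
    using nn_integral_power_Icc[of 1 j] by (simp add: nn_integral_multc del: of_nat_Suc)
  finally show ?thesis .
qed

text \<open>Stated as an equality of measures so that the real-valued formula
  \<open>integral_sphere_axis\<close> follows for every Borel \<open>h\<close>, without an
  integrability condition.\<close>

lemma distr_sphere_measure_axis:
  fixes k :: "'n::finite"
  defines "N \<equiv> CARD('n)"
  assumes N: "N \<ge> 3"
  shows "\<exists>C>0. distr (sphere_measure N lborel) borel (\<lambda>\<theta>::real^'n. \<bar>\<theta> $ k\<bar>) =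
    density lborel (\<lambda>v. ennreal C * (indicator {0..1} v * ennreal (sqrt (1 - v\<^sup>2) ^ (N - 3))))"
proof -
  define C where "C = 2 * (real (N - 1) * unit_ball_vol (real (N - 1)))"
  have C: "C > 0" using N by (simp add: C_def unit_ball_vol_pos)
  have meas: "(\<lambda>\<theta>::real^'n. \<bar>\<theta> $ k\<bar>) \<in> borel_measurable borel"
    by (intro borel_measurable_continuous_onI continuous_intros)
  show ?thesis
  proof (intro exI[of _ C] conjI C measure_eqI)
    fix A assume "A \<in> sets (distr (sphere_measure N lborel) borel (\<lambda>\<theta>::real^'n. \<bar>\<theta> $ k\<bar>))"
    then have A[measurable]: "A \<in> sets borel" by simp
    let ?D = "density lborel (\<lambda>v. ennreal C * (indicator {0..1} v * ennreal (sqrt (1 - v\<^sup>2) ^ (N - 3))))"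
    define \<Psi> where "\<Psi> R v = (indicator {0<..<1} R * indicator A v :: ennreal)" for R v :: real
    have [measurable]: "case_prod \<Psi> \<in> borel_measurable (borel \<Otimes>\<^sub>M borel)" unfolding \<Psi>_def by measurable
    have "emeasure (distr (sphere_measure N lborel) borel (\<lambda>\<theta>::real^'n. \<bar>\<theta> $ k\<bar>)) A =
       (\<integral>\<^sup>+\<theta>. indicator A \<bar>\<theta> $ k\<bar> \<partial>sphere_measure N (lborel :: (real^'n) measure))"
      using meas by (subst nn_integral_indicator[symmetric], simp)
        (subst nn_integral_distr, auto intro!: measurable_restrict_space1)
    also have "\<dots> = ennreal N * (\<integral>\<^sup>+x. indicator {0<..<1} (norm x) * indicator A \<bar>sgn x $ k\<bar> \<partial>(lborel :: (real^'n) measure))"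
      using meas by (intro nn_integral_sphere_measure) auto
    also have "\<dots> = ennreal N * (\<integral>\<^sup>+x. \<Psi> (norm x) (\<bar>x $ k\<bar> / norm x) \<partial>(lborel :: (real^'n) measure))"
      by (simp add: \<Psi>_def sgn_div_norm abs_mult divide_inverse mult.commute)
    also have "\<dots> = ennreal N * (ennreal C * (\<integral>\<^sup>+v. indicator {0..1} v * ennreal (sqrt (1 - v\<^sup>2) ^ (N - 3)) *
         (\<integral>\<^sup>+R. indicator {0..} R * ennreal (R ^ (N - 1)) * \<Psi> R v \<partial>lborel) \<partial>lborel))"
      using N unfolding N_def C_def
      by (subst nn_integral_lborel_zonal[where B = 1]) (auto simp: \<Psi>_def)
    also have "\<dots> = ennreal N * (ennreal C * (\<integral>\<^sup>+v. ennreal (1 / N) * (indicator {0..1} v * ennreal (sqrt (1 - v\<^sup>2) ^ (N - 3)) *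
         indicator A v) \<partial>lborel))"
      using N nn_integral_power_Ioo[of "N - 1"] by (simp add: \<Psi>_def mult_ac)
    also have "\<dots> = ennreal N * (ennreal C * (ennreal (1 / N) * (\<integral>\<^sup>+v. indicator {0..1} v * ennreal (sqrt (1 - v\<^sup>2) ^ (N - 3)) *
         indicator A v \<partial>lborel)))"
      by (simp add: nn_integral_cmult)
    also have "\<dots> = (ennreal N * ennreal (1 / N)) * (ennreal C * (\<integral>\<^sup>+v. indicator {0..1} v * ennreal (sqrt (1 - v\<^sup>2) ^ (N - 3)) *
         indicator A v \<partial>lborel))"
      by (simp only: mult_ac)
    also have "ennreal N * ennreal (1 / N) = 1" using N by (simp flip: ennreal_mult')
    also have "1 * (ennreal C * (\<integral>\<^sup>+v. indicator {0..1} v * ennreal (sqrt (1 - v\<^sup>2) ^ (N - 3)) * indicator A v \<partial>lborel))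
       = emeasure ?D A"
      by (subst emeasure_density) (simp_all add: nn_integral_cmult mult.assoc)
    finally show "emeasure (distr (sphere_measure N lborel) borel (\<lambda>\<theta>::real^'n. \<bar>\<theta> $ k\<bar>)) A = emeasure ?D A" .
  qed simp
qed

text \<open>Inside the hyperplane the cosine \<open>v\<close> is measured from the projected axis,
  which shortens the original axial component to \<open>sqrt (1 - (\<xi> $ k)\<^sup>2) * v\<close>.
  The exponent is \<open>(n - 1) - 3\<close>, and \<open>C\<close> is the same for all
  \<open>\<xi>\<close>.\<close>

lemma distr_hyperplane_sphere_axis:
  fixes k :: "'n::finite"
  defines "n \<equiv> CARD('n)"
  assumes n: "n \<ge> 4"
  shows "\<exists>C>0. \<forall>\<xi>::real^'n. norm \<xi> = 1 \<longrightarrow>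
    distr (sphere_measure (n - 1) (hyperplane_measure \<xi>)) borel (\<lambda>\<theta>. \<bar>\<theta> $ k\<bar>) =
    distr (density lborel (\<lambda>v. ennreal C * (indicator {0..1} v * ennreal (sqrt (1 - v\<^sup>2) ^ (n - 4)))))
      borel (\<lambda>v. sqrt (1 - (\<xi> $ k)\<^sup>2) * v)"
proof -
  define C where "C = 2 * (real (n - 2) * unit_ball_vol (real (n - 2)))"
  have C: "C > 0" using n by (simp add: C_def unit_ball_vol_pos)
  have meas: "(\<lambda>\<theta>::real^'n. \<bar>\<theta> $ k\<bar>) \<in> borel_measurable borel"
    by (intro borel_measurable_continuous_onI continuous_intros)
  show ?thesis
  proof (intro exI[of _ C] conjI C measure_eqI allI impI)
    fix \<xi> :: "real^'n" and A
    let ?S = "sphere_measure (n - 1) (hyperplane_measure \<xi>)"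
    define s where "s = sqrt (1 - (\<xi> $ k)\<^sup>2)"
    let ?D = "density lborel (\<lambda>v. ennreal C * (indicator {0..1} v * ennreal (sqrt (1 - v\<^sup>2) ^ (n - 4))))"
    assume \<xi>: "norm \<xi> = 1" and "A \<in> sets (distr ?S borel (\<lambda>\<theta>. \<bar>\<theta> $ k\<bar>))"
    then have A[measurable]: "A \<in> sets borel" by simp
    define \<Psi> where "\<Psi> R v = (indicator {0<..<1} R * indicator A v :: ennreal)" for R v :: real
    have [measurable]: "case_prod \<Psi> \<in> borel_measurable (borel \<Otimes>\<^sub>M borel)" unfolding \<Psi>_def by measurable
    define pr where "pr = (\<lambda>x. x - (x \<bullet> \<xi>) *\<^sub>R \<xi>)"
    have m2: "(\<lambda>x. \<Psi> (norm x) (\<bar>x $ k\<bar> / norm x)) \<in> borel_measurable borel"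
      using meas by measurable
    have "emeasure (distr ?S borel (\<lambda>\<theta>. \<bar>\<theta> $ k\<bar>)) A = (\<integral>\<^sup>+\<theta>. indicator A \<bar>\<theta> $ k\<bar> \<partial>?S)"
      using meas by (subst nn_integral_indicator[symmetric], simp)
        (subst nn_integral_distr, auto intro!: measurable_restrict_space1)
    also have "\<dots> = ennreal (real (n - 1)) * (\<integral>\<^sup>+x. indicator {0<..<1} (norm x) * indicator A \<bar>sgn x $ k\<bar> \<partial>hyperplane_measure \<xi>)"
      using meas by (intro nn_integral_sphere_measure) auto
    also have "\<dots> = ennreal (real (n - 1)) * (\<integral>\<^sup>+x. \<Psi> (norm x) (\<bar>x $ k\<bar> / norm x) \<partial>hyperplane_measure \<xi>)"
      by (simp add: \<Psi>_def sgn_div_norm abs_mult divide_inverse mult.commute)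
    also have "\<dots> = ennreal (real (n - 1)) * (\<integral>\<^sup>+x. indicator {0..1} (x \<bullet> \<xi>) * \<Psi> (norm (pr x)) (\<bar>pr x $ k\<bar> / norm (pr x)) \<partial>lborel)"
      using nn_integral_hyperplane_measure[OF m2] by (simp add: pr_def)
    also have "\<dots> = ennreal (real (n - 1)) * (ennreal C * (\<integral>\<^sup>+v. indicator {0..1} v * ennreal (sqrt (1 - v\<^sup>2) ^ (n - 4)) *
         (\<integral>\<^sup>+R. indicator {0..} R * ennreal (R ^ (n - 2)) * \<Psi> R (s * v) \<partial>lborel) \<partial>lborel))"
      using n \<xi> unfolding n_def C_def s_def pr_def
      by (subst nn_integral_slab_zonal[where B = 1]) (auto simp: \<Psi>_def)
    also have "\<dots> = ennreal (real (n - 1)) * (ennreal C * (\<integral>\<^sup>+v. ennreal (1 / real (n - 1)) * (indicator {0..1} v * ennreal (sqrt (1 - v\<^sup>2) ^ (n - 4)) *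
         indicator A (s * v)) \<partial>lborel))"
    proof -
      have "Suc (n - 2) = n - 1" using n by simp
      then have inn: "(\<integral>\<^sup>+R. indicator {0..} R * ennreal (R ^ (n - 2)) * (indicator {0<..<1} R * c) \<partial>lborel) =
          ennreal (1 / real (n - 1)) * c" for c
        using nn_integral_power_Ioo[of "n - 2" c] n by simp
      then show ?thesis unfolding \<Psi>_def inn by (simp only: mult_ac)
    qed
    also have "\<dots> = ennreal (real (n - 1)) * (ennreal C * (ennreal (1 / real (n - 1)) * (\<integral>\<^sup>+v. indicator {0..1} v * ennreal (sqrt (1 - v\<^sup>2) ^ (n - 4)) *
         indicator A (s * v) \<partial>lborel)))"
      by (simp add: nn_integral_cmult)
    also have "\<dots> = (ennreal (real (n - 1)) * ennreal (1 / real (n - 1))) * (ennreal C * (\<integral>\<^sup>+v. indicator {0..1} v * ennreal (sqrt (1 - v\<^sup>2) ^ (n - 4)) *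
         indicator A (s * v) \<partial>lborel))"
      by (simp only: mult_ac)
    also have "ennreal (real (n - 1)) * ennreal (1 / real (n - 1)) = 1" using n by (simp flip: ennreal_mult')
    also have "1 * (ennreal C * (\<integral>\<^sup>+v. indicator {0..1} v * ennreal (sqrt (1 - v\<^sup>2) ^ (n - 4)) * indicator A (s * v) \<partial>lborel))
       = (\<integral>\<^sup>+v. indicator A (s * v) \<partial>?D)"
      by (subst nn_integral_density) (simp_all add: nn_integral_cmult mult.assoc)
    also have "\<dots> = emeasure (distr ?D borel (\<lambda>v. s * v)) A"
    proof -
      have "emeasure (distr ?D borel (\<lambda>v. s * v)) A = (\<integral>\<^sup>+v. indicator A v \<partial>distr ?D borel (\<lambda>v. s * v))" by simp
      also have "\<dots> = (\<integral>\<^sup>+v. indicator A (s * v) \<partial>?D)" by (subst nn_integral_distr) simp_all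
      finally show ?thesis by (rule sym)
    qed
    finally show "emeasure (distr ?S borel (\<lambda>\<theta>. \<bar>\<theta> $ k\<bar>)) A =
        emeasure (distr ?D borel (\<lambda>v. sqrt (1 - (\<xi> $ k)\<^sup>2) * v)) A" by (simp add: s_def)
  qed simp
qed

section \<open>Real-valued zonal integrals and volumes of central sections\<close>

lemma integral_sphere_axis:
  fixes k :: "'n::finite"
  defines "N \<equiv> CARD('n)"
  assumes N: "N \<ge> 3"
  shows "\<exists>C>0. \<forall>h\<in>borel_measurable borel. (\<integral>\<theta>. h \<bar>\<theta> $ k\<bar> \<partial>sphere_measure N (lborel :: (real^'n) measure)) =
     C * (\<integral>v. indicator {0..1} v * (sqrt (1 - v\<^sup>2) ^ (N - 3) * h v) \<partial>lborel :: real)"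
proof -
  have [measurable]: "(\<lambda>\<theta>::real^'n. \<bar>\<theta> $ k\<bar>) \<in> borel_measurable (restrict_space borel (sphere 0 1))"
    by (intro measurable_restrict_space1 borel_measurable_continuous_onI continuous_intros)
  obtain C where C: "C > 0" and eq: "distr (sphere_measure N lborel) borel (\<lambda>\<theta>::real^'n. \<bar>\<theta> $ k\<bar>) =
    density lborel (\<lambda>v. ennreal C * (indicator {0..1} v * ennreal (sqrt (1 - v\<^sup>2) ^ (N - 3))))"
    using distr_sphere_measure_axis[of k] N by (auto simp: N_def)
  let ?d = "\<lambda>v::real. C * (indicator {0..1} v * sqrt (1 - v\<^sup>2) ^ (N - 3))"
  have d: "ennreal C * (indicator {0..1} v * ennreal (sqrt (1 - v\<^sup>2) ^ (N - 3))) = ennreal (?d v)" 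
    and d0: "?d v \<ge> 0" for v
    using C by (auto simp: ennreal_mult abs_square_le_1 split: split_indicator)
  show ?thesis
  proof (intro exI[of _ C] conjI C ballI)
    fix h :: "real \<Rightarrow> real" assume [measurable]: "h \<in> borel_measurable borel"
    have "(\<integral>\<theta>. h \<bar>\<theta> $ k\<bar> \<partial>sphere_measure N (lborel :: (real^'n) measure)) =
       (\<integral>v. h v \<partial>distr (sphere_measure N lborel) borel (\<lambda>\<theta>::real^'n. \<bar>\<theta> $ k\<bar>))"
      by (subst integral_distr) auto
    also have "\<dots> = (\<integral>v. ?d v * h v \<partial>lborel)"
      unfolding eq d using d0 by (subst integral_density) auto
    also have "\<dots> = C * (\<integral>v. indicator {0..1} v * (sqrt (1 - v\<^sup>2) ^ (N - 3) * h v) \<partial>lborel)"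
      by (simp only: mult.assoc integral_mult_right_zero)
    finally show "(\<integral>\<theta>. h \<bar>\<theta> $ k\<bar> \<partial>sphere_measure N (lborel :: (real^'n) measure)) =
     C * (\<integral>v. indicator {0..1} v * (sqrt (1 - v\<^sup>2) ^ (N - 3) * h v) \<partial>lborel)" .
  qed
qed

lemma spherical_radon_axis:
  fixes k :: "'n::finite"
  assumes n: "CARD('n) \<ge> 4"
  shows "\<exists>C>0. \<forall>h\<in>borel_measurable borel. \<forall>\<xi>::real^'n. norm \<xi> = 1 \<longrightarrow> spherical_radon (\<lambda>\<theta>. h \<bar>\<theta> $ k\<bar>) \<xi> =
     C * (\<integral>v. indicator {0..1} v * (sqrt (1 - v\<^sup>2) ^ (CARD('n) - 4) * h (sqrt (1 - (\<xi> $ k)\<^sup>2) * v)) \<partial>lborel :: real)"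
proof -
  define n where "n = CARD('n)"
  have [measurable]: "(\<lambda>\<theta>::real^'n. \<bar>\<theta> $ k\<bar>) \<in> borel_measurable (restrict_space borel (sphere 0 1))"
    by (intro measurable_restrict_space1 borel_measurable_continuous_onI continuous_intros)
  obtain C where C: "C > 0" and eq: "\<And>\<xi>::real^'n. norm \<xi> = 1 \<Longrightarrow>
    distr (sphere_measure (n - 1) (hyperplane_measure \<xi>)) borel (\<lambda>\<theta>. \<bar>\<theta> $ k\<bar>) =
    distr (density lborel (\<lambda>v. ennreal C * (indicator {0..1} v * ennreal (sqrt (1 - v\<^sup>2) ^ (n - 4)))))
      borel (\<lambda>v. sqrt (1 - (\<xi> $ k)\<^sup>2) * v)"
    using distr_hyperplane_sphere_axis[of k] n by (auto simp: n_def)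
  let ?d = "\<lambda>v::real. C * (indicator {0..1} v * sqrt (1 - v\<^sup>2) ^ (n - 4))"
  have d: "ennreal C * (indicator {0..1} v * ennreal (sqrt (1 - v\<^sup>2) ^ (n - 4))) = ennreal (?d v)" 
    and d0: "?d v \<ge> 0" for v
    using C by (auto simp: ennreal_mult abs_square_le_1 split: split_indicator)
  show ?thesis
  proof (intro exI[of _ C] conjI C ballI allI impI)
    fix h :: "real \<Rightarrow> real" and \<xi> :: "real^'n" assume [measurable]: "h \<in> borel_measurable borel"
    assume \<xi>: "norm \<xi> = 1"
    define s where "s = sqrt (1 - (\<xi> $ k)\<^sup>2)"
    have "spherical_radon (\<lambda>\<theta>. h \<bar>\<theta> $ k\<bar>) \<xi> =
       (\<integral>v. h v \<partial>distr (sphere_measure (n - 1) (hyperplane_measure \<xi>)) borel (\<lambda>\<theta>::real^'n. \<bar>\<theta> $ k\<bar>))"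
      unfolding spherical_radon_def by (subst integral_distr) (auto simp: n_def)
    also have "\<dots> = (\<integral>v. h (s * v) \<partial>density lborel (\<lambda>v. ennreal (?d v)))"
      unfolding eq[OF \<xi>] d s_def by (subst integral_distr) auto
    also have "\<dots> = (\<integral>v. ?d v * h (s * v) \<partial>lborel)"
      using d0 by (subst integral_density) auto
    also have "\<dots> = C * (\<integral>v. indicator {0..1} v * (sqrt (1 - v\<^sup>2) ^ (n - 4) * h (s * v)) \<partial>lborel)"
      by (simp only: mult.assoc integral_mult_right_zero)
    finally show "spherical_radon (\<lambda>\<theta>. h \<bar>\<theta> $ k\<bar>) \<xi> =
     C * (\<integral>v. indicator {0..1} v * (sqrt (1 - v\<^sup>2) ^ (CARD('n) - 4) * h (sqrt (1 - (\<xi> $ k)\<^sup>2) * v)) \<partial>lborel)"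
      by (simp add: n_def s_def)
  qed
qed

text \<open>\<open>C\<close> depends on the dimension alone. The formula serves twice: for the given
  body \<open>L\<close> and, two dimensions higher, for the body constructed from it. Integrating
  \<open>R ^ (n - 2)\<close> up to the radial function produces its power
  \<open>n - 1\<close>.\<close>

lemma section_volume:
  fixes k :: "'n::finite"
  assumes n: "CARD('n) \<ge> 4"
  obtains C where "C > 0" and "\<And>(L::(real^'n) set) f B \<xi>. closed L \<Longrightarrow> f \<in> borel_measurable borel \<Longrightarrow> (\<And>v. 0 \<le> f v \<and> f v < B) \<Longrightarrow>
     (\<And>y. y \<in> L \<longleftrightarrow> norm y \<le> f (\<bar>y $ k\<bar> / norm y)) \<Longrightarrow> norm \<xi> = 1 \<Longrightarrow>
     measure (hyperplane_measure \<xi>) (L \<inter> {x. x \<bullet> \<xi> = 0}) =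
     C * (\<integral>v. indicator {0..1} v * (sqrt (1 - v\<^sup>2) ^ (CARD('n) - 4) * f (sqrt (1 - (\<xi> $ k)\<^sup>2) * v) ^ (CARD('n) - 1)) \<partial>lborel)"
proof -
  define n where "n = CARD('n)"
  define C where "C = 2 * (real (n - 2) * unit_ball_vol (real (n - 2)))"
  have C: "C / (n - 1) > 0" using assms by (simp add: C_def n_def unit_ball_vol_pos)
  show ?thesis
  proof (rule that[OF C])
    fix L :: "(real^'n) set" and f :: "real \<Rightarrow> real" and B and \<xi> :: "real^'n"
    assume L: "closed L" and [measurable]: "f \<in> borel_measurable borel" and f: "\<And>v. 0 \<le> f v \<and> f v < B"
      and Lf: "\<And>y. y \<in> L \<longleftrightarrow> norm y \<le> f (\<bar>y $ k\<bar> / norm y)" and \<xi>: "norm \<xi> = 1"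
    define s where "s = sqrt (1 - (\<xi> $ k)\<^sup>2)"
    define pr where "pr = (\<lambda>x. x - (x \<bullet> \<xi>) *\<^sub>R \<xi>)"
    have pr0: "pr x \<bullet> \<xi> = 0" for x using \<xi> by (simp add: pr_def inner_diff_left norm_eq_1)
    define \<Psi> where "\<Psi> R v = (if R \<le> f v then 1 else 0 :: ennreal)" for R v :: real
    have [measurable]: "case_prod \<Psi> \<in> borel_measurable (borel \<Otimes>\<^sub>M borel)" unfolding \<Psi>_def by measurable
    have supp: "\<Psi> R v = 0" if "R \<ge> B" for R v using f[of v] that by (simp add: \<Psi>_def)
    let ?X = "L \<inter> {x. x \<bullet> \<xi> = 0}"
    have "closed ?X" by (intro closed_Int L closed_Collect_eq continuous_intros)
    then have X[measurable]: "?X \<in> sets borel" by simp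
    have f0: "f v ^ (n - 1) \<ge> 0" for v using f by simp
    have "emeasure (hyperplane_measure \<xi>) ?X = (\<integral>\<^sup>+y. indicator ?X y \<partial>hyperplane_measure \<xi>)" by simp
    also have "\<dots> = (\<integral>\<^sup>+x. indicator {0..1} (x \<bullet> \<xi>) * indicator ?X (pr x) \<partial>lborel)"
      unfolding pr_def by (rule nn_integral_hyperplane_measure) simp
    also have "\<dots> = (\<integral>\<^sup>+x. indicator {0..1} (x \<bullet> \<xi>) * \<Psi> (norm (pr x)) (\<bar>pr x $ k\<bar> / norm (pr x)) \<partial>lborel)"
      using Lf by (intro nn_integral_cong) (auto simp: \<Psi>_def pr0 split: split_indicator)
    also have "\<dots> = ennreal C * (\<integral>\<^sup>+v. indicator {0..1} v * ennreal (sqrt (1 - v\<^sup>2) ^ (n - 4)) *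
         (\<integral>\<^sup>+R. indicator {0..} R * ennreal (R ^ (n - 2)) * \<Psi> R (s * v) \<partial>lborel) \<partial>lborel)"
      unfolding n_def C_def s_def pr_def using n \<xi> supp
      by (intro nn_integral_slab_zonal[where B = B]) auto
    also have "\<dots> = ennreal C * (\<integral>\<^sup>+v. ennreal (indicator {0..1} v * (sqrt (1 - v\<^sup>2) ^ (n - 4) * f (s * v) ^ (n - 1) / (n - 1))) \<partial>lborel)"
    proof (rule arg_cong[where f="\<lambda>x. ennreal C * x"], rule nn_integral_cong)
      fix v :: real
      have "(\<integral>\<^sup>+R. indicator {0..} R * ennreal (R ^ (n - 2)) * \<Psi> R (s * v) \<partial>lborel) =
         (\<integral>\<^sup>+R. ennreal (R ^ (n - 2)) * indicator {0..f (s * v)} R \<partial>lborel)"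
        by (intro nn_integral_cong) (auto simp: \<Psi>_def split: split_indicator)
      also have "\<dots> = ennreal (f (s * v) ^ Suc (n - 2) / real (Suc (n - 2)))"
        using f by (intro nn_integral_power_Icc) simp
      also have "Suc (n - 2) = n - 1" using n by (simp add: n_def)
      finally show "indicator {0..1} v * ennreal (sqrt (1 - v\<^sup>2) ^ (n - 4)) *
         (\<integral>\<^sup>+R. indicator {0..} R * ennreal (R ^ (n - 2)) * \<Psi> R (s * v) \<partial>lborel) =
         ennreal (indicator {0..1} v * (sqrt (1 - v\<^sup>2) ^ (n - 4) * f (s * v) ^ (n - 1) / (n - 1)))"
        using f0 by (auto simp: abs_square_le_1 simp flip: ennreal_mult split: split_indicator)
    qed
    finally have "emeasure (hyperplane_measure \<xi>) ?X =
      ennreal C * (\<integral>\<^sup>+v. ennreal (indicator {0..1} v * (sqrt (1 - v\<^sup>2) ^ (n - 4) * f (s * v) ^ (n - 1) / (n - 1))) \<partial>lborel)" .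
    moreover have "(\<integral>v. indicator {0..1} v * (sqrt (1 - v\<^sup>2) ^ (n - 4) * f (s * v) ^ (n - 1) / (n - 1)) \<partial>lborel) =
      enn2real (\<integral>\<^sup>+v. ennreal (indicator {0..1} v * (sqrt (1 - v\<^sup>2) ^ (n - 4) * f (s * v) ^ (n - 1) / (n - 1))) \<partial>lborel)"
      using f0 by (intro integral_eq_nn_integral) (auto simp: abs_square_le_1 split: split_indicator)
    ultimately have "measure (hyperplane_measure \<xi>) ?X =
      C * (\<integral>v. indicator {0..1} v * (sqrt (1 - v\<^sup>2) ^ (n - 4) * f (s * v) ^ (n - 1) / (n - 1)) \<partial>lborel)"
      using C n by (simp add: measure_def enn2real_mult n_def zero_less_divide_iff)
    also have "\<dots> = C / (n - 1) * (\<integral>v. indicator {0..1} v * (sqrt (1 - v\<^sup>2) ^ (n - 4) * f (s * v) ^ (n - 1)) \<partial>lborel)"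
      by simp
    finally show "measure (hyperplane_measure \<xi>) ?X =
     C / (n - 1) * (\<integral>v. indicator {0..1} v * (sqrt (1 - v\<^sup>2) ^ (CARD('n) - 4) * f (sqrt (1 - (\<xi> $ k)\<^sup>2) * v) ^ (CARD('n) - 1)) \<partial>lborel)"
      by (simp add: n_def s_def)
  qed
qed

section \<open>Bodies of revolution\<close>

text \<open>A quarter circle from the equator to the pole that meets every latitude once; evaluating
  a zonal function along it recovers the function of the cosine.\<close>

definition meridian :: "'n::finite \<Rightarrow> 'n \<Rightarrow> real \<Rightarrow> real^'n" where
  "meridian j k c = c *\<^sub>R axis k 1 + sqrt (1 - c\<^sup>2) *\<^sub>R axis j 1"

lemma meridian_nth:
  assumes "j \<noteq> k"
  shows "meridian j k c $ k = c"
  using assms by (simp add: meridian_def axis_def)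

lemma norm_meridian:
  assumes "j \<noteq> k" "0 \<le> c" "c \<le> 1"
  shows "norm (meridian j k c) = 1"
proof -
  have "c\<^sup>2 \<le> 1" using assms by (simp add: abs_square_le_1)
  then have "meridian j k c \<bullet> meridian j k c = 1"
    using assms(1) by (simp add: meridian_def inner_add_left inner_add_right inner_axis_axis power2_eq_square[symmetric])
  then show ?thesis by (simp add: norm_eq_1)
qed

lemma axis_quotient_bounds:
  fixes y :: "real^'n"
  shows "0 \<le> \<bar>y $ k\<bar> / norm y" "\<bar>y $ k\<bar> / norm y \<le> 1"
  using component_le_norm_cart[of y k] by (auto simp: divide_le_eq_1)

lemma star_body_radial_fun:
  assumes "star_body L" "norm \<xi> = 1"
  shows "0 \<le> radial_fun L \<xi>" "\<And>a. 0 \<le> a \<Longrightarrow> a *\<^sub>R \<xi> \<in> L \<longleftrightarrow> a \<le> radial_fun L \<xi>"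
proof -
  let ?S = "{a. a *\<^sub>R \<xi> \<in> L}"
  have L: "compact L" "0 \<in> L" "\<And>x. x \<in> L \<Longrightarrow> closed_segment 0 x \<subseteq> L"
    using assms(1) by (auto simp: star_body_def)
  obtain B where B: "\<And>x. x \<in> L \<Longrightarrow> norm x \<le> B"
    using compact_imp_bounded[OF L(1)] by (auto simp: bounded_iff)
  have S0: "0 \<in> ?S" using L(2) by simp
  have le: "a \<le> B" if "a \<in> ?S" for a using B[of "a *\<^sub>R \<xi>"] that assms(2) by simp
  have bdd: "bdd_above ?S" using le by (intro bdd_aboveI[of _ B]) auto
  have "closed ((\<lambda>a. a *\<^sub>R \<xi>) -` L)"
    by (intro closed_vimage compact_imp_closed[OF L(1)] continuous_intros)
  then have cl: "closed ?S" by (simp add: vimage_def)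
  have Sup: "radial_fun L \<xi> \<in> ?S"
    unfolding radial_fun_def by (rule closed_contains_Sup[OF _ bdd cl]) (use S0 in blast)
  show pos: "0 \<le> radial_fun L \<xi>" unfolding radial_fun_def by (rule cSup_upper[OF S0 bdd])
  fix a :: real assume a: "0 \<le> a"
  show "a *\<^sub>R \<xi> \<in> L \<longleftrightarrow> a \<le> radial_fun L \<xi>"
  proof
    assume "a *\<^sub>R \<xi> \<in> L"
    then show "a \<le> radial_fun L \<xi>" unfolding radial_fun_def by (intro cSup_upper[OF _ bdd]) simp
  next
    assume le: "a \<le> radial_fun L \<xi>"
    let ?r = "radial_fun L \<xi>"
    show "a *\<^sub>R \<xi> \<in> L"
    proof (cases "?r = 0")
      case True then show ?thesis using a le L(2) by simp
    next
      case False
      have "a *\<^sub>R \<xi> = (a / ?r) *\<^sub>R (?r *\<^sub>R \<xi>)" using False by simp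
      then have "a *\<^sub>R \<xi> \<in> closed_segment 0 (?r *\<^sub>R \<xi>)"
        unfolding closed_segment_def using a le pos False
        by (intro CollectI exI[of _ "a / ?r"]) (auto simp: divide_le_eq_1)
      then show ?thesis using L(3) Sup by blast
    qed
  qed
qed

text \<open>For \<open>y \<noteq> 0\<close> the quotient is the cosine of the angle to the axis. At
  \<open>y = 0\<close> it is \<open>0 / 0 = 0\<close>, and \<open>0 \<le> f 0\<close> keeps the
  equivalence true.\<close>

lemma star_body_mem_iff:
  fixes L :: "(real^'n) set"
  assumes "star_body L" and f: "\<And>\<xi>. norm \<xi> = 1 \<Longrightarrow> radial_fun L \<xi> = f \<bar>\<xi> $ k\<bar>" and f0: "0 \<le> f 0"
  shows "y \<in> L \<longleftrightarrow> norm y \<le> f (\<bar>y $ k\<bar> / norm y)"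
proof (cases "y = 0")
  case True
  then show ?thesis using assms by (simp add: star_body_def)
next
  case False
  have "norm (sgn y) = 1" using False by (simp add: norm_sgn)
  moreover have "norm y *\<^sub>R sgn y = y" "\<bar>sgn y $ k\<bar> = \<bar>y $ k\<bar> / norm y"
    using False by (auto simp: sgn_div_norm abs_mult divide_inverse mult.commute)
  ultimately show ?thesis
    using star_body_radial_fun(2)[OF assms(1), of "sgn y" "norm y"] f[of "sgn y"] by simp
qed

text \<open>Clamping the argument to \<open>[0, 1]\<close> extends the radial function to a
  continuous, nonnegative and bounded function on the whole line, so later integrals carry no domain
  conditions.\<close>

lemma zonal_radial_fun:
  fixes L :: "(real^'n) set" and k :: 'n
  assumes n: "CARD('n) \<ge> 2" and L: "star_body L"
    and zonal: "\<And>\<xi> \<eta>. norm \<xi> = 1 \<Longrightarrow> norm \<eta> = 1 \<Longrightarrow> \<bar>\<xi> $ k\<bar> = \<bar>\<eta> $ k\<bar> \<Longrightarrow> radial_fun L \<xi> = radial_fun L \<eta>"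
  obtains f B where "continuous_on UNIV f" "\<And>v. 0 \<le> f v" "\<And>v. f v < B"
    "\<And>\<xi>. norm \<xi> = 1 \<Longrightarrow> radial_fun L \<xi> = f \<bar>\<xi> $ k\<bar>"
proof -
  obtain j where j: "j \<noteq> k" using ex_other_index[OF n] .
  define c where "c v = max 0 (min 1 v)" for v :: real
  have c: "0 \<le> c v" "c v \<le> 1" for v by (auto simp: c_def)
  define f where "f v = radial_fun L (meridian j k (c v))" for v
  have nm: "norm (meridian j k (c v)) = 1" for v using norm_meridian[OF j c] .
  have cont: "continuous_on (sphere 0 1) (radial_fun L)" using L by (simp add: star_body_def)
  have cf: "continuous_on UNIV f"
    unfolding f_def
  proof (rule continuous_on_compose2[OF cont])
    show "continuous_on UNIV (\<lambda>v. meridian j k (c v))"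
      unfolding meridian_def c_def by (intro continuous_intros)
  qed (use nm in auto)
  have "bounded (radial_fun L ` sphere 0 1)"
    by (intro compact_imp_bounded compact_continuous_image cont) auto
  then obtain B where B: "\<And>\<xi>. norm \<xi> = 1 \<Longrightarrow> \<bar>radial_fun L \<xi>\<bar> \<le> B"
    by (force simp: bounded_iff)
  show ?thesis
  proof (rule that[OF cf, of "B + 1"])
    show "0 \<le> f v" for v unfolding f_def using star_body_radial_fun(1)[OF L nm] .
    show "f v < B + 1" for v using B[OF nm[of v]] by (simp add: f_def)
    show "radial_fun L \<xi> = f \<bar>\<xi> $ k\<bar>" if "norm \<xi> = 1" for \<xi>
    proof -
      have "\<bar>\<xi> $ k\<bar> \<le> 1" using component_le_norm_cart[of \<xi> k] that by simp
      then show ?thesis unfolding f_def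
        by (intro zonal that nm) (simp add: meridian_nth[OF j] c_def)
    qed
  qed
qed

text \<open>The reflection exchanging two unit vectors of equal axial component fixes the axis,
  hence preserves \<open>L\<close>. Opposite axial components are reduced to this case by
  \<open>L = - L\<close>.\<close>

lemma body_of_revolution_zonal:
  fixes L :: "(real^'n) set"
  assumes L: "star_body L" "body_of_revolution k L"
    and u: "norm \<xi> = 1" "norm \<eta> = 1" "\<bar>\<xi> $ k\<bar> = \<bar>\<eta> $ k\<bar>"
  shows "radial_fun L \<xi> = radial_fun L \<eta>"
proof -
  have *: "radial_fun L \<xi> = radial_fun L \<eta>" if u: "norm \<xi> = 1" "norm \<eta> = 1" "\<xi> $ k = \<eta> $ k" for \<xi> \<eta>
  proof -
    obtain T where T: "orthogonal_transformation T" "T \<xi> = \<eta>" "T (axis k 1) = axis k 1"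
      using orthogonal_swap[of \<xi> \<eta>] u by (metis inner_axis' )
    have TL: "T ` L = L" using L(2) T by (auto simp: body_of_revolution_def)
    have lin: "linear T" and inj: "inj T"
      using T(1) by (auto simp: orthogonal_transformation_linear orthogonal_transformation_inj)
    have "a *\<^sub>R \<eta> \<in> L \<longleftrightarrow> a *\<^sub>R \<xi> \<in> L" for a
    proof -
      have "a *\<^sub>R \<eta> \<in> L \<longleftrightarrow> T (a *\<^sub>R \<xi>) \<in> T ` L" by (simp add: linear_scale[OF lin] T(2) TL)
      then show ?thesis using inj by (simp add: inj_image_mem_iff)
    qed
    then show ?thesis by (simp add: radial_fun_def)
  qed
  have neg: "radial_fun L (- \<eta>) = radial_fun L \<eta>"
  proof -
    have "- x \<in> L \<longleftrightarrow> x \<in> L" for x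
      using L(1) by (metis add.inverse_inverse star_body_def)
    from this[of "_ *\<^sub>R \<eta>"] show ?thesis by (simp add: radial_fun_def)
  qed
  show ?thesis
  proof (cases "\<xi> $ k = \<eta> $ k")
    case True then show ?thesis using * u by blast
  next
    case False
    then have "\<xi> $ k = (- \<eta>) $ k" using u(3) by (auto simp: abs_if split: if_splits)
    then show ?thesis using *[of \<xi> "- \<eta>"] u neg by simp
  qed
qed

text \<open>Otherwise \<open>L\<close> would be contained in \<open>{0}\<close>. Positivity at one
  cosine is the form of nonempty interior that can be carried from dimension \<open>n\<close> to
  \<open>n + 2\<close>.\<close>

lemma star_body_radial_pos:
  fixes L :: "(real^'n) set"
  assumes L: "star_body L" and f: "\<And>\<xi>. norm \<xi> = 1 \<Longrightarrow> radial_fun L \<xi> = f \<bar>\<xi> $ k\<bar>"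
  shows "\<exists>t\<in>{0..1}. 0 < f t"
proof (rule ccontr)
  assume no: "\<not> (\<exists>t\<in>{0..1}. 0 < f t)"
  have "L \<subseteq> {0}"
  proof
    fix y assume y: "y \<in> L"
    show "y \<in> {0}"
    proof (rule ccontr)
      assume "y \<notin> {0}"
      then have 1: "norm (sgn y) = 1" "norm y *\<^sub>R sgn y = y" "norm y > 0"
        by (auto simp: norm_sgn sgn_div_norm)
      then have "norm y \<le> f \<bar>sgn y $ k\<bar>"
        using star_body_radial_fun(2)[OF L 1(1), of "norm y"] y f[OF 1(1)] by simp
      moreover have "\<bar>sgn y $ k\<bar> \<le> 1" using component_le_norm_cart[of "sgn y" k] 1 by simp
      ultimately have "0 < f \<bar>sgn y $ k\<bar>" "\<bar>sgn y $ k\<bar> \<in> {0..1}"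
        using less_le_trans[OF 1(3)] by auto
      then show False using no by blast
    qed
  qed
  then have "interior L \<subseteq> interior {0}" by (rule interior_mono)
  moreover have "interior L \<noteq> {}" using L by (simp add: star_body_def)
  ultimately show False by simp
qed

text \<open>Compactness comes from writing the body as a continuous image of \<open>{0..1}\<close>
  times the sphere. The strict radial inequality defines an open subset away from 0, and
  \<open>0 < g t\<close> makes it nonempty.\<close>

lemma star_body_revolution_body:
  fixes k :: "'n::finite"
  assumes n: "CARD('n) \<ge> 2" and g: "continuous_on UNIV g" "\<And>v. 0 \<le> g v" 
    and \<rho>: "\<And>\<phi>. \<phi> \<in> {0..pi/2} \<Longrightarrow> \<rho> \<phi> = g (cos \<phi>)"
    and pos: "t \<in> {0..1}" "0 < g t"
  shows "star_body (revolution_body k \<rho> :: (real^'n) set)"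
    "\<And>\<xi> :: real^'n. norm \<xi> = 1 \<Longrightarrow> radial_fun (revolution_body k \<rho>) \<xi> = g \<bar>\<xi> $ k\<bar>"
proof -
  let ?K = "revolution_body k \<rho> :: (real^'n) set"
  have k1: "\<bar>\<xi> $ k\<bar> \<le> 1" if "norm \<xi> = 1" for \<xi> :: "real^'n"
    using component_le_norm_cart[of \<xi> k] that by simp
  have \<rho>g: "\<rho> (arccos \<bar>\<xi> $ k\<bar>) = g \<bar>\<xi> $ k\<bar>" if "norm \<xi> = 1" for \<xi> :: "real^'n"
    using k1[OF that] arccos_lbound[of "\<bar>\<xi> $ k\<bar>"] arccos_le_pi2[of "\<bar>\<xi> $ k\<bar>"]
    by (subst \<rho>) auto
  show rad: "radial_fun ?K \<xi> = g \<bar>\<xi> $ k\<bar>" if "norm \<xi> = 1" for \<xi>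
    using radial_fun_revolution_body[of \<rho> \<xi> k] \<rho> g(2) that \<rho>g[OF that] by simp
  have K: "?K = (\<lambda>(a, \<xi>). (a * g \<bar>\<xi> $ k\<bar>) *\<^sub>R \<xi>) ` ({0..1} \<times> sphere 0 1)" (is "_ = ?R")
  proof
    show "?K \<subseteq> ?R"
    proof
      fix x assume "x \<in> ?K"
      then obtain r \<xi> where h: "x = r *\<^sub>R \<xi>" "norm \<xi> = 1" "0 \<le> r" "r \<le> g \<bar>\<xi> $ k\<bar>"
        by (auto simp: revolution_body_def \<rho>g)
      then have "x = (\<lambda>(a, \<xi>). (a * g \<bar>\<xi> $ k\<bar>) *\<^sub>R \<xi>) (r / g \<bar>\<xi> $ k\<bar>, \<xi>)"
        by (cases "g \<bar>\<xi> $ k\<bar> = 0") auto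
      moreover have "(r / g \<bar>\<xi> $ k\<bar>, \<xi>) \<in> {0..1} \<times> sphere 0 1"
        using h g(2)[of "\<bar>\<xi> $ k\<bar>"] by (cases "g \<bar>\<xi> $ k\<bar> = 0") (auto simp: divide_le_eq_1)
      ultimately show "x \<in> ?R" by blast
    qed
    show "?R \<subseteq> ?K"
    proof clarsimp
      fix a :: real and \<xi> :: "real^'n" assume h: "norm \<xi> = 1" "0 \<le> a" "a \<le> 1"
      then show "(a * g \<bar>\<xi> $ k\<bar>) *\<^sub>R \<xi> \<in> ?K"
        unfolding revolution_body_def using g(2)
        by (intro CollectI exI[of _ "a * g \<bar>\<xi> $ k\<bar>"] exI[of _ \<xi>]) (auto simp: \<rho>g mult_left_le_one_le)
    qed
  qed
  have mem: "y \<in> ?K \<longleftrightarrow> norm y \<le> g (\<bar>y $ k\<bar> / norm y)" for y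
  proof (cases "y = 0")
    case True
    have "norm (axis k 1 :: real^'n) = 1" by simp
    from \<rho>g[OF this] g(2) have "\<rho> (arccos \<bar>(axis k 1 :: real^'n) $ k\<bar>) \<ge> 0" by metis
    then have "0 *\<^sub>R axis k 1 \<in> ?K" unfolding revolution_body_def
      by (intro CollectI exI[of _ 0] exI[of _ "axis k 1"]) (simp del: axis_nth)
    then show ?thesis using True g(2) by simp
  next
    case False
    then have s: "norm (sgn y) = 1" "norm y *\<^sub>R sgn y = y" "\<bar>sgn y $ k\<bar> = \<bar>y $ k\<bar> / norm y"
      by (auto simp: norm_sgn sgn_div_norm abs_mult divide_inverse mult.commute)
    show ?thesis
    proof
      assume "y \<in> ?K"
      then obtain r \<xi> where h: "y = r *\<^sub>R \<xi>" "norm \<xi> = 1" "0 \<le> r" "r \<le> g \<bar>\<xi> $ k\<bar>"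
        by (auto simp: revolution_body_def \<rho>g)
      then show "norm y \<le> g (\<bar>y $ k\<bar> / norm y)" using False by (simp add: abs_mult)
    next
      assume "norm y \<le> g (\<bar>y $ k\<bar> / norm y)"
      then show "y \<in> ?K" unfolding revolution_body_def using s \<rho>g[OF s(1)]
        by (intro CollectI exI[of _ "norm y"] exI[of _ "sgn y"]) auto
    qed
  qed
  show "star_body ?K" unfolding star_body_def
  proof (intro conjI ballI)
    have "continuous_on ({0..1} \<times> sphere 0 1) (\<lambda>(a, \<xi>::real^'n). (a * g \<bar>\<xi> $ k\<bar>) *\<^sub>R \<xi>)"
      unfolding case_prod_beta
      by (intro continuous_intros continuous_on_compose2[OF g(1)]) auto
    then show "compact ?K" unfolding K by (intro compact_continuous_image compact_Times) auto
    obtain j where j: "j \<noteq> k" using ex_other_index[OF n] .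
    let ?U = "{y. norm y < g (\<bar>y $ k\<bar> / norm y)} - {0::real^'n}"
    have cont: "continuous_on (- {0}) (\<lambda>y::real^'n. g (\<bar>y $ k\<bar> / norm y) - norm y)"
      by (intro continuous_intros continuous_on_compose2[OF g(1)]) auto
    have "open (- {0} \<inter> (\<lambda>y::real^'n. g (\<bar>y $ k\<bar> / norm y) - norm y) -` {0<..})"
      by (rule continuous_open_preimage[OF cont]) auto
    moreover have "- {0} \<inter> (\<lambda>y::real^'n. g (\<bar>y $ k\<bar> / norm y) - norm y) -` {0<..} = ?U" by auto
    ultimately have "open ?U" by simp
    moreover have "?U \<subseteq> ?K" by (intro subsetI mem[THEN iffD2]) simp
    moreover have "(g t / 2) *\<^sub>R meridian j k t \<in> ?U"
    proof -
      let ?m = "meridian j k t"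
      have m: "norm ?m = 1" "?m $ k = t" using norm_meridian[OF j, of t] meridian_nth[OF j] pos by auto
      then have "?m \<noteq> 0" by (metis norm_zero zero_neq_one)
      then show ?thesis using m pos by (simp add: abs_mult)
    qed
    ultimately show "interior ?K \<noteq> {}" using interior_maximal by blast
    show "0 \<in> ?K" using mem[of 0] g(2) by simp
    show "closed_segment 0 x \<subseteq> ?K" if "x \<in> ?K" for x
    proof
      fix y assume "y \<in> closed_segment 0 x"
      then obtain u where u: "y = u *\<^sub>R x" "0 \<le> u" "u \<le> 1" by (auto simp: closed_segment_def)
      show "y \<in> ?K"
      proof (cases "u = 0 \<or> x = 0")
        case True then show ?thesis using u mem[of 0] g(2) by auto
      next
        case False
        then have "\<bar>y $ k\<bar> / norm y = \<bar>x $ k\<bar> / norm x" using u by (simp add: abs_mult)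
        moreover have "norm y \<le> norm x" using u by (simp add: mult_left_le_one_le)
        ultimately show ?thesis using that mem[of x] mem[of y] by simp
      qed
    qed
    show "- x \<in> ?K" if "x \<in> ?K" for x using that mem[of x] mem[of "- x"] by simp
    show "continuous_on (sphere 0 1) (radial_fun ?K)"
    proof (subst continuous_on_cong[OF refl])
      show "continuous_on (sphere 0 1) (\<lambda>\<xi>::real^'n. g \<bar>\<xi> $ k\<bar>)"
        by (intro continuous_intros continuous_on_compose2[OF g(1)]) auto
    qed (simp add: rad)
  qed
qed

text \<open>\<open>s * f s\<close> is the height of the boundary point at cosine \<open>s\<close>.
  If the slice at this height is convex, it contains the chord from that point to its mirror image,
  and the chord meets every direction with larger cosine \<open>t\<close>; so the boundary there is
  at least as high. Conversely, a convex combination of two points of a slice has the same height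
  and at most the larger norm, hence a larger cosine, and monotonicity keeps it in
  \<open>L\<close>.\<close>

lemma equator_convex_iff:
  fixes L :: "(real^'n) set"
  assumes n: "CARD('n) \<ge> 2" and mem: "\<And>y. y \<in> L \<longleftrightarrow> norm y \<le> f (\<bar>y $ k\<bar> / norm y)"
    and f: "\<And>v. 0 \<le> f v"
  shows "equator_convex k L \<longleftrightarrow> (\<forall>s t. 0 < s \<and> s \<le> t \<and> t \<le> 1 \<longrightarrow> s * f s \<le> t * f t)"
proof (intro iffI allI impI)
  fix s t :: real assume conv: "equator_convex k L" and st: "0 < s \<and> s \<le> t \<and> t \<le> 1"
  obtain j where j: "j \<noteq> k" using ex_other_index[OF n] .
  define h where "h = s * f s"
  show "s * f s \<le> t * f t"
  proof (cases "f s = 0")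
    case True then show ?thesis using f st by auto
  next
    case False
    then have fs: "f s > 0" using f[of s] by simp
    define m where "m c = meridian j k c" for c
    define m' where "m' c = meridian j k c - (2 * sqrt (1 - c\<^sup>2)) *\<^sub>R axis j 1" for c
    have m: "norm (m c) = 1" "m c $ k = c" if "0 \<le> c" "c \<le> 1" for c
      using norm_meridian[OF j that] meridian_nth[OF j] by (auto simp: m_def)
    have m'k: "m' c $ k = c" for c using j by (simp add: m'_def meridian_nth axis_def)
    have m'n: "norm (m' c) = 1" if "0 \<le> c" "c \<le> 1" for c
    proof -
      have "c\<^sup>2 \<le> 1" using that by (simp add: abs_square_le_1)
      then have "m' c \<bullet> m' c = 1" using j
        by (simp add: m'_def meridian_def inner_add_left inner_add_right inner_diff_left inner_diff_right
            inner_axis_axis power2_eq_square[symmetric] algebra_simps)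
      then show ?thesis by (simp add: norm_eq_1)
    qed
    have 1: "f s *\<^sub>R m s \<in> L" "f s *\<^sub>R m' s \<in> L"
      using m[of s] m'n[of s] m'k[of s] st fs by (auto simp: mem abs_mult)
    define q where "q c = sqrt (1 - c\<^sup>2)" for c :: real
    have q: "0 \<le> q t" "q t \<le> q s" using st by (auto simp: q_def abs_square_le_1 power_mono)
    have hpos: "h > 0" using st fs by (simp add: h_def)
    define z where "z = (h / t) *\<^sub>R m t"
    \<comment> \<open>The chord has half-length \<open>f s * q s\<close>, and the point of direction
      \<open>t\<close> at height \<open>h\<close> lies at distance \<open>(h / t) * q t\<close> from
      the axis; the quotient of the two is \<open>2 * l - 1\<close>. For \<open>q s = 0\<close> the
      chord is a single point on the axis.\<close>
    define l where "l = (if q s = 0 then 1 else (1 + s * q t / (t * q s)) / 2)"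
    have r: "0 \<le> s * q t / (t * q s)" "s * q t / (t * q s) \<le> 1" if "q s \<noteq> 0"
    proof -
      have "s * q t \<le> t * q s" using q st by (intro mult_mono) auto
      then show "0 \<le> s * q t / (t * q s)" "s * q t / (t * q s) \<le> 1"
        using q st that by (auto simp: divide_le_eq_1)
    qed
    have l: "0 \<le> l" "l \<le> 1" using r by (auto simp: l_def)
    have z: "z = l *\<^sub>R (f s *\<^sub>R m s) + (1 - l) *\<^sub>R (f s *\<^sub>R m' s)"
    proof -
      have 1: "l * (f s * q s) - (1 - l) * (f s * q s) = (h / t) * q t"
      proof (cases "q s = 0")
        case True then show ?thesis using q by simp
      next
        case False
        have "l * (f s * q s) - (1 - l) * (f s * q s) = (2 * l - 1) * (f s * q s)" by (simp add: algebra_simps)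
        also have "2 * l - 1 = s * q t / (t * q s)" using False by (simp add: l_def add_divide_distrib)
        also have "\<dots> * (f s * q s) = (h / t) * q t" using False by (simp add: h_def)
        finally show ?thesis .
      qed
      have 2: "m c = c *\<^sub>R axis k 1 + q c *\<^sub>R axis j 1" "m' c = c *\<^sub>R axis k 1 - q c *\<^sub>R axis j 1" for c
        by (simp_all add: m_def m'_def meridian_def q_def vec_eq_iff algebra_simps)
      have "l *\<^sub>R (f s *\<^sub>R m s) + (1 - l) *\<^sub>R (f s *\<^sub>R m' s) =
        (l * f s * s + (1 - l) * f s * s) *\<^sub>R axis k 1 + (l * (f s * q s) - (1 - l) * (f s * q s)) *\<^sub>R axis j 1"
        unfolding 2 by (simp only: scaleR_add_right scaleR_diff_right scaleR_add_left scaleR_diff_left scaleR_scaleR mult.assoc) simp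
      also have "\<dots> = z" unfolding 1 z_def 2 using st by (simp add: h_def scaleR_add_right algebra_simps)
      finally show ?thesis by simp
    qed
    have "convex (L \<inter> {x. x $ k = h})" using conv by (simp add: equator_convex_def)
    moreover have "f s *\<^sub>R m s \<in> L \<inter> {x. x $ k = h}" "f s *\<^sub>R m' s \<in> L \<inter> {x. x $ k = h}"
      using 1 m[of s] m'k[of s] st by (auto simp: h_def)
    ultimately have "z \<in> L \<inter> {x. x $ k = h}"
      unfolding z using l by (intro convexD) auto
    then have "h / t \<le> f t"
      using m[of t] st hpos by (auto simp: mem z_def abs_mult)
    then show ?thesis using st by (simp add: h_def field_simps)
  qed
next
  assume mono: "\<forall>s t. 0 < s \<and> s \<le> t \<and> t \<le> 1 \<longrightarrow> s * f s \<le> t * f t"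
  show "equator_convex k L"
    unfolding equator_convex_def
  proof
    fix h
    show "convex (L \<inter> {x. x $ k = h})"
    proof (rule convexI)
      fix x y u v assume xy: "x \<in> L \<inter> {x. x $ k = h}" "y \<in> L \<inter> {x. x $ k = h}"
        and uv: "0 \<le> u" "0 \<le> v" "u + v = (1::real)"
      let ?z = "u *\<^sub>R x + v *\<^sub>R y"
      have zk: "?z $ k = h" using xy uv by (simp flip: distrib_right)
      \<comment> \<open>Hence one of the two points serves as \<open>p\<close>, with the same height
        and a norm not below that of \<open>?z\<close>.\<close>
      have "norm ?z \<le> u * norm x + v * norm y"
        using uv by (intro norm_triangle_le) simp
      also have "\<dots> \<le> max (norm x) (norm y)"
        using uv by (intro convex_bound_le) auto
      finally obtain p where p: "p \<in> L" "p $ k = h" "norm ?z \<le> norm p"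
        using xy by (cases "norm x \<le> norm y") auto
      have "?z \<in> L"
      proof (cases "?z = 0")
        case True then show ?thesis using f by (simp add: mem)
      next
        case z0: False
        then have zp: "0 < norm ?z" "0 < norm p" using p(3) by (auto intro: less_le_trans)
        show ?thesis
        proof (cases "h = 0")
          case True
          have "norm ?z \<le> f 0" using p True by (simp add: mem)
          then show ?thesis using zk True by (simp add: mem)
        next
          case False
          let ?s = "\<bar>h\<bar> / norm p" and ?t = "\<bar>h\<bar> / norm ?z"
          have "0 < ?s" using False zp by simp
          moreover have "?s \<le> ?t" using p(3) zp by (intro divide_left_mono) auto
          moreover have "?t \<le> 1" using axis_quotient_bounds(2)[of ?z k] zk by simp
          ultimately have "?s * f ?s \<le> ?t * f ?t" using mono by blast
          moreover have "\<bar>h\<bar> \<le> ?s * f ?s"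
          proof -
            have "norm p \<le> f ?s" using p by (simp add: mem)
            then have "?s * norm p \<le> ?s * f ?s" by (intro mult_left_mono) auto
            then show ?thesis using zp by simp
          qed
          ultimately have "\<bar>h\<bar> \<le> ?t * f ?t" by linarith
          then have "norm ?z \<le> f ?t" using False zp by (simp add: field_simps)
          then show ?thesis using zk by (simp add: mem)
        qed
      qed
      then show "?z \<in> L \<inter> {x. x $ k = h}" using zk by simp
    qed
  qed
qed

section \<open>Passing from dimension n to n + 2\<close>

text \<open>With \<open>h v = f (s v)\<close>, the function
  \<open>v * h v ^ (2 * q + 1) * (1 - v\<^sup>2) ^ q\<close> vanishes at 0 and 1, so its derivative
  \<open>D\<close> integrates to 0. Writing \<open>v\<^sup>2 = 1 - (1 - v\<^sup>2)\<close> in the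
  term from the weight raises the coefficient of
  \<open>(1 - v\<^sup>2) ^ q * h v ^ (2 * q + 1)\<close> from 1 to \<open>2 * q + 1\<close> and
  leaves the integrand of the right-hand side.\<close>

lemma integral_by_parts_dimension_shift:
  fixes f f' :: "real \<Rightarrow> real"
  assumes f: "\<And>t. t \<in> {0..1} \<Longrightarrow> (f has_real_derivative f' t) (at t within {0..1})"
    and f': "continuous_on {0..1} f'" and q: "q \<ge> 1" and s: "s \<in> {0..1}"
  shows "(\<integral>v. indicator {0..1} v * ((1 - v\<^sup>2) ^ q * (real (2 * q + 1) * f (s * v) ^ (2 * q) * (f (s * v) + s * v * f' (s * v)))) \<partial>lborel) =
     2 * q * (\<integral>v. indicator {0..1} v * ((1 - v\<^sup>2) ^ (q - 1) * f (s * v) ^ (2 * q + 1)) \<partial>lborel)"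
proof -
  have sv: "s * v \<in> {0..1}" if "v \<in> {0..1}" for v using s that by (simp add: mult_le_one)
  have df: "((\<lambda>v. f (s * v)) has_real_derivative f' (s * v) * s) (at v within {0..1})" if v: "v \<in> {0..1}" for v
  proof -
    have 1: "(f has_real_derivative f' (s * v)) (at (s * v) within (\<lambda>v. s * v) ` {0..1})"
      using sv v by (intro DERIV_subset[OF f] image_subsetI) blast+
    have 2: "((\<lambda>v. s * v) has_real_derivative s) (at v within {0..1})"
      by (auto intro!: derivative_eq_intros)
    show ?thesis using DERIV_image_chain[OF 1 2] by (simp add: o_def)
  qed
  have cf: "continuous_on {0..1} (\<lambda>v. f (s * v))"
    using df by (intro DERIV_continuous_on)
  have cf': "continuous_on {0..1} (\<lambda>v. f' (s * v))"
    using sv by (intro continuous_on_compose2[OF f'] continuous_intros image_subsetI) blast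
  define h where "h v = f (s * v)" for v
  define h' where "h' v = f' (s * v) * s" for v
  have dh: "(h has_real_derivative h' v) (at v within {0..1})" if "v \<in> {0..1}" for v
    using df[OF that] by (simp add: h_def[abs_def] h'_def)
  have ch: "continuous_on {0..1} h" "continuous_on {0..1} h'"
    using cf cf' by (auto simp: h_def[abs_def] h'_def[abs_def] intro!: continuous_intros)
  define D where "D v = h v ^ (2 * q + 1) * (1 - v\<^sup>2) ^ q + v * (real (2 * q + 1) * h v ^ (2 * q) * h' v) * (1 - v\<^sup>2) ^ q
     - real (2 * q) * v\<^sup>2 * h v ^ (2 * q + 1) * (1 - v\<^sup>2) ^ (q - 1)" for v
  let ?H = "\<lambda>v. v * (h v ^ (2 * q + 1) * (1 - v\<^sup>2) ^ q)"
  have D0: "(\<integral>v. indicator {0..1} v *\<^sub>R D v \<partial>lborel) = ?H 1 - ?H 0"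
  proof (rule integral_FTC_Icc)
    fix v :: real assume "0 \<le> v" "v \<le> 1"
    then have v: "v \<in> {0..1}" by simp
    have 1: "((\<lambda>v. h v ^ (2 * q + 1)) has_real_derivative real (2 * q + 1) * h v ^ (2 * q) * h' v) (at v within {0..1})"
      using DERIV_power[OF dh[OF v], of "2 * q + 1"] by (simp add: mult_ac)
    have 2: "((\<lambda>v. (1 - v\<^sup>2) ^ q) has_real_derivative (real q * (- (2 * v) * (1 - v\<^sup>2) ^ (q - 1)))) (at v within {0..1})"
      by (auto intro!: derivative_eq_intros)
    have "(?H has_real_derivative D v) (at v within {0..1})"
      by (rule derivative_eq_intros 1 2 refl)+ (simp add: D_def algebra_simps power2_eq_square)
    then show "(?H has_vector_derivative D v) (at v within {0..1})"
      by (simp add: has_real_derivative_iff_has_vector_derivative)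
  next
    show "continuous_on {0..1} D" unfolding D_def by (intro continuous_intros ch)
  qed simp
  then have D0: "(\<integral>v. indicator {0..1} v *\<^sub>R D v \<partial>lborel) = 0" using q by simp
  let ?g = "\<lambda>v. 2 * q * ((1 - v\<^sup>2) ^ (q - 1) * h v ^ (2 * q + 1))"
  have "continuous_on {0..1} ?g" by (intro continuous_intros ch)
  then have ig: "integrable lborel (\<lambda>v. indicator {0..1} v *\<^sub>R ?g v)"
    by (rule borel_integrable_atLeastAtMost'[unfolded set_integrable_def])
  have "continuous_on {0..1} D" unfolding D_def by (intro continuous_intros ch)
  then have iD: "integrable lborel (\<lambda>v. indicator {0..1} v *\<^sub>R D v)"
    by (rule borel_integrable_atLeastAtMost'[unfolded set_integrable_def])
  have eq: "(1 - v\<^sup>2) ^ q * (real (2 * q + 1) * h v ^ (2 * q) * (h v + v * h' v)) = ?g v + D v" for v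
  proof -
    obtain p where p: "q = Suc p" using q by (cases q) auto
    show ?thesis by (simp add: D_def p algebra_simps power2_eq_square)
  qed
  have "(\<integral>v. indicator {0..1} v * ((1 - v\<^sup>2) ^ q * (real (2 * q + 1) * f (s * v) ^ (2 * q) * (f (s * v) + s * v * f' (s * v)))) \<partial>lborel) =
    (\<integral>v. indicator {0..1} v * ((1 - v\<^sup>2) ^ q * (real (2 * q + 1) * h v ^ (2 * q) * (h v + v * h' v))) \<partial>lborel)"
    by (simp add: h_def h'_def mult_ac)
  also have "\<dots> = (\<integral>v. indicator {0..1} v *\<^sub>R ?g v + indicator {0..1} v *\<^sub>R D v \<partial>lborel)"
    unfolding eq by (simp add: distrib_left)
  also have "\<dots> = (\<integral>v. indicator {0..1} v *\<^sub>R ?g v \<partial>lborel)"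
    by (subst Bochner_Integration.integral_add[OF ig iD]) (simp only: D0 add_0_right)
  also have "\<dots> = (\<integral>v. 2 * q * (indicator {0..1} v * ((1 - v\<^sup>2) ^ (q - 1) * f (s * v) ^ (2 * q + 1))) \<partial>lborel)"
    by (simp add: h_def mult_ac)
  finally show ?thesis by simp
qed

lemma derivative_nonneg_within:
  fixes g :: "real \<Rightarrow> real"
  assumes d: "(g has_real_derivative D) (at t within {0..1})" and t: "t \<in> {0..1}"
    and mono: "\<And>x y. 0 \<le> x \<Longrightarrow> x \<le> y \<Longrightarrow> y \<le> 1 \<Longrightarrow> g x \<le> g y"
  shows "0 \<le> D"
proof (rule tendsto_lowerbound)
  show "((\<lambda>y. (g y - g t) / (y - t)) \<longlongrightarrow> D) (at t within {0..1})"
    using d by (simp add: has_field_derivative_iff)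
  show "\<forall>\<^sub>F y in at t within {0..1}. 0 \<le> (g y - g t) / (y - t)"
    unfolding eventually_at_filter
  proof (intro always_eventually allI impI)
    fix y assume y: "y \<noteq> t" "y \<in> {0..1}"
    show "0 \<le> (g y - g t) / (y - t)"
      using mono[of y t] mono[of t y] y t by (cases "y < t") (auto simp: divide_nonpos_nonpos divide_nonneg_nonneg)
  qed
  have "t \<in> closure ({0..1} - {t})"
  proof (cases "t = 0")
    case True
    then have "{0..1} - {t} = {0<..1::real}" by auto
    then show ?thesis using True by simp
  next
    case False
    then have "t \<in> closure {0..<t}" using t by simp
    moreover have "{0..<t} \<subseteq> {0..1} - {t}" using t by auto
    ultimately show ?thesis using closure_mono by blast
  qed
  then show "at t within {0..1} \<noteq> bot" by (simp add: at_within_eq_bot_iff)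
qed

text \<open>The parity of the dimension enters here: for \<open>n = 2 * q + 2\<close> the exponents
  \<open>n - 4\<close> and \<open>n - 2\<close> of the root are even, and the weights are
  polynomials.\<close>

lemma even_section_weight:
  fixes v :: real
  assumes "v \<in> {0..1}"
  shows "sqrt (1 - v\<^sup>2) ^ (2 * p) = (1 - v\<^sup>2) ^ p"
  using assms by (simp add: power_mult abs_square_le_1)

lemma integral_indicator_cong:
  fixes g h :: "real \<Rightarrow> real"
  assumes "\<And>v. v \<in> A \<Longrightarrow> g v = h v"
  shows "(\<integral>v. indicator A v * g v \<partial>lborel) = (\<integral>v. indicator A v * h v \<partial>lborel)"
  using assms by (intro Bochner_Integration.integral_cong) (auto split: split_indicator)

text \<open>\<open>F \<ge> 0\<close> suffices, strict positivity is not asked for: the root of order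
  \<open>2 * q + 3\<close> is continuous also where \<open>F\<close> vanishes, and a star body may
  have radial function 0 in some directions.\<close>

lemma intersection_body_dimension_lift:
  fixes k :: "'n::finite" and k' :: "'m::finite" and L :: "(real^'n) set"
  assumes n: "CARD('n) \<ge> 4" "even CARD('n)" "CARD('m) = CARD('n) + 2"
    and \<rho>: "\<And>\<phi>. \<phi> \<in> {0..pi/2} \<Longrightarrow> \<rho> \<phi> = \<kappa> (cos \<phi>)"
    and \<kappa>: "continuous_on UNIV \<kappa>" "\<And>v. 0 \<le> \<kappa> v" "\<exists>t\<in>{0..1}. 0 < \<kappa> t"
    and fc: "continuous_on UNIV f" and f0: "\<And>v. 0 \<le> f v"
    and C: "C > 0" and eq: "\<And>t. t \<in> {0..1} \<Longrightarrow> \<kappa> t =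
      C * (\<integral>v. indicator {0..1} v * (sqrt (1 - v\<^sup>2) ^ (CARD('n) - 4) * f (sqrt (1 - t\<^sup>2) * v) ^ (CARD('n) - 1)) \<partial>lborel)"
    and mono: "\<And>s t. 0 < s \<Longrightarrow> s \<le> t \<Longrightarrow> t \<le> 1 \<Longrightarrow> s * f s \<le> t * f t"
    and f': "\<And>t. t \<in> {0..1} \<Longrightarrow> (f has_real_derivative f' t) (at t within {0..1})" "continuous_on {0..1} f'"
  shows "\<exists>M. intersection_body_of (revolution_body k' \<rho> :: (real^'m) set) M"
proof -
  obtain q where q: "CARD('n) = 2 * q + 2"
  proof -
    obtain r where "CARD('n) = 2 * r" using n(2) by (elim evenE)
    then show ?thesis using n(1) by (intro that[of "r - 1"]) auto
  qed
  have q1: "q \<ge> 1" using q n(1) by simp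
  have N: "CARD('m) = 2 * q + 4" using q n(3) by simp
  have N4: "CARD('m) \<ge> 4" "CARD('m) \<ge> 2" using N by simp_all
  define c where "c v = max 0 (min 1 v)" for v :: real
  have c: "c v \<in> {0..1}" for v by (simp add: c_def)
  have cc: "c v = v" if "v \<in> {0..1}" for v using that by (simp add: c_def)
  define F where "F t = real (2 * q + 1) * f t ^ (2 * q) * (f t + t * f' t)" for t
  have cF: "continuous_on {0..1} F"
    unfolding F_def by (intro continuous_intros f'(2) continuous_on_subset[OF fc]) auto
  have "continuous_on UNIV c" unfolding c_def by (intro continuous_intros)
  then have cFc: "continuous_on UNIV (\<lambda>v. F (c v))"
    by (intro continuous_on_compose2[OF cF]) (use c in auto)
  have F0: "0 \<le> F t" if t: "t \<in> {0..1}" for t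
  proof -
    have "((\<lambda>t. t * f t) has_real_derivative f t + t * f' t) (at t within {0..1})"
      by (rule derivative_eq_intros f'(1) t refl)+ simp
    then have "0 \<le> f t + t * f' t"
    proof (rule derivative_nonneg_within[OF _ t])
      fix x y :: real assume "0 \<le> x" "x \<le> y" "y \<le> 1"
      then show "x * f x \<le> y * f y" using mono[of x y] f0[of y] by (cases "x = 0") auto
    qed
    then show ?thesis using f0[of t] by (simp add: F_def)
  qed
  obtain B where B: "\<And>v. F (c v) \<le> B"
  proof -
    have "bounded (F ` {0..1})" by (intro compact_imp_bounded compact_continuous_image cF) auto
    then obtain B where "\<forall>x\<in>{0..1}. \<bar>F x\<bar> \<le> B" by (auto simp: bounded_real)
    then have "F (c v) \<le> B" for v using c abs_le_D1 by blast
    then show ?thesis by (rule that)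
  qed
  have exps: "CARD('m) - 4 = 2 * q" "CARD('m) - 1 = 2 * q + 3" using N by simp_all
  obtain C2 where C2: "C2 > 0" and vol: "\<And>M g B (\<xi>::real^'m). closed M \<Longrightarrow> g \<in> borel_measurable borel \<Longrightarrow>
      (\<And>v. 0 \<le> g v \<and> g v < B) \<Longrightarrow>
      (\<And>y. y \<in> M \<longleftrightarrow> norm y \<le> g (\<bar>y $ k'\<bar> / norm y)) \<Longrightarrow> norm \<xi> = 1 \<Longrightarrow>
     measure (hyperplane_measure \<xi>) (M \<inter> {x. x \<bullet> \<xi> = 0}) =
     C2 * (\<integral>v. indicator {0..1} v * (sqrt (1 - v\<^sup>2) ^ (2 * q) * g (sqrt (1 - (\<xi> $ k')\<^sup>2) * v) ^ (2 * q + 3)) \<partial>lborel)"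
  proof (rule section_volume[OF N4(1), of k', unfolded exps], goal_cases)
    case (1 C)
    show ?case by (rule 1(1)[OF 1(2)], rule 1(3))
  qed
  \<comment> \<open>Chosen so that \<open>C2 * l * (2 * q) = C\<close>, where \<open>2 * q\<close>
    is the factor produced by the integration by parts.\<close>
  define l where "l = C / (2 * q * C2)"
  have l: "l > 0" using C C2 q1 by (simp add: l_def)
  define g where "g v = root (2 * q + 3) (l * F (c v))" for v
  have gpow: "g v ^ (2 * q + 3) = l * F (c v)" for v
    unfolding g_def using l F0[OF c] by (intro real_root_pow_pos2) auto
  have cg: "continuous_on UNIV g"
    unfolding g_def by (intro continuous_intros cFc)
  have g0: "0 \<le> g v" for v
    using l F0[OF c] by (simp add: g_def)
  have gB: "g v < root (2 * q + 3) (l * B) + 1" for v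
  proof -
    have "g v \<le> root (2 * q + 3) (l * B)"
      unfolding g_def using B l by (intro real_root_le_mono) auto
    then show ?thesis by simp
  qed
  have \<kappa>eq: "\<kappa> t = C2 * (\<integral>v. indicator {0..1} v * (sqrt (1 - v\<^sup>2) ^ (2 * q) * g (sqrt (1 - t\<^sup>2) * v) ^ (2 * q + 3)) \<partial>lborel)"
    if t: "t \<in> {0..1}" for t
  proof -
    define s where "s = sqrt (1 - t\<^sup>2)"
    have s: "s \<in> {0..1}" using t by (auto simp: s_def abs_square_le_1)
    have sv: "s * v \<in> {0..1}" if "v \<in> {0..1}" for v using s that by (simp add: mult_le_one)
    have "C2 * (\<integral>v. indicator {0..1} v * (sqrt (1 - v\<^sup>2) ^ (2 * q) * g (s * v) ^ (2 * q + 3)) \<partial>lborel) =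
      C2 * (\<integral>v. l * (indicator {0..1} v * ((1 - v\<^sup>2) ^ q * F (s * v))) \<partial>lborel)"
      by (rule arg_cong[where f="\<lambda>x. C2 * x"], rule Bochner_Integration.integral_cong[OF refl])
         (auto simp: gpow cc[OF sv] even_section_weight split: split_indicator)
    also have "\<dots> = C2 * l * (2 * q) * (\<integral>v. indicator {0..1} v * ((1 - v\<^sup>2) ^ (q - 1) * f (s * v) ^ (2 * q + 1)) \<partial>lborel)"
      unfolding F_def using integral_by_parts_dimension_shift[OF f' q1 s] by simp
    also have "\<dots> = C * (\<integral>v. indicator {0..1} v * ((1 - v\<^sup>2) ^ (q - 1) * f (s * v) ^ (2 * q + 1)) \<partial>lborel)"
      using C2 q1 by (simp add: l_def)
    also have "\<dots> = C * (\<integral>v. indicator {0..1} v * (sqrt (1 - v\<^sup>2) ^ (2 * (q - 1)) * f (s * v) ^ (2 * q + 1)) \<partial>lborel)"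
      by (rule arg_cong[where f="\<lambda>x. C * x"], rule integral_indicator_cong) (simp only: even_section_weight)
    also have "\<dots> = \<kappa> t"
      using eq[OF t] by (simp add: q s_def diff_mult_distrib2)
    finally show ?thesis by (simp add: s_def)
  qed
  \<comment> \<open>The new body needs an interior point. If \<open>g\<close> vanished on
    \<open>[0, 1]\<close>, so would \<open>\<kappa>\<close> by the formula just proved.\<close>
  have "\<exists>t\<in>{0..1}. 0 < g t"
  proof (rule ccontr)
    assume "\<not> (\<exists>t\<in>{0..1}. 0 < g t)"
    then have gz: "g t = 0" if "t \<in> {0..1}" for t using g0[of t] that by force
    obtain t where t: "t \<in> {0..1}" "0 < \<kappa> t" using \<kappa>(3) by blast
    have s: "sqrt (1 - t\<^sup>2) \<in> {0..1}" using t by (auto simp: abs_square_le_1)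
    have sv: "sqrt (1 - t\<^sup>2) * v \<in> {0..1}" if "v \<in> {0..1}" for v using s that by (simp add: mult_le_one)
    have "(\<integral>v. indicator {0..1} v * (sqrt (1 - v\<^sup>2) ^ (2 * q) * g (sqrt (1 - t\<^sup>2) * v) ^ (2 * q + 3)) \<partial>lborel) =
       (\<integral>v. indicator {0..1} (v::real) * 0 \<partial>lborel)"
      by (rule integral_indicator_cong) (simp add: gz[OF sv])
    then show False using \<kappa>eq[OF t(1)] t(2) by simp
  qed
  then obtain t0 where t0: "t0 \<in> {0..1}" "0 < g t0" by blast
  define M where "M = (revolution_body k' (\<lambda>\<phi>. g (cos \<phi>)) :: (real^'m) set)"
  have M: "star_body M" "\<And>\<xi>. norm \<xi> = 1 \<Longrightarrow> radial_fun M \<xi> = g \<bar>\<xi> $ k'\<bar>"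
    unfolding M_def using star_body_revolution_body[OF N4(2) cg g0 refl t0, where k = k'] by auto
  obtain t1 where t1: "t1 \<in> {0..1}" "0 < \<kappa> t1" using \<kappa>(3) by blast
  let ?K = "revolution_body k' \<rho> :: (real^'m) set"
  have K: "star_body ?K" "\<And>\<xi>. norm \<xi> = 1 \<Longrightarrow> radial_fun ?K \<xi> = \<kappa> \<bar>\<xi> $ k'\<bar>"
    using star_body_revolution_body[OF N4(2) \<kappa>(1,2) \<rho> t1, where k = k'] by auto
  have "intersection_body_of ?K M"
    unfolding intersection_body_of_def
  proof (intro conjI K(1) M(1) ballI)
    fix \<xi> :: "real^'m" assume "\<xi> \<in> sphere 0 1"
    then have \<xi>: "norm \<xi> = 1" by simp
    have t: "\<bar>\<xi> $ k'\<bar> \<in> {0..1}" using component_le_norm_cart[of \<xi> k'] \<xi> by simp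
    have "closed M" using M(1) by (simp add: star_body_def compact_imp_closed)
    then have "measure (hyperplane_measure \<xi>) (M \<inter> {x. x \<bullet> \<xi> = 0}) =
      C2 * (\<integral>v. indicator {0..1} v * (sqrt (1 - v\<^sup>2) ^ (2 * q) * g (sqrt (1 - (\<xi> $ k')\<^sup>2) * v) ^ (2 * q + 3)) \<partial>lborel)"
      using cg g0 gB \<xi> star_body_mem_iff[OF M g0]
      by (intro vol[where B = "root (2 * q + 3) (l * B) + 1"]) (auto intro: borel_measurable_continuous_onI)
    then show "radial_fun ?K \<xi> = measure (hyperplane_measure \<xi>) (M \<inter> {x. x \<bullet> \<xi> = 0})"
      using \<kappa>eq[OF t] K(2)[OF \<xi>] by simp
  qed
  then show ?thesis by blast
qed

section \<open>Zonal test functions with prescribed Radon transform\<close>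

lemma ex_pderiv:
  fixes p :: "real poly"
  shows "\<exists>P. pderiv P = p"
proof -
  have "pderiv (\<Sum>i\<le>degree p. monom (coeff p i / real (Suc i)) (Suc i)) = (\<Sum>i\<le>degree p. monom (coeff p i) i)"
    by (simp add: higher_pderiv_sum[of 1, simplified] pderiv_monom del: of_nat_Suc)
  then show ?thesis by (metis poly_as_sum_of_monoms)
qed

lemma higher_pderiv_eq_0:
  fixes p :: "real poly"
  shows "degree p < m \<Longrightarrow> (pderiv ^^ m) p = 0"
proof (induction m arbitrary: p)
  case (Suc m)
  show ?case
  proof (cases "degree p = 0")
    case True
    then have "pderiv p = 0" by (simp add: pderiv_eq_0_iff)
    moreover have "(pderiv ^^ m) 0 = (0 :: real poly)" by (induction m) auto
    ultimately show ?thesis by (simp add: funpow_Suc_right del: funpow.simps)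
  next
    case False
    then have "degree (pderiv p) < m" using Suc.prems by (simp add: degree_pderiv)
    then show ?thesis using Suc.IH by (simp add: funpow_Suc_right del: funpow.simps)
  qed
qed simp

text \<open>One differentiation of \<open>l ^ Suc m * r\<close> leaves a factor
  \<open>l ^ m\<close>; the cofactor changes, so the induction runs over all
  \<open>r\<close>.\<close>

lemma higher_pderiv_root_power:
  fixes l r :: "real poly"
  assumes "poly l a = 0"
  shows "i < M \<Longrightarrow> poly ((pderiv ^^ i) (l ^ M * r)) a = 0"
proof (induction i arbitrary: M r)
  case 0
  then show ?case using assms by simp
next
  case (Suc i)
  then obtain m where m: "M = Suc m" "i < m" by (cases M) auto
  have "pderiv (l ^ M * r) = l ^ m * (smult (of_nat (Suc m)) (pderiv l) * r + l * pderiv r)"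
    by (simp add: m pderiv_mult pderiv_power_Suc algebra_simps smult_add_left del: of_nat_Suc power_Suc)
       (simp add: algebra_simps)
  then show ?case using Suc.IH[OF m(2)] by (simp add: funpow_Suc_right del: funpow.simps)
qed

text \<open>Vanishing to order \<open>j\<close> at \<open>a\<close> survives multiplication by any
  polynomial, by the product rule.\<close>

lemma higher_pderiv_root_mult:
  fixes p r :: "real poly"
  assumes "\<And>i. i < j \<Longrightarrow> poly ((pderiv ^^ i) p) a = 0"
  shows "i < j \<Longrightarrow> poly ((pderiv ^^ i) (p * r)) a = 0"
  using assms
proof (induction j arbitrary: i p r)
  case (Suc j)
  show ?case
  proof (cases i)
    case 0
    then show ?thesis using Suc.prems(2)[of 0] by simp
  next
    case (Suc i')
    then have i': "i' < j" using Suc.prems by simp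
    have "poly ((pderiv ^^ i') (p * pderiv r)) a = 0"
      using Suc.prems(2) by (intro Suc.IH[OF i']) simp
    moreover have "poly ((pderiv ^^ i') (pderiv p * r)) a = 0"
      using Suc.prems(2)[of "Suc _"] by (intro Suc.IH[OF i']) (simp add: funpow_Suc_right del: funpow.simps)
    ultimately show ?thesis
      by (simp add: Suc funpow_Suc_right pderiv_mult higher_pderiv_add mult.commute del: funpow.simps)
  qed
qed simp

text \<open>The centre \<open>x\<close> comes last because it is the running variable: in the
  derivative with respect to the centre all terms but one telescope away, which makes this an
  antiderivative of the integrand in the Taylor remainder.\<close>

definition taylor_poly :: "nat \<Rightarrow> real poly \<Rightarrow> real \<Rightarrow> real \<Rightarrow> real" where
  "taylor_poly i p y x = (\<Sum>j\<le>i. poly ((pderiv ^^ j) p) x * (y - x) ^ j / fact j)"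

lemma taylor_poly_deriv:
  "(taylor_poly i p y has_real_derivative poly ((pderiv ^^ Suc i) p) x * (y - x) ^ i / fact i) (at x)"
proof (induction i)
  case 0
  have "taylor_poly 0 p y = poly p" by (simp add: taylor_poly_def fun_eq_iff)
  then show ?case by (simp add: poly_DERIV)
next
  case (Suc i)
  let ?d = "\<lambda>j. (pderiv ^^ j) p"
  have d1: "((\<lambda>x. (y - x) ^ Suc i) has_real_derivative - (real (Suc i) * (y - x) ^ i)) (at x)"
  proof -
    have "((\<lambda>x. y - x) has_real_derivative - 1) (at x)" by (auto intro!: derivative_eq_intros)
    from DERIV_power_Suc[OF this, of i] show ?thesis by (simp add: algebra_simps)
  qed
  have "((\<lambda>x. poly (?d (Suc i)) x * (y - x) ^ Suc i / fact (Suc i)) has_real_derivative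
     (poly (?d (Suc (Suc i))) x * (y - x) ^ Suc i - poly (?d (Suc i)) x * (real (Suc i) * (y - x) ^ i)) / fact (Suc i)) (at x)"
    by (rule DERIV_cong[OF DERIV_cdivide[OF DERIV_mult[OF poly_DERIV[of "?d (Suc i)"] d1], of "fact (Suc i)"]])
      (simp add: mult.commute del: of_nat_Suc fact_Suc power_Suc)
  from DERIV_add[OF Suc this]
  have "((\<lambda>x. taylor_poly i p y x + poly (?d (Suc i)) x * (y - x) ^ Suc i / fact (Suc i)) has_real_derivative
     poly (?d (Suc i)) x * (y - x) ^ i / fact i +
     (poly (?d (Suc (Suc i))) x * (y - x) ^ Suc i - poly (?d (Suc i)) x * (real (Suc i) * (y - x) ^ i)) / fact (Suc i)) (at x)" .
  moreover have "(\<lambda>x. taylor_poly i p y x + poly (?d (Suc i)) x * (y - x) ^ Suc i / fact (Suc i)) = taylor_poly (Suc i) p y"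
    by (simp add: taylor_poly_def fun_eq_iff)
  moreover have "poly (?d (Suc i)) x * (y - x) ^ i / fact i +
     (poly (?d (Suc (Suc i))) x * (y - x) ^ Suc i - poly (?d (Suc i)) x * (real (Suc i) * (y - x) ^ i)) / fact (Suc i)
     = poly (?d (Suc (Suc i))) x * (y - x) ^ Suc i / fact (Suc i)"
  proof -
    have "A / F + (B - A * N) / (N * F) = B / (N * F)" if "N \<noteq> 0" "F \<noteq> 0" for A B N F :: real
      using that by (simp add: divide_simps)
    from this[of "real (Suc i)" "fact i" "poly (?d (Suc i)) x * (y - x) ^ i"]
    show ?thesis by (simp add: mult_ac del: funpow.simps of_nat_Suc power_Suc)
  qed
  ultimately show ?case by simp
qed

lemma taylor_poly_self: "taylor_poly i p y y = poly p y"
proof -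
  have "taylor_poly i p y y = (\<Sum>j\<le>i. if j = 0 then poly p y else 0)"
    unfolding taylor_poly_def by (intro sum.cong) auto
  then show ?thesis by simp
qed

lemma taylor_poly_exact:
  assumes "(pderiv ^^ Suc i) r = 0"
  shows "taylor_poly i r y x = poly r y"
proof -
  have "(taylor_poly i r y has_real_derivative 0) (at x)" for x
    using taylor_poly_deriv[of i r y x] assms by simp
  then have "taylor_poly i r y x = taylor_poly i r y y"
    by (intro DERIV_isconst_all[of "taylor_poly i r y"]) simp
  then show ?thesis by (simp add: taylor_poly_self)
qed

text \<open>In the variable \<open>x = t\<^sup>2\<close> this is Taylor's formula with integral
  remainder, since \<open>fact i * taylor_poly i p y\<close> is an antiderivative in the centre. The
  lower end \<open>a\<close> contributes 0. The upper end is \<open>y\<close>, which gives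
  \<open>poly p y\<close>, or \<open>b\<close>, where \<open>p\<close> has the Taylor polynomial of
  \<open>r\<close>, which is exact. As \<open>D\<close> vanishes at \<open>a\<close> and
  \<open>b\<close>, clamping its argument extends it by 0.\<close>

lemma abel_integral_poly:
  fixes p r :: "real poly"
  assumes ab: "0 \<le> a" "a \<le> b"
    and pa: "\<And>j. j \<le> i \<Longrightarrow> poly ((pderiv ^^ j) p) a = 0"
    and pb: "\<And>j. j \<le> i \<Longrightarrow> poly ((pderiv ^^ j) p) b = poly ((pderiv ^^ j) r) b"
    and r: "(pderiv ^^ Suc i) r = 0"
    and D: "D = (pderiv ^^ Suc i) p" "poly D a = 0" "poly D b = 0"
    and y: "0 \<le> y"
  shows "(\<integral>t. indicator {0..sqrt y} t * (2 * t * poly D (max a (min b (t\<^sup>2))) * (y - t\<^sup>2) ^ i) \<partial>lborel) =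
    fact i * (if y \<le> a then 0 else if y \<le> b then poly p y else poly r y)"
proof -
  define c where "c = max a (min b y)"
  have ac: "a \<le> c" "c \<le> b" "0 \<le> c" using ab by (auto simp: c_def)
  have "(\<integral>t. indicator {0..sqrt y} t * (2 * t * poly D (max a (min b (t\<^sup>2))) * (y - t\<^sup>2) ^ i) \<partial>lborel) =
    (\<integral>t. (2 * t * poly D (t\<^sup>2) * (y - t\<^sup>2) ^ i) * indicator {sqrt a..sqrt c} t \<partial>lborel)"
  proof (rule Bochner_Integration.integral_cong[OF refl])
    fix t :: real
    have sq: "sqrt u \<le> t \<longleftrightarrow> u \<le> t\<^sup>2" "t \<le> sqrt u \<longleftrightarrow> t\<^sup>2 \<le> u" if "0 \<le> t" "0 \<le> u" for u
      using that by (metis real_sqrt_le_iff real_sqrt_unique abs_of_nonneg real_sqrt_abs)+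
    show "indicator {0..sqrt y} t * (2 * t * poly D (max a (min b (t\<^sup>2))) * (y - t\<^sup>2) ^ i) =
      2 * t * poly D (t\<^sup>2) * (y - t\<^sup>2) ^ i * indicator {sqrt a..sqrt c} t"
    proof (cases "0 \<le> t")
      case False
      then have "\<not> sqrt a \<le> t" using ab by (meson order_trans real_sqrt_ge_zero)
      then show ?thesis using False by simp
    next
      case t: True
      consider "t\<^sup>2 < a" | "t\<^sup>2 = a" | "a < t\<^sup>2" "t\<^sup>2 \<le> b" | "b < t\<^sup>2" by linarith
      then show ?thesis
      proof cases
        case 1
        then show ?thesis using D ab t by (simp add: sq max_def min_def)
      next
        case 2
        then show ?thesis using D ab by (simp add: max_def min_def)
      next
        case 3
        then have "t \<in> {0..sqrt y} \<longleftrightarrow> t \<in> {sqrt a..sqrt c}"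
          using t y ab ac by (auto simp: sq c_def)
        then show ?thesis using 3 by (simp add: indicator_def max_def min_def)
      next
        case 4
        then have "t \<notin> {sqrt a..sqrt c}" using t ac by (auto simp: sq)
        then show ?thesis using 4 D ab by (simp add: max_def min_def)
      qed
    qed
  qed
  also have "\<dots> = fact i * taylor_poly i p y ((sqrt c)\<^sup>2) - fact i * taylor_poly i p y ((sqrt a)\<^sup>2)"
  proof (rule integral_FTC_Icc_real)
    show "sqrt a \<le> sqrt c" using ac by simp
    fix t :: real
    have "((\<lambda>t. taylor_poly i p y (t\<^sup>2)) has_real_derivative
       poly ((pderiv ^^ Suc i) p) (t\<^sup>2) * (y - t\<^sup>2) ^ i / fact i * (2 * t)) (at t)"
      by (rule DERIV_chain2[OF taylor_poly_deriv]) (auto intro!: derivative_eq_intros)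
    from DERIV_cmult[OF this, of "fact i"]
    show "((\<lambda>t. fact i * taylor_poly i p y (t\<^sup>2)) has_real_derivative 2 * t * poly D (t\<^sup>2) * (y - t\<^sup>2) ^ i) (at t)"
      by (simp add: D(1) mult_ac del: funpow.simps)
    show "isCont (\<lambda>t. 2 * t * poly D (t\<^sup>2) * (y - t\<^sup>2) ^ i) t" by (intro continuous_intros) 
  qed
  also have "taylor_poly i p y ((sqrt a)\<^sup>2) = 0"
    using ab pa by (simp add: taylor_poly_def)
  also have "taylor_poly i p y ((sqrt c)\<^sup>2) = (if y \<le> a then 0 else if y \<le> b then poly p y else poly r y)"
  proof -
    consider "y \<le> a" | "a < y" "y \<le> b" | "a < y" "b < y" by linarith
    then show ?thesis
    proof cases
      case 1
      then have "c = a" using ab by (simp add: c_def)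
      then show ?thesis using 1 ab pa by (simp add: taylor_poly_def)
    next
      case 2
      then have "c = y" by (simp add: c_def)
      then show ?thesis using 2 y by (simp add: taylor_poly_self)
    next
      case 3
      then have c: "c = b" using ab by (simp add: c_def)
      have "taylor_poly i p y b = taylor_poly i r y b"
        unfolding taylor_poly_def by (intro sum.cong) (simp_all add: pb)
      then show ?thesis using 3 c ac by (simp add: taylor_poly_exact[OF r])
    qed
  qed
  finally show ?thesis by simp
qed

text \<open>The normalised antiderivative of \<open>((x - a) * (b - x)) ^ Suc M\<close>: this is
  positive between \<open>a\<close> and \<open>b\<close>, and its multiple roots make the step flat
  to order \<open>M\<close> at both ends.\<close>

lemma smoothstep_poly:
  fixes a b :: real
  assumes "a < b"
  obtains S :: "real poly" where
    "\<And>i. i \<le> M \<Longrightarrow> poly ((pderiv ^^ i) S) a = 0"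
    "\<And>i. i \<le> M \<Longrightarrow> poly ((pderiv ^^ i) (S - 1)) b = 0"
    "\<And>x. a \<le> x \<Longrightarrow> x \<le> b \<Longrightarrow> 0 \<le> poly (pderiv S) x"
    "\<And>x. a \<le> x \<Longrightarrow> x \<le> b \<Longrightarrow> 0 \<le> poly S x \<and> poly S x \<le> 1"
proof -
  define u where "u = [:-a, 1:] ^ Suc M * [:b, -1:] ^ Suc M"
  obtain T where T: "pderiv T = u" using ex_pderiv by blast
  have u0: "poly ((pderiv ^^ i) u) a = 0" "poly ((pderiv ^^ i) u) b = 0" if "i \<le> M" for i
  proof -
    show "poly ((pderiv ^^ i) u) a = 0"
      unfolding u_def using that by (intro higher_pderiv_root_power) auto
    show "poly ((pderiv ^^ i) u) b = 0"
      unfolding u_def using that by (subst mult.commute, intro higher_pderiv_root_power) auto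
  qed
  have upos: "poly u x > 0" if "a < x" "x < b" for x
    using that by (simp add: u_def poly_power del: power_Suc)
  have dT: "(poly T has_real_derivative poly u x) (at x)" for x
    using poly_DERIV[of T x] by (simp add: T)
  define c where "c = poly T b - poly T a"
  have c: "c > 0"
  proof -
    have "poly T a < poly T b"
    proof (rule DERIV_pos_imp_increasing_open[OF assms])
      show "\<exists>y. (poly T has_real_derivative y) (at x) \<and> 0 < y" if "a < x" "x < b" for x
        using dT upos that by blast
    qed (auto intro!: continuous_intros)
    then show ?thesis by (simp add: c_def)
  qed
  define S where "S = smult (1 / c) (T - [:poly T a:])"
  have dS: "pderiv S = smult (1 / c) u" by (simp add: S_def pderiv_smult pderiv_diff pderiv_pCons T)
  have Sa: "poly S a = 0" and Sb: "poly S b = 1" using c by (simp_all add: S_def c_def)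
  have dS1: "pderiv (S - 1) = pderiv S" by (simp add: pderiv_diff pderiv_1)
  have dpos: "0 \<le> poly (pderiv S) x" if "a \<le> x" "x \<le> b" for x
  proof -
    consider "x = a" | "x = b" | "a < x" "x < b" using \<open>a \<le> x\<close> \<open>x \<le> b\<close> by linarith
    then have "0 \<le> poly u x"
      using u0[of 0] upos[of x] by cases auto
    then show ?thesis using c by (simp add: dS)
  qed
  have dS': "\<exists>d. (poly S has_real_derivative d) (at z) \<and> 0 \<le> d" if "a \<le> z" "z \<le> b" for z
    using poly_DERIV dpos[OF that] by blast
  show ?thesis
  proof (rule that[OF _ _ dpos])
    show "poly ((pderiv ^^ i) S) a = 0" if "i \<le> M" for i
      using that u0 by (cases i) (simp_all add: Sa funpow_Suc_right dS higher_pderiv_smult del: funpow.simps)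
    show "poly ((pderiv ^^ i) (S - 1)) b = 0" if "i \<le> M" for i
      using that u0 by (cases i) (simp_all add: Sb funpow_Suc_right dS dS1 higher_pderiv_smult del: funpow.simps)
    show "0 \<le> poly S x \<and> poly S x \<le> 1" if "a \<le> x" "x \<le> b" for x
    proof -
      have "poly S a \<le> poly S x"
        using that by (intro DERIV_nonneg_imp_nondecreasing[OF that(1)] dS') auto
      moreover have "poly S x \<le> poly S b"
        using that by (intro DERIV_nonneg_imp_nondecreasing[OF that(2)] dS') auto
      ultimately show ?thesis by (simp add: Sa Sb)
    qed
  qed
qed

lemma integrable_indicator_continuous:
  fixes h :: "real \<Rightarrow> real"
  assumes "continuous_on {a..b} h"
  shows "integrable lborel (\<lambda>t. indicator {a..b} t * h t)"
  using borel_integrable_atLeastAtMost'[OF assms] by (simp add: set_integrable_def)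

text \<open>
  Here \<open>\<gamma> t = 2 t d (t\<^sup>2) / fact q\<close>, where \<open>d\<close> is the derivative of order \<open>q + 1\<close> of \<open>(1 - y) ^ q * S y\<close>. It is
  supported in \<open>[a, b]\<close> since \<open>(1 - y) ^ q\<close> has degree \<open>q\<close>; \<open>\<sigma>\<close> is the derivative of \<open>S\<close>.
\<close>

lemma smoothstep_kernel:
  fixes a b :: real
  assumes ab: "0 < a" "a < b" "b < 1" and q: "q \<ge> 1"
  obtains \<gamma> S \<sigma> :: "real \<Rightarrow> real" where
    "continuous_on UNIV \<gamma>" "\<gamma> 0 = 0"
    "\<And>y. 0 \<le> y \<Longrightarrow> (\<integral>t. indicator {0..sqrt y} t * (\<gamma> t * (y - t\<^sup>2) ^ q) \<partial>lborel) = (1 - y) ^ q * S y"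
    "\<And>y. 0 \<le> y \<Longrightarrow> (\<integral>t. indicator {0..sqrt y} t * (\<gamma> t * (1 - t\<^sup>2) * (y - t\<^sup>2) ^ (q - 1)) \<partial>lborel) = (1 - y) ^ (q + 1) * \<sigma> y / q"
    "\<And>y. y \<le> a \<Longrightarrow> S y = 0" "\<And>y. b \<le> y \<Longrightarrow> S y = 1" "\<And>y. 0 \<le> S y \<and> S y \<le> 1"
    "continuous_on UNIV \<sigma>" "\<And>y. 0 \<le> \<sigma> y" "\<And>y. y \<notin> {a..b} \<Longrightarrow> \<sigma> y = 0"
    "(\<integral>\<tau>. indicator {0..1} \<tau> * (2 * \<tau> * \<sigma> (1 - \<tau>\<^sup>2)) \<partial>lborel) = 1"
proof -
  \<comment> \<open>Flatness of order \<open>Suc q\<close> makes even \<open>D\<close>, the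
    derivative of order \<open>q + 1\<close>, vanish at \<open>a\<close> and \<open>b\<close>, so
    that its extension by 0 is continuous.\<close>
  obtain s :: "real poly" where s:
    "\<And>i. i \<le> Suc q \<Longrightarrow> poly ((pderiv ^^ i) s) a = 0"
    "\<And>i. i \<le> Suc q \<Longrightarrow> poly ((pderiv ^^ i) (s - 1)) b = 0"
    "\<And>x. a \<le> x \<Longrightarrow> x \<le> b \<Longrightarrow> 0 \<le> poly (pderiv s) x"
    "\<And>x. a \<le> x \<Longrightarrow> x \<le> b \<Longrightarrow> 0 \<le> poly s x \<and> poly s x \<le> 1"
    using smoothstep_poly[OF ab(2), of "Suc q"] by metis
  have sab: "poly s a = 0" "poly s b = 1" "poly (pderiv s) a = 0" "poly (pderiv s) b = 0"
    using s(1)[of 0] s(2)[of 0] s(1)[of 1] s(2)[of 1] by (auto simp: pderiv_diff pderiv_1)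
  define r :: "real poly" where "r = [:1, -1:] ^ q"
  have pr: "poly r y = (1 - y) ^ q" for y :: real by (simp add: r_def poly_power)
  have pr': "poly (pderiv r) y = - (q * (1 - y) ^ (q - 1))" for y :: real
  proof -
    have "(poly r has_real_derivative poly (pderiv r) y) (at y)" by (rule poly_DERIV)
    moreover have "poly r = (\<lambda>y. (1 - y) ^ q)" using pr by auto
    moreover have "((\<lambda>y. (1 - y) ^ q) has_real_derivative - (q * (1 - y) ^ (q - 1))) (at y)"
      by (auto intro!: derivative_eq_intros)
    ultimately show ?thesis by (metis DERIV_unique)
  qed
  \<comment> \<open>On \<open>[a, b]\<close> this is the prescribed transform
    \<open>(1 - y) ^ q * S y\<close>; it joins 0 at \<open>a\<close> and \<open>r\<close> at
    \<open>b\<close> with all derivatives up to order \<open>q + 1\<close>.\<close>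
  define p where "p = s * r"
  define D where "D = (pderiv ^^ Suc q) p"
  have "degree r \<le> q" unfolding r_def using degree_power_le[of "[:1, -1::real:]" q] by simp
  then have r0: "(pderiv ^^ Suc q) r = 0" by (intro higher_pderiv_eq_0) simp
  have pa: "poly ((pderiv ^^ j) p) a = 0" if "j \<le> Suc q" for j
    unfolding p_def using s(1) that by (intro higher_pderiv_root_mult[where j = "Suc (Suc q)"]) auto
  have pb: "poly ((pderiv ^^ j) p) b = poly ((pderiv ^^ j) r) b" if "j \<le> Suc q" for j
  proof -
    have "poly ((pderiv ^^ j) ((s - 1) * r)) b = 0"
      using s(2) that by (intro higher_pderiv_root_mult[where j = "Suc (Suc q)"]) auto
    moreover have "p = (s - 1) * r + r" by (simp add: p_def algebra_simps)
    ultimately show ?thesis by (simp add: higher_pderiv_add)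
  qed
  have Da: "poly D a = 0" and Db: "poly D b = 0"
    using pa[of "Suc q"] pb[of "Suc q"] r0 by (simp_all add: D_def)
  define d where "d x = poly D (max a (min b x))" for x
  have cd: "continuous_on UNIV d" unfolding d_def by (intro continuous_intros)
  define \<gamma> where "\<gamma> t = 2 * t * d (t\<^sup>2) / fact q" for t
  have cg: "continuous_on UNIV \<gamma>" unfolding \<gamma>_def by (intro continuous_intros continuous_on_compose2[OF cd]) auto
  define S where "S y = (if y \<le> a then 0 else if y \<le> b then poly s y else 1)" for y
  define \<sigma> where "\<sigma> y = poly (pderiv s) (max a (min b y))" for y
  have \<sigma>0: "\<sigma> y = 0" if "y \<notin> {a..b}" for y
    using that sab ab by (auto simp: \<sigma>_def max_def min_def)
  have A: "(\<integral>t. indicator {0..sqrt y} t * (2 * t * d (t\<^sup>2) * (y - t\<^sup>2) ^ q) \<partial>lborel) = fact q * ((1 - y) ^ q * S y)"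
    if "0 \<le> y" for y
    unfolding d_def using ab pa pb r0 Da Db that
    by (subst abel_integral_poly[where p = p and r = r and D = D])
       (auto simp: D_def S_def pr p_def simp del: funpow.simps)
  \<comment> \<open>Lowering the exponent to \<open>q - 1\<close> replaces \<open>p\<close> and
    \<open>r\<close> by their derivatives, because \<open>D\<close> is also the derivative of order
    \<open>q\<close> of \<open>pderiv p\<close>.\<close>
  have B: "(\<integral>t. indicator {0..sqrt y} t * (2 * t * d (t\<^sup>2) * (y - t\<^sup>2) ^ (q - 1)) \<partial>lborel) =
     fact (q - 1) * (if y \<le> a then 0 else if y \<le> b then poly (pderiv p) y else poly (pderiv r) y)"
    if "0 \<le> y" for y
  proof -
    have sh: "(pderiv ^^ j) (pderiv x) = (pderiv ^^ Suc j) x" for j and x :: "real poly"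
      by (simp add: funpow_Suc_right del: funpow.simps)
    have q': "Suc (q - 1) = q" using q by simp
    show ?thesis
      unfolding d_def
      by (rule abel_integral_poly)
         (use ab pa pb r0 Da Db that q' in \<open>auto simp: sh D_def simp del: funpow.simps\<close>)
  qed
  have i1: "integrable lborel (\<lambda>t. indicator {0..sqrt y} t * (2 * t * d (t\<^sup>2) * (y - t\<^sup>2) ^ j))" for y j
    by (intro integrable_indicator_continuous continuous_intros continuous_on_compose2[OF cd]) auto
  show ?thesis
  proof (rule that[of \<gamma> S \<sigma>])
    show "(\<integral>t. indicator {0..sqrt y} t * (\<gamma> t * (y - t\<^sup>2) ^ q) \<partial>lborel) = (1 - y) ^ q * S y" if "0 \<le> y" for y
    proof -
      have "(\<integral>t. indicator {0..sqrt y} t * (\<gamma> t * (y - t\<^sup>2) ^ q) \<partial>lborel) =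
        (\<integral>t. (indicator {0..sqrt y} t * (2 * t * d (t\<^sup>2) * (y - t\<^sup>2) ^ q)) / fact q \<partial>lborel)"
        by (simp add: \<gamma>_def)
      then show ?thesis using A[OF that] by simp
    qed
    show "(\<integral>t. indicator {0..sqrt y} t * (\<gamma> t * (1 - t\<^sup>2) * (y - t\<^sup>2) ^ (q - 1)) \<partial>lborel) = (1 - y) ^ (q + 1) * \<sigma> y / q"
      if y: "0 \<le> y" for y
    proof -
      let ?I = "\<lambda>j t. indicator {0..sqrt y} t * (2 * t * d (t\<^sup>2) * (y - t\<^sup>2) ^ j)"
      have fq: "fact q = real q * fact (q - 1)" using q by (simp add: fact_reduce)
      have "(\<integral>t. indicator {0..sqrt y} t * (\<gamma> t * (1 - t\<^sup>2) * (y - t\<^sup>2) ^ (q - 1)) \<partial>lborel) =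
        (\<integral>t. ((1 - y) * ?I (q - 1) t + ?I q t) / fact q \<partial>lborel)"
      proof (rule Bochner_Integration.integral_cong[OF refl])
        fix t :: real
        define E where "E = (y - t\<^sup>2) ^ (q - 1)"
        have qE: "(y - t\<^sup>2) ^ q = (y - t\<^sup>2) * E" using q by (cases q) (auto simp: E_def)
        show "indicator {0..sqrt y} t * (\<gamma> t * (1 - t\<^sup>2) * (y - t\<^sup>2) ^ (q - 1)) = ((1 - y) * ?I (q - 1) t + ?I q t) / fact q"
          unfolding qE E_def[symmetric] by (simp add: \<gamma>_def field_simps)
      qed
      also have "\<dots> = ((1 - y) * (\<integral>t. ?I (q - 1) t \<partial>lborel) + (\<integral>t. ?I q t \<partial>lborel)) / fact q"
        using i1[of y "q - 1"] i1[of y q] by simp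
      also have "\<dots> = ((1 - y) * (if y \<le> a then 0 else if y \<le> b then poly (pderiv p) y else poly (pderiv r) y)) / q + (1 - y) ^ q * S y"
        using q unfolding A[OF y] B[OF y] by (simp add: fq field_simps)
      \<comment> \<open>The terms with \<open>S\<close> cancel since \<open>(1 - y)\<close> times
        the derivative of \<open>(1 - y) ^ q\<close> is \<open>- q * (1 - y) ^ q\<close>.\<close>
      also have "\<dots> = (1 - y) ^ (q + 1) * \<sigma> y / q"
      proof -
        obtain k where k: "q = Suc k" using q by (cases q) auto
        consider "y < a" | "y = a" | "a < y" "y \<le> b" | "b < y" by linarith
        then show ?thesis
        proof cases
          case 1 then show ?thesis by (simp add: S_def \<sigma>0)
        next
          case 2 then show ?thesis using ab sab by (simp add: S_def \<sigma>_def)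
        next
          case 3
          then have "\<sigma> y = poly (pderiv s) y" by (simp add: \<sigma>_def)
          moreover define E where "E = (1 - y) ^ k"
          moreover have "poly (pderiv p) y = poly s y * (- (real q * E)) + poly (pderiv s) y * ((1 - y) * E)"
            by (simp add: p_def pderiv_mult pr pr' k E_def)
          moreover have "(1 - y) * (u * (- (real q * E)) + v * ((1 - y) * E)) / q + (1 - y) * E * u = (1 - y) * ((1 - y) * E) * v / q" for u v
            using q by (simp add: field_simps)
          ultimately show ?thesis using 3 by (simp add: S_def k mult.assoc)
        next
          case 4
          then show ?thesis using ab \<sigma>0[of y] by (simp add: S_def pr' k)
        qed
      qed
      finally show ?thesis .
    qed
    show "0 \<le> S y \<and> S y \<le> 1" for y using s(4)[of y] by (simp add: S_def)
    show "S y = 1" if "b \<le> y" for y using that ab sab by (auto simp: S_def)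
    show "0 \<le> \<sigma> y" for y unfolding \<sigma>_def using ab by (intro s(3)) auto
    show "(\<integral>\<tau>. indicator {0..1} \<tau> * (2 * \<tau> * \<sigma> (1 - \<tau>\<^sup>2)) \<partial>lborel) = 1"
    proof -
      have m: "sqrt (1 - b) \<le> sqrt (1 - a)" using ab by simp
      \<comment> \<open>The integrand is the derivative of
        \<open>- poly s (1 - \<tau>\<^sup>2)\<close> on the interval where it does not vanish, so
        the integral is the total rise of the step.\<close>
      have "(\<integral>\<tau>. indicator {0..1} \<tau> * (2 * \<tau> * \<sigma> (1 - \<tau>\<^sup>2)) \<partial>lborel) =
        (\<integral>\<tau>. (2 * \<tau> * poly (pderiv s) (1 - \<tau>\<^sup>2)) * indicator {sqrt (1 - b)..sqrt (1 - a)} \<tau> \<partial>lborel)"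
      proof (rule Bochner_Integration.integral_cong[OF refl])
        fix \<tau> :: real
        have iff: "\<tau> \<in> {sqrt (1 - b)..sqrt (1 - a)} \<longleftrightarrow> 0 \<le> \<tau> \<and> 1 - \<tau>\<^sup>2 \<in> {a..b}"
        proof (cases "0 \<le> \<tau>")
          case True
          then have "sqrt (\<tau>\<^sup>2) = \<tau>" by simp
          then have "sqrt (1 - b) \<le> \<tau> \<longleftrightarrow> 1 - b \<le> \<tau>\<^sup>2" "\<tau> \<le> sqrt (1 - a) \<longleftrightarrow> \<tau>\<^sup>2 \<le> 1 - a"
            by (metis real_sqrt_le_iff)+
          then show ?thesis using True by auto
        next
          case False
          then have "\<not> sqrt (1 - b) \<le> \<tau>" using ab by (meson diff_ge_0_iff_ge less_imp_le order_trans real_sqrt_ge_zero)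
          then show ?thesis using False by simp
        qed
        have le1: "\<tau> \<le> 1" if "0 \<le> \<tau>" "1 - \<tau>\<^sup>2 \<in> {a..b}"
          using that ab by (simp add: power2_le_imp_le[of \<tau> 1])
        show "indicator {0..1} \<tau> * (2 * \<tau> * \<sigma> (1 - \<tau>\<^sup>2)) =
           2 * \<tau> * poly (pderiv s) (1 - \<tau>\<^sup>2) * indicator {sqrt (1 - b)..sqrt (1 - a)} \<tau>"
        proof (cases "0 \<le> \<tau> \<and> 1 - \<tau>\<^sup>2 \<in> {a..b}")
          case True
          then have "\<sigma> (1 - \<tau>\<^sup>2) = poly (pderiv s) (1 - \<tau>\<^sup>2)" by (simp add: \<sigma>_def)
          then show ?thesis using True iff le1 by (simp add: indicator_def)
        next
          case False
          then have "indicator {sqrt (1 - b)..sqrt (1 - a)} \<tau> = (0::real)" using iff by (simp add: indicator_def)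
          moreover have "indicator {0..1} \<tau> * \<sigma> (1 - \<tau>\<^sup>2) = 0"
            using False \<sigma>0[of "1 - \<tau>\<^sup>2"] by (auto simp: indicator_def)
          ultimately show ?thesis by (auto simp: indicator_def)
        qed
      qed
      also have "\<dots> = - poly s (1 - (sqrt (1 - a))\<^sup>2) - - poly s (1 - (sqrt (1 - b))\<^sup>2)"
      proof (rule integral_FTC_Icc_real[OF m])
        fix \<tau> :: real
        have "((\<lambda>\<tau>. poly s (1 - \<tau>\<^sup>2)) has_real_derivative poly (pderiv s) (1 - \<tau>\<^sup>2) * (- (2 * \<tau>))) (at \<tau>)"
          by (rule DERIV_chain2[OF poly_DERIV]) (auto intro!: derivative_eq_intros)
        from DERIV_minus[OF this]
        show "((\<lambda>\<tau>. - poly s (1 - \<tau>\<^sup>2)) has_real_derivative 2 * \<tau> * poly (pderiv s) (1 - \<tau>\<^sup>2)) (at \<tau>)"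
          by (simp add: mult_ac)
        show "isCont (\<lambda>\<tau>. 2 * \<tau> * poly (pderiv s) (1 - \<tau>\<^sup>2)) \<tau>" by (intro continuous_intros)
      qed
      also have "\<dots> = 1" using ab sab by simp
      finally show ?thesis .
    qed
    show "continuous_on UNIV \<sigma>" unfolding \<sigma>_def by (intro continuous_intros)
    show "S y = 0" if "y \<le> a" for y using that by (simp add: S_def)
    show "\<gamma> 0 = 0" by (simp add: \<gamma>_def)
  qed (use cg \<sigma>0 in auto)
qed

section \<open>Failure of equator-convexity\<close>

text \<open>The substitution \<open>\<tau> = w * v\<close> brings section integrals into the form of
  an Abel integral up to \<open>w\<close>.\<close>

lemma integral_scale_unit_interval:
  fixes h :: "real \<Rightarrow> real"
  assumes w: "0 \<le> w"
  shows "w ^ (2 * j + 1) * (\<integral>v. indicator {0..1} v * ((1 - v\<^sup>2) ^ j * h (w * v)) \<partial>lborel) =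
    (\<integral>\<tau>. indicator {0..w} \<tau> * (h \<tau> * (w\<^sup>2 - \<tau>\<^sup>2) ^ j) \<partial>lborel)"
proof (cases "w = 0")
  case True
  have "(\<integral>\<tau>. indicator {0..w} \<tau> * (h \<tau> * (w\<^sup>2 - \<tau>\<^sup>2) ^ j) \<partial>lborel) = 0"
    by (rule integral_eq_zero_AE, rule AE_mp[OF AE_lborel_singleton[of 0]])
       (use True in \<open>auto intro!: AE_I2 split: split_indicator\<close>)
  then show ?thesis using True by simp
next
  case False
  then have w: "w > 0" using assms by simp
  have "(\<integral>\<tau>. indicator {0..w} \<tau> * (h \<tau> * (w\<^sup>2 - \<tau>\<^sup>2) ^ j) \<partial>lborel) =
    \<bar>w\<bar> *\<^sub>R (\<integral>v. indicator {0..w} (0 + w * v) * (h (0 + w * v) * (w\<^sup>2 - (0 + w * v)\<^sup>2) ^ j) \<partial>lborel)"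
    using w by (intro lborel_integral_real_affine) simp
  also have "\<dots> = w * (\<integral>v. w ^ (2 * j) * (indicator {0..1} v * ((1 - v\<^sup>2) ^ j * h (w * v))) \<partial>lborel)"
  proof -
    have eq: "indicator {0..w} (0 + w * v) * (h (0 + w * v) * (w\<^sup>2 - (0 + w * v)\<^sup>2) ^ j) =
      w ^ (2 * j) * (indicator {0..1} v * ((1 - v\<^sup>2) ^ j * h (w * v)))" for v
    proof -
      have "w\<^sup>2 - (w * v)\<^sup>2 = w\<^sup>2 * (1 - v\<^sup>2)" by (simp add: power_mult_distrib algebra_simps)
      then have "(w\<^sup>2 - (w * v)\<^sup>2) ^ j = w ^ (2 * j) * (1 - v\<^sup>2) ^ j" by (simp add: power_mult_distrib power_mult)
      moreover have "w * v \<in> {0..w} \<longleftrightarrow> v \<in> {0..1}" using w by (auto simp: zero_le_mult_iff)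
      ultimately show ?thesis by (simp add: indicator_def)
    qed
    show ?thesis using w unfolding eq by simp
  qed
  finally show ?thesis by (simp add: mult.assoc)
qed

lemma bounded_on_unit_interval:
  fixes h :: "real \<Rightarrow> real"
  assumes "continuous_on UNIV h"
  shows "\<exists>B. \<forall>t\<in>{0..1}. \<bar>h t\<bar> \<le> B"
proof -
  have "bounded (h ` {0..1})"
    by (intro compact_imp_bounded compact_continuous_image continuous_on_subset[OF assms]) auto
  then show ?thesis by (simp add: bounded_real)
qed

text \<open>Both sides are \<open>C\<close> times the integral of \<open>\<gamma> t * (1 -
  t\<^sup>2) * G \<tau> * (1 - t\<^sup>2 - \<tau>\<^sup>2) ^ (q - 1)\<close> over the quarter disk
  \<open>t\<^sup>2 + \<tau>\<^sup>2 \<le> 1\<close>, taken in the two orders.\<close>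

lemma quarter_disk_swap:
  fixes \<gamma> G \<kappa> :: "real \<Rightarrow> real"
  assumes c\<gamma>: "continuous_on UNIV \<gamma>" and cG: "continuous_on UNIV G" and q: "q \<ge> 1"
    and \<kappa>: "\<And>t. t \<in> {0..1} \<Longrightarrow> \<kappa> t = C * (\<integral>v. indicator {0..1} v * ((1 - v\<^sup>2) ^ (q - 1) * G (sqrt (1 - t\<^sup>2) * v)) \<partial>lborel)"
  shows "(\<integral>t. indicator {0..1} t * (sqrt (1 - t\<^sup>2) ^ (2 * q + 1) * (\<kappa> t * \<gamma> t)) \<partial>lborel) =
    C * (\<integral>\<tau>. indicator {0..1} \<tau> * (G \<tau> * (\<integral>t. indicator {0..sqrt (1 - \<tau>\<^sup>2)} t * (\<gamma> t * (1 - t\<^sup>2) * ((1 - \<tau>\<^sup>2) - t\<^sup>2) ^ (q - 1)) \<partial>lborel)) \<partial>lborel)"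
proof -
  have [measurable]: "\<gamma> \<in> borel_measurable borel" "G \<in> borel_measurable borel"
    using c\<gamma> cG by (auto intro: borel_measurable_continuous_onI)
  obtain k where k: "q = Suc k" using q by (cases q) auto
  define \<Phi> where "\<Phi> t \<tau> = (if 0 \<le> t \<and> 0 \<le> \<tau> \<and> t\<^sup>2 + \<tau>\<^sup>2 \<le> 1 then \<gamma> t * (1 - t\<^sup>2) * (G \<tau> * (1 - t\<^sup>2 - \<tau>\<^sup>2) ^ k) else 0)" for t \<tau> :: real
  have iff: "0 \<le> t \<and> 0 \<le> \<tau> \<and> t\<^sup>2 + \<tau>\<^sup>2 \<le> 1 \<longleftrightarrow> t \<in> {0..1} \<and> \<tau> \<in> {0..sqrt (1 - t\<^sup>2)}" for t \<tau> :: real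
  proof (cases "0 \<le> t \<and> 0 \<le> \<tau>")
    case True
    have "\<tau> \<le> sqrt (1 - t\<^sup>2) \<longleftrightarrow> \<tau>\<^sup>2 \<le> 1 - t\<^sup>2" 
      using True by (metis abs_of_nonneg real_sqrt_abs real_sqrt_le_iff)
    moreover have "t \<le> 1" if "t\<^sup>2 + \<tau>\<^sup>2 \<le> 1"
    proof -
      have "t\<^sup>2 \<le> 1\<^sup>2" unfolding one_power2 using that zero_le_power2[of \<tau>] by linarith
      then show ?thesis by (rule power2_le_imp_le) simp
    qed
    ultimately show ?thesis using True by auto
  qed auto
  obtain B1 where B1: "\<And>t. t \<in> {0..1} \<Longrightarrow> \<bar>\<gamma> t\<bar> \<le> B1"
    using bounded_on_unit_interval[OF c\<gamma>] by metis
  obtain B2 where B2: "\<And>t. t \<in> {0..1} \<Longrightarrow> \<bar>G t\<bar> \<le> B2"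
    using bounded_on_unit_interval[OF cG] by metis
  have unit: "t \<in> {0..1} \<and> \<tau> \<in> {0..1}" if "0 \<le> t \<and> 0 \<le> \<tau> \<and> t\<^sup>2 + \<tau>\<^sup>2 \<le> 1" for t \<tau> :: real
    using that iff[of t \<tau>] iff[of \<tau> t] by (auto simp: add.commute)
  have int: "integrable (lborel \<Otimes>\<^sub>M lborel) (case_prod \<Phi>)"
  proof (rule integrableI_bounded_set)
    show "cbox (0, 0) (1, 1) \<in> sets (lborel \<Otimes>\<^sub>M (lborel :: real measure))"
      unfolding lborel_prod by simp
    show "case_prod \<Phi> \<in> borel_measurable (lborel \<Otimes>\<^sub>M lborel)" unfolding \<Phi>_def by measurable
    show "emeasure (lborel \<Otimes>\<^sub>M lborel) (cbox (0, 0) (1, 1::real)) < \<infinity>"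
      unfolding lborel_prod using emeasure_lborel_cbox_finite by auto
    show "AE x in lborel \<Otimes>\<^sub>M lborel. x \<in> cbox (0, 0) (1, 1) \<longrightarrow> norm (case_prod \<Phi> x) \<le> B1 * B2"
    proof (intro AE_I2 impI, clarify)
      fix t \<tau> :: real
      show "norm (\<Phi> t \<tau>) \<le> B1 * B2"
      proof (cases "0 \<le> t \<and> 0 \<le> \<tau> \<and> t\<^sup>2 + \<tau>\<^sup>2 \<le> 1")
        case True
        note u = unit[OF True]
        have "\<bar>\<gamma> t * (1 - t\<^sup>2)\<bar> \<le> B1 * 1"
          unfolding abs_mult using u B1[of t] True by (intro mult_mono) (auto simp: abs_le_iff abs_square_le_1)
        moreover have "\<bar>G \<tau> * (1 - t\<^sup>2 - \<tau>\<^sup>2) ^ k\<bar> \<le> B2 * 1"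
          unfolding abs_mult power_abs using u B2[of \<tau>] True
          by (intro mult_mono power_le_one) (auto simp: abs_le_iff)
        ultimately have "\<bar>\<gamma> t * (1 - t\<^sup>2) * (G \<tau> * (1 - t\<^sup>2 - \<tau>\<^sup>2) ^ k)\<bar> \<le> B1 * B2"
          unfolding abs_mult[of "\<gamma> t * (1 - t\<^sup>2)"] using B1[of t] u by (intro mult_mono) auto
        then show ?thesis using True by (simp add: \<Phi>_def)
      next
        case False
        have "0 \<le> B1 * B2" using B1[of 0] B2[of 0] by (intro mult_nonneg_nonneg) auto
        then show ?thesis unfolding \<Phi>_def if_not_P[OF False] by simp
      qed
    qed
    show "AE x in lborel \<Otimes>\<^sub>M lborel. x \<notin> cbox (0, 0) (1, 1) \<longrightarrow> case_prod \<Phi> x = 0"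
    proof -
      have "case_prod \<Phi> x = 0" if "x \<notin> cbox (0, 0) (1, 1)" for x
      proof (cases x)
        case (Pair t \<tau>)
        then have "\<not> (0 \<le> t \<and> 0 \<le> \<tau> \<and> t\<^sup>2 + \<tau>\<^sup>2 \<le> 1)" using unit[of t \<tau>] that by (auto simp: cbox_Pair_eq)
        then have "\<Phi> t \<tau> = 0" unfolding \<Phi>_def by (rule if_not_P)
        then show ?thesis by (simp add: Pair)
      qed
      then show ?thesis by simp
    qed
  qed
  have "(\<integral>t. indicator {0..1} t * (sqrt (1 - t\<^sup>2) ^ (2 * q + 1) * (\<kappa> t * \<gamma> t)) \<partial>lborel) =
     (\<integral>t. C * (\<integral>\<tau>. \<Phi> t \<tau> \<partial>lborel) \<partial>lborel)"
  proof (rule Bochner_Integration.integral_cong[OF refl])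
    fix t :: real
    show "indicator {0..1} t * (sqrt (1 - t\<^sup>2) ^ (2 * q + 1) * (\<kappa> t * \<gamma> t)) = C * (\<integral>\<tau>. \<Phi> t \<tau> \<partial>lborel)"
    proof (cases "t \<in> {0..1}")
      case True
      define w where "w = sqrt (1 - t\<^sup>2)"
      have w: "0 \<le> w" "w\<^sup>2 = 1 - t\<^sup>2" using True by (auto simp: w_def abs_square_le_1)
      \<comment> \<open>Rescaling the section integral uses up \<open>2 * q - 1\<close> of these
        powers of \<open>w\<close>; the remaining \<open>w\<^sup>2\<close> is the factor
        \<open>1 - t\<^sup>2\<close>.\<close>
      have "w ^ (2 * q + 1) * (\<integral>v. indicator {0..1} v * ((1 - v\<^sup>2) ^ k * G (w * v)) \<partial>lborel) =
        w\<^sup>2 * (w ^ (2 * k + 1) * (\<integral>v. indicator {0..1} v * ((1 - v\<^sup>2) ^ k * G (w * v)) \<partial>lborel))"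
        by (simp add: k power2_eq_square)
      also have "\<dots> = (1 - t\<^sup>2) * (\<integral>\<tau>. indicator {0..w} \<tau> * (G \<tau> * (1 - t\<^sup>2 - \<tau>\<^sup>2) ^ k) \<partial>lborel)"
        unfolding integral_scale_unit_interval[OF w(1)] w(2) ..
      finally have "w ^ (2 * q + 1) * (\<kappa> t * \<gamma> t) = C * ((\<gamma> t * (1 - t\<^sup>2)) * (\<integral>\<tau>. indicator {0..w} \<tau> * (G \<tau> * (1 - t\<^sup>2 - \<tau>\<^sup>2) ^ k) \<partial>lborel))"
        using \<kappa>[OF True] by (simp add: k w_def[symmetric] mult_ac)
      also have "\<dots> = C * (\<integral>\<tau>. (\<gamma> t * (1 - t\<^sup>2)) * (indicator {0..w} \<tau> * (G \<tau> * (1 - t\<^sup>2 - \<tau>\<^sup>2) ^ k)) \<partial>lborel)"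
        by simp
      also have "(\<lambda>\<tau>. (\<gamma> t * (1 - t\<^sup>2)) * (indicator {0..w} \<tau> * (G \<tau> * (1 - t\<^sup>2 - \<tau>\<^sup>2) ^ k))) = \<Phi> t"
        unfolding \<Phi>_def iff using True by (auto simp: fun_eq_iff w_def indicator_def)
      finally show ?thesis using True by (simp add: w_def)
    next
      case False
      then have "\<Phi> t = (\<lambda>_. 0)" unfolding \<Phi>_def iff by auto
      then show ?thesis using False by simp
    qed
  qed
  also have "\<dots> = C * (\<integral>t. (\<integral>\<tau>. \<Phi> t \<tau> \<partial>lborel) \<partial>lborel)" by simp
  also have "(\<integral>t. (\<integral>\<tau>. \<Phi> t \<tau> \<partial>lborel) \<partial>lborel) = (\<integral>\<tau>. (\<integral>t. \<Phi> t \<tau> \<partial>lborel) \<partial>lborel)"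
    using lborel_pair.Fubini_integral[OF int] by simp
  also have "\<dots> = (\<integral>\<tau>. indicator {0..1} \<tau> * (G \<tau> * (\<integral>t. indicator {0..sqrt (1 - \<tau>\<^sup>2)} t * (\<gamma> t * (1 - t\<^sup>2) * ((1 - \<tau>\<^sup>2) - t\<^sup>2) ^ (q - 1)) \<partial>lborel)) \<partial>lborel)"
  proof (rule Bochner_Integration.integral_cong[OF refl])
    fix \<tau> :: real
    have sw: "0 \<le> t \<and> 0 \<le> \<tau> \<and> t\<^sup>2 + \<tau>\<^sup>2 \<le> 1 \<longleftrightarrow> \<tau> \<in> {0..1} \<and> t \<in> {0..sqrt (1 - \<tau>\<^sup>2)}" for t
      using iff[of \<tau> t] by (auto simp: add.commute)
    show "(\<integral>t. \<Phi> t \<tau> \<partial>lborel) = indicator {0..1} \<tau> * (G \<tau> * (\<integral>t. indicator {0..sqrt (1 - \<tau>\<^sup>2)} t * (\<gamma> t * (1 - t\<^sup>2) * ((1 - \<tau>\<^sup>2) - t\<^sup>2) ^ (q - 1)) \<partial>lborel))"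
    proof (cases "\<tau> \<in> {0..1}")
      case True
      have "G \<tau> * (\<integral>t. indicator {0..sqrt (1 - \<tau>\<^sup>2)} t * (\<gamma> t * (1 - t\<^sup>2) * ((1 - \<tau>\<^sup>2) - t\<^sup>2) ^ (q - 1)) \<partial>lborel) =
        (\<integral>t. G \<tau> * (indicator {0..sqrt (1 - \<tau>\<^sup>2)} t * (\<gamma> t * (1 - t\<^sup>2) * ((1 - \<tau>\<^sup>2) - t\<^sup>2) ^ (q - 1))) \<partial>lborel)"
        by simp
      also have "(\<lambda>t. G \<tau> * (indicator {0..sqrt (1 - \<tau>\<^sup>2)} t * (\<gamma> t * (1 - t\<^sup>2) * ((1 - \<tau>\<^sup>2) - t\<^sup>2) ^ (q - 1)))) = (\<lambda>t. \<Phi> t \<tau>)"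
        unfolding \<Phi>_def sw using True by (auto simp: fun_eq_iff indicator_def k algebra_simps)
      finally show ?thesis using True by simp
    next
      case False
      then have "(\<lambda>t. \<Phi> t \<tau>) = (\<lambda>_. 0)" unfolding \<Phi>_def sw by auto
      then show ?thesis using False by simp
    qed
  qed
  finally show ?thesis .
qed

text \<open>The pairing is \<open>C / (2 * q)\<close> times a weighted average of
  \<open>\<tau> ^ (2 * q + 1) * G \<tau>\<close> over \<open>[\<alpha>, \<beta>]\<close>; the two
  final bounds express this without exposing the density.\<close>

lemma interval_test_function:
  fixes G \<kappa> :: "real \<Rightarrow> real"
  assumes \<alpha>\<beta>: "0 < \<alpha>" "\<alpha> < \<beta>" "\<beta> < 1" and q: "q \<ge> 1" and cG: "continuous_on UNIV G" and C: "C > 0"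
    and \<kappa>: "\<And>t. t \<in> {0..1} \<Longrightarrow> \<kappa> t = C * (\<integral>v. indicator {0..1} v * ((1 - v\<^sup>2) ^ (q - 1) * G (sqrt (1 - t\<^sup>2) * v)) \<partial>lborel)"
  obtains \<gamma> S :: "real \<Rightarrow> real" where "continuous_on UNIV \<gamma>" "\<gamma> 0 = 0"
    "\<And>y. 0 \<le> y \<Longrightarrow> (\<integral>t. indicator {0..sqrt y} t * (\<gamma> t * (y - t\<^sup>2) ^ q) \<partial>lborel) = (1 - y) ^ q * S y"
    "\<And>y. y \<le> 1 - \<beta>\<^sup>2 \<Longrightarrow> S y = 0" "\<And>y. 1 - \<alpha>\<^sup>2 \<le> y \<Longrightarrow> S y = 1" "\<And>y. 0 \<le> S y \<and> S y \<le> 1"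
    "\<And>u. (\<And>\<tau>. \<tau> \<in> {\<alpha>..\<beta>} \<Longrightarrow> u \<le> \<tau> ^ (2 * q + 1) * G \<tau>) \<Longrightarrow>
       C / (2 * q) * u \<le> (\<integral>t. indicator {0..1} t * (sqrt (1 - t\<^sup>2) ^ (2 * q + 1) * (\<kappa> t * \<gamma> t)) \<partial>lborel)"
    "\<And>u. (\<And>\<tau>. \<tau> \<in> {\<alpha>..\<beta>} \<Longrightarrow> \<tau> ^ (2 * q + 1) * G \<tau> \<le> u) \<Longrightarrow>
       (\<integral>t. indicator {0..1} t * (sqrt (1 - t\<^sup>2) ^ (2 * q + 1) * (\<kappa> t * \<gamma> t)) \<partial>lborel) \<le> C / (2 * q) * u"
proof -
  \<comment> \<open>The interval \<open>[\<alpha>, \<beta>]\<close> of cosines in the variable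
    \<open>y = 1 - \<tau>\<^sup>2\<close>, which reverses its ends.\<close>
  define a b where "a = 1 - \<beta>\<^sup>2" and "b = 1 - \<alpha>\<^sup>2"
  have ab: "0 < a" "a < b" "b < 1"
    using \<alpha>\<beta> by (auto simp: a_def b_def abs_square_less_1 power_strict_mono)
  obtain \<gamma> S \<sigma> :: "real \<Rightarrow> real" where
    c: "continuous_on UNIV \<gamma>" and \<gamma>0: "\<gamma> 0 = 0" and
    1: "\<And>y. 0 \<le> y \<Longrightarrow> (\<integral>t. indicator {0..sqrt y} t * (\<gamma> t * (y - t\<^sup>2) ^ q) \<partial>lborel) = (1 - y) ^ q * S y" and
    2: "\<And>y. 0 \<le> y \<Longrightarrow> (\<integral>t. indicator {0..sqrt y} t * (\<gamma> t * (1 - t\<^sup>2) * (y - t\<^sup>2) ^ (q - 1)) \<partial>lborel) = (1 - y) ^ (q + 1) * \<sigma> y / q" and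
    S: "\<And>y. y \<le> a \<Longrightarrow> S y = 0" "\<And>y. b \<le> y \<Longrightarrow> S y = 1" "\<And>y. 0 \<le> S y \<and> S y \<le> 1" and
    \<sigma>: "continuous_on UNIV \<sigma>" "\<And>y. 0 \<le> \<sigma> y" "\<And>y. y \<notin> {a..b} \<Longrightarrow> \<sigma> y = 0" and
    \<sigma>1: "(\<integral>\<tau>. indicator {0..1} \<tau> * (2 * \<tau> * \<sigma> (1 - \<tau>\<^sup>2)) \<partial>lborel) = 1"
    using smoothstep_kernel[OF ab q] by blast
  define U where "U \<tau> = \<tau> ^ (2 * q + 1) * G \<tau>" for \<tau>
  \<comment> \<open>A probability density carried by \<open>{\<alpha>..\<beta>}\<close>: the
    derivative of the step, transported to the variable \<open>\<tau>\<close>.\<close>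
  define W where "W \<tau> = indicator {0..1} \<tau> * (2 * \<tau> * \<sigma> (1 - \<tau>\<^sup>2))" for \<tau> :: real
  have W0: "0 \<le> W \<tau>" for \<tau> using \<sigma>(2) by (simp add: W_def indicator_def)
  have Wz: "W \<tau> = 0" if "\<tau> \<notin> {\<alpha>..\<beta>}" for \<tau>
  proof (cases "\<tau> \<in> {0..1}")
    case True
    have "1 - \<tau>\<^sup>2 \<notin> {a..b}"
    proof
      assume "1 - \<tau>\<^sup>2 \<in> {a..b}"
      then have "\<alpha>\<^sup>2 \<le> \<tau>\<^sup>2" "\<tau>\<^sup>2 \<le> \<beta>\<^sup>2" by (auto simp: a_def b_def)
      then have "\<alpha> \<le> \<tau>" "\<tau> \<le> \<beta>" using True \<alpha>\<beta> by (auto intro: power2_le_imp_le)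
      then show False using that by simp
    qed
    then show ?thesis by (simp add: W_def \<sigma>(3))
  qed (simp add: W_def)
  have cU: "continuous_on UNIV U" unfolding U_def by (intro continuous_intros cG)
  have c1: "continuous_on {0..1} (\<lambda>\<tau>. 2 * \<tau> * \<sigma> (1 - \<tau>\<^sup>2))"
    by (intro continuous_intros continuous_on_compose2[OF \<sigma>(1)]) auto
  have c2: "continuous_on {0..1} (\<lambda>\<tau>. 2 * \<tau> * \<sigma> (1 - \<tau>\<^sup>2) * U \<tau>)"
    by (intro continuous_intros continuous_on_compose2[OF \<sigma>(1)] continuous_on_subset[OF cU]) auto
  have iW: "integrable lborel W" unfolding W_def by (rule integrable_indicator_continuous[OF c1])
  have iWU: "integrable lborel (\<lambda>\<tau>. W \<tau> * U \<tau>)"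
    unfolding W_def mult.assoc using integrable_indicator_continuous[OF c2] by (simp add: mult.assoc)
  have W1: "(\<integral>\<tau>. W \<tau> \<partial>lborel) = 1" using \<sigma>1 by (simp add: W_def)
  have \<Phi>: "(\<integral>t. indicator {0..1} t * (sqrt (1 - t\<^sup>2) ^ (2 * q + 1) * (\<kappa> t * \<gamma> t)) \<partial>lborel) =
    C / (2 * q) * (\<integral>\<tau>. W \<tau> * U \<tau> \<partial>lborel)"
  proof -
    have "(\<integral>t. indicator {0..1} t * (sqrt (1 - t\<^sup>2) ^ (2 * q + 1) * (\<kappa> t * \<gamma> t)) \<partial>lborel) =
      C * (\<integral>\<tau>. indicator {0..1} \<tau> * (G \<tau> * (\<integral>t. indicator {0..sqrt (1 - \<tau>\<^sup>2)} t * (\<gamma> t * (1 - t\<^sup>2) * ((1 - \<tau>\<^sup>2) - t\<^sup>2) ^ (q - 1)) \<partial>lborel)) \<partial>lborel)"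
      by (rule quarter_disk_swap[OF c cG q \<kappa>])
    also have "\<dots> = C * (\<integral>\<tau>. W \<tau> * U \<tau> / (2 * q) \<partial>lborel)"
    proof (rule arg_cong[where f="\<lambda>x. C * x"], rule Bochner_Integration.integral_cong[OF refl])
      fix \<tau> :: real
      show "indicator {0..1} \<tau> * (G \<tau> * (\<integral>t. indicator {0..sqrt (1 - \<tau>\<^sup>2)} t * (\<gamma> t * (1 - t\<^sup>2) * ((1 - \<tau>\<^sup>2) - t\<^sup>2) ^ (q - 1)) \<partial>lborel)) =
        W \<tau> * U \<tau> / (2 * q)"
      proof (cases "\<tau> \<in> {0..1}")
        case True
        then have "0 \<le> 1 - \<tau>\<^sup>2" by (simp add: abs_square_le_1)
        from 2[OF this] have J: "(\<integral>t. indicator {0..sqrt (1 - \<tau>\<^sup>2)} t * (\<gamma> t * (1 - t\<^sup>2) * ((1 - \<tau>\<^sup>2) - t\<^sup>2) ^ (q - 1)) \<partial>lborel) =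
          \<tau> ^ (2 * q + 2) * \<sigma> (1 - \<tau>\<^sup>2) / q"
          by (simp add: power_mult power_add power2_eq_square power_mult_distrib)
        have t: "\<tau> ^ (2 * q + 2) = \<tau> * \<tau> ^ (2 * q + 1)" by simp
        show ?thesis unfolding J t W_def U_def using True q by (simp add: field_simps)
      qed (simp add: W_def)
    qed
    finally show ?thesis by simp
  qed
  have Cq: "C / (2 * q) > 0" using C q by simp
  show ?thesis
  proof (rule that[OF c \<gamma>0 1 S[unfolded a_def b_def]])
    fix u
    show "C / (2 * q) * u \<le> (\<integral>t. indicator {0..1} t * (sqrt (1 - t\<^sup>2) ^ (2 * q + 1) * (\<kappa> t * \<gamma> t)) \<partial>lborel)"
      if u: "\<And>\<tau>. \<tau> \<in> {\<alpha>..\<beta>} \<Longrightarrow> u \<le> \<tau> ^ (2 * q + 1) * G \<tau>"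
    proof -
      have "(\<integral>\<tau>. W \<tau> * u \<partial>lborel) \<le> (\<integral>\<tau>. W \<tau> * U \<tau> \<partial>lborel)"
      proof (rule integral_mono)
        show "W \<tau> * u \<le> W \<tau> * U \<tau>" for \<tau>
          using u[of \<tau>] W0[of \<tau>] Wz[of \<tau>] by (cases "\<tau> \<in> {\<alpha>..\<beta>}") (auto simp: U_def intro: mult_left_mono)
      qed (use iW iWU in auto)
      then have "u \<le> (\<integral>\<tau>. W \<tau> * U \<tau> \<partial>lborel)" by (simp add: W1)
      then show ?thesis unfolding \<Phi> using Cq by (intro mult_left_mono) auto
    qed
    show "(\<integral>t. indicator {0..1} t * (sqrt (1 - t\<^sup>2) ^ (2 * q + 1) * (\<kappa> t * \<gamma> t)) \<partial>lborel) \<le> C / (2 * q) * u"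
      if u: "\<And>\<tau>. \<tau> \<in> {\<alpha>..\<beta>} \<Longrightarrow> \<tau> ^ (2 * q + 1) * G \<tau> \<le> u"
    proof -
      have "(\<integral>\<tau>. W \<tau> * U \<tau> \<partial>lborel) \<le> (\<integral>\<tau>. W \<tau> * u \<partial>lborel)"
      proof (rule integral_mono)
        show "W \<tau> * U \<tau> \<le> W \<tau> * u" for \<tau>
          using u[of \<tau>] W0[of \<tau>] Wz[of \<tau>] by (cases "\<tau> \<in> {\<alpha>..\<beta>}") (auto simp: U_def intro: mult_left_mono)
      qed (use iW iWU in auto)
      then have "(\<integral>\<tau>. W \<tau> * U \<tau> \<partial>lborel) \<le> u" by (simp add: W1)
      then show ?thesis unfolding \<Phi> using Cq by (intro mult_left_mono) auto
    qed
  qed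
qed

text \<open>One step rises at cosines just below \<open>s\<close>, the other just below
  \<open>t\<close>. In \<open>y\<close> the latter is complete before the former starts, so the
  difference of the test functions has a nonnegative transform, while its pairing is close to a
  positive multiple of \<open>U t - U s < 0\<close>.\<close>

lemma not_intersection_body_lift:
  fixes k' :: "'m::finite" and \<kappa> f :: "real \<Rightarrow> real"
  assumes N: "CARD('m) = 2 * q + 4" and q: "q \<ge> 1"
    and rad: "\<And>\<xi> :: real^'m. norm \<xi> = 1 \<Longrightarrow> radial_fun K \<xi> = \<kappa> \<bar>\<xi> $ k'\<bar>"
    and c\<kappa>: "continuous_on UNIV \<kappa>" and cf: "continuous_on UNIV f" and f0: "\<And>v. 0 \<le> f v"
    and C: "C > 0" and eq: "\<And>t. t \<in> {0..1} \<Longrightarrow> \<kappa> t =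
      C * (\<integral>v. indicator {0..1} v * ((1 - v\<^sup>2) ^ (q - 1) * f (sqrt (1 - t\<^sup>2) * v) ^ (2 * q + 1)) \<partial>lborel)"
    and st: "0 < s" "s < t" "t \<le> 1" "t * f t < s * f s"
  shows "\<not> intersection_body (K :: (real^'m) set)"
proof
  assume "intersection_body K"
  then obtain \<mu> where \<mu>: "sets \<mu> = sets (restrict_space borel (sphere 0 1))" and
    test: "\<And>g :: real^'m \<Rightarrow> real. continuous_on (sphere 0 1) g \<Longrightarrow>
             (\<integral>\<xi>. radial_fun K \<xi> * g \<xi> \<partial>sphere_measure DIM(real^'m) lborel) = (\<integral>\<xi>. spherical_radon g \<xi> \<partial>\<mu>)"
    unfolding intersection_body_def by blast
  define G where "G v = f v ^ (2 * q + 1)" for v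
  define U where "U v = v ^ (2 * q + 1) * G v" for v
  have cG: "continuous_on UNIV G" unfolding G_def by (intro continuous_intros cf)
  have cU: "continuous_on UNIV U" unfolding U_def by (intro continuous_intros cG)
  have "(t * f t) ^ (2 * q + 1) < (s * f s) ^ (2 * q + 1)"
    using st f0[of t] by (intro power_strict_mono) auto
  then have Ust: "U t < U s" by (simp only: U_def G_def power_mult_distrib)
  \<comment> \<open>A third of the gap: after an error \<open>e\<close> at both ends the difference
    of the averages is still at most \<open>- e\<close>.\<close>
  define e where "e = (U s - U t) / 3"
  have e: "e > 0" using Ust by (simp add: e_def)
  have "isCont U s" "isCont U t" using cU by (auto simp: continuous_on_eq_continuous_at)
  then obtain d1 d2 where d: "d1 > 0" "d2 > 0"
    "\<And>x. \<bar>x - s\<bar> < d1 \<Longrightarrow> \<bar>U x - U s\<bar> < e" "\<And>x. \<bar>x - t\<bar> < d2 \<Longrightarrow> \<bar>U x - U t\<bar> < e"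
    using e unfolding continuous_at_eps_delta dist_real_def by metis
  \<comment> \<open>Besides the radii of continuity, the bound \<open>s\<close> keeps the first
    interval positive, and \<open>(t - s) / 2\<close> keeps the second one to the right of
    \<open>s\<close>.\<close>
  define \<delta> where "\<delta> = min (min d1 d2) (min s ((t - s) / 2))"
  have \<delta>: "\<delta> > 0" "\<delta> \<le> d1" "\<delta> \<le> d2" "\<delta> \<le> s" "2 * \<delta> \<le> t - s"
    using d st by (auto simp: \<delta>_def min_def)
  \<comment> \<open>The intervals are \<open>[\<alpha>1, s]\<close> and
    \<open>[\<alpha>2, \<beta>2]\<close>. The second stops short of \<open>t\<close>, so it stays
    inside the open unit interval even when \<open>t = 1\<close>.\<close>
  define \<alpha>1 \<alpha>2 \<beta>2 where "\<alpha>1 = s - \<delta> / 2" and "\<alpha>2 = t - 2 * \<delta> / 3" and "\<beta>2 = t - \<delta> / 3"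
  have I1: "0 < \<alpha>1" "\<alpha>1 < s" "s < 1" using \<delta> st by (auto simp: \<alpha>1_def)
  have I2: "0 < \<alpha>2" "\<alpha>2 < \<beta>2" "\<beta>2 < 1" and s\<alpha>2: "s \<le> \<alpha>2" using \<delta> st by (auto simp: \<alpha>2_def \<beta>2_def)
  have U1: "U s - e \<le> U \<tau>" if "\<tau> \<in> {\<alpha>1..s}" for \<tau>
  proof -
    have "\<bar>\<tau> - s\<bar> < d1" using that \<delta> by (simp add: \<alpha>1_def)
    from d(3)[OF this] show ?thesis by linarith
  qed
  have U2: "U \<tau> \<le> U t + e" if "\<tau> \<in> {\<alpha>2..\<beta>2}" for \<tau>
  proof -
    have "\<bar>\<tau> - t\<bar> < d2" using that \<delta> by (simp add: \<alpha>2_def \<beta>2_def)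
    from d(4)[OF this] show ?thesis by linarith
  qed
  have eqG: "\<kappa> t = C * (\<integral>v. indicator {0..1} v * ((1 - v\<^sup>2) ^ (q - 1) * G (sqrt (1 - t\<^sup>2) * v)) \<partial>lborel)"
    if "t \<in> {0..1}" for t using eq[OF that] by (simp add: G_def)
  define \<Phi> where "\<Phi> \<gamma> = (\<integral>t. indicator {0..1} t * (sqrt (1 - t\<^sup>2) ^ (2 * q + 1) * (\<kappa> t * \<gamma> t)) \<partial>lborel)" for \<gamma>
  obtain \<gamma>1 S1 where c1: "continuous_on UNIV \<gamma>1" "\<gamma>1 0 = 0"
    and E1: "\<And>y. 0 \<le> y \<Longrightarrow> (\<integral>t. indicator {0..sqrt y} t * (\<gamma>1 t * (y - t\<^sup>2) ^ q) \<partial>lborel) = (1 - y) ^ q * S1 y"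
    and S1: "\<And>y. y \<le> 1 - s\<^sup>2 \<Longrightarrow> S1 y = 0" "\<And>y. 0 \<le> S1 y \<and> S1 y \<le> 1"
    and L1: "\<And>u. (\<And>\<tau>. \<tau> \<in> {\<alpha>1..s} \<Longrightarrow> u \<le> U \<tau>) \<Longrightarrow> C / (2 * q) * u \<le> \<Phi> \<gamma>1"
  proof (rule interval_test_function[OF I1 q cG C eqG], assumption, goal_cases)
    case (1 \<gamma> S)
    show ?case by (rule 1(1)[OF 1(2-5) 1(7) 1(8)[folded U_def \<Phi>_def]])
  qed
  obtain \<gamma>2 S2 where c2: "continuous_on UNIV \<gamma>2" "\<gamma>2 0 = 0"
    and E2: "\<And>y. 0 \<le> y \<Longrightarrow> (\<integral>t. indicator {0..sqrt y} t * (\<gamma>2 t * (y - t\<^sup>2) ^ q) \<partial>lborel) = (1 - y) ^ q * S2 y"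
    and S2: "\<And>y. 1 - \<alpha>2\<^sup>2 \<le> y \<Longrightarrow> S2 y = 1" "\<And>y. 0 \<le> S2 y \<and> S2 y \<le> 1"
    and L2: "\<And>u. (\<And>\<tau>. \<tau> \<in> {\<alpha>2..\<beta>2} \<Longrightarrow> U \<tau> \<le> u) \<Longrightarrow> \<Phi> \<gamma>2 \<le> C / (2 * q) * u"
  proof (rule interval_test_function[OF I2 q cG C eqG], assumption, goal_cases)
    case (1 \<gamma> S)
    show ?case by (rule 1(1)[OF 1(2-4) 1(6-7) 1(9)[folded U_def \<Phi>_def]])
  qed
  \<comment> \<open>Up to \<open>1 - s\<^sup>2\<close> the step \<open>S1\<close> is 0; beyond it
    \<open>S2\<close> is already 1, because \<open>s \<le> \<alpha>2\<close>.\<close>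
  have S12: "S1 y \<le> S2 y" for y
  proof (cases "y \<le> 1 - s\<^sup>2")
    case True then show ?thesis using S1(1)[of y] S2(2)[of y] by simp
  next
    case False
    have "s\<^sup>2 \<le> \<alpha>2\<^sup>2" using s\<alpha>2 st by (intro power_mono) auto
    then show ?thesis using False S1(2)[of y] S2(1)[of y] by simp
  qed
  define \<gamma> where "\<gamma> t = \<gamma>2 t - \<gamma>1 t" for t
  have c\<gamma>: "continuous_on UNIV \<gamma>" unfolding \<gamma>_def by (intro continuous_intros c1 c2)
  have [measurable]: "\<gamma> \<in> borel_measurable borel" "\<kappa> \<in> borel_measurable borel"
    using c\<gamma> c\<kappa> by (auto intro: borel_measurable_continuous_onI)
  have N4: "CARD('m) \<ge> 4" and N3: "CARD('m) \<ge> 3" and NN: "CARD('m) - 4 = 2 * q" "CARD('m) - 3 = 2 * q + 1"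
    using N by simp_all
  obtain C3 where C3: "C3 > 0" and sph: "\<And>h. h \<in> borel_measurable borel \<Longrightarrow>
    (\<integral>\<theta>. h \<bar>\<theta> $ k'\<bar> \<partial>sphere_measure CARD('m) (lborel :: (real^'m) measure)) =
     C3 * (\<integral>v. indicator {0..1} v * (sqrt (1 - v\<^sup>2) ^ (2 * q + 1) * h v) \<partial>lborel :: real)"
    using integral_sphere_axis[of k', OF N3] unfolding NN by blast
  obtain C4 where C4: "C4 > 0" and rdn: "\<And>h (\<xi>::real^'m). h \<in> borel_measurable borel \<Longrightarrow> norm \<xi> = 1 \<Longrightarrow>
    spherical_radon (\<lambda>\<theta>. h \<bar>\<theta> $ k'\<bar>) \<xi> =
     C4 * (\<integral>v. indicator {0..1} v * (sqrt (1 - v\<^sup>2) ^ (2 * q) * h (sqrt (1 - (\<xi> $ k')\<^sup>2) * v)) \<partial>lborel :: real)"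
    using spherical_radon_axis[of k', OF N4] unfolding NN by blast
  have radon_nonneg: "0 \<le> spherical_radon (\<lambda>\<theta>. \<gamma> \<bar>\<theta> $ k'\<bar>) \<xi>" if \<xi>: "norm \<xi> = 1" for \<xi> :: "real^'m"
  proof -
    define w where "w = sqrt (1 - (\<xi> $ k')\<^sup>2)"
    have "\<bar>\<xi> $ k'\<bar> \<le> 1" using component_le_norm_cart[of \<xi> k'] \<xi> by simp
    then have "(\<xi> $ k')\<^sup>2 \<le> 1" by (simp add: abs_square_le_1)
    then have w: "0 \<le> w" "w\<^sup>2 \<le> 1" "sqrt (w\<^sup>2) = w" by (simp_all add: w_def)
    define I where "I = (\<integral>v. indicator {0..1} v * ((1 - v\<^sup>2) ^ q * \<gamma> (w * v)) \<partial>lborel)"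
    have "0 \<le> I"
    \<comment> \<open>At the poles the factor \<open>w ^ (2 * q + 1)\<close> of the Abel form hides
      the transform. There it is a multiple of the value at the equator,
      \<open>\<gamma> 0 = 0\<close>.\<close>
    proof (cases "w = 0")
      case True
      then show ?thesis by (simp add: I_def \<gamma>_def c1(2) c2(2))
    next
      case False
      have i: "integrable lborel (\<lambda>t. indicator {0..w} t * (h t * (w\<^sup>2 - t\<^sup>2) ^ q))" if "continuous_on UNIV h" for h
        by (intro integrable_indicator_continuous continuous_intros continuous_on_subset[OF that]) auto
      have "w ^ (2 * q + 1) * I = (\<integral>t. indicator {0..w} t * (\<gamma> t * (w\<^sup>2 - t\<^sup>2) ^ q) \<partial>lborel)"
        unfolding I_def by (rule integral_scale_unit_interval[OF w(1)])
      also have "\<dots> = (\<integral>t. indicator {0..w} t * (\<gamma>2 t * (w\<^sup>2 - t\<^sup>2) ^ q) - indicator {0..w} t * (\<gamma>1 t * (w\<^sup>2 - t\<^sup>2) ^ q) \<partial>lborel)"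
        by (simp add: \<gamma>_def algebra_simps)
      also have "\<dots> = (1 - w\<^sup>2) ^ q * S2 (w\<^sup>2) - (1 - w\<^sup>2) ^ q * S1 (w\<^sup>2)"
        using E1[of "w\<^sup>2"] E2[of "w\<^sup>2"] i[OF c1(1)] i[OF c2(1)] unfolding w(3) by simp
      also have "\<dots> \<ge> 0" using S12[of "w\<^sup>2"] w by (simp add: mult_left_mono)
      finally have "0 \<le> w ^ (2 * q + 1) * I" .
      moreover have "0 < w ^ (2 * q + 1)" using False w by simp
      ultimately show ?thesis by (simp add: zero_le_mult_iff)
    qed
    moreover have "spherical_radon (\<lambda>\<theta>. \<gamma> \<bar>\<theta> $ k'\<bar>) \<xi> = C4 * I"
    proof -
      have "(\<integral>v. indicator {0..1} v * (sqrt (1 - v\<^sup>2) ^ (2 * q) * \<gamma> (w * v)) \<partial>lborel) = I"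
        unfolding I_def by (rule integral_indicator_cong) (simp only: even_section_weight)
      then show ?thesis using rdn[of \<gamma> \<xi>] \<xi> by (simp add: w_def)
    qed
    ultimately show ?thesis using C4 by simp
  qed
  have "space \<mu> = sphere 0 1" using sets_eq_imp_space_eq[OF \<mu>] by (simp add: space_restrict_space)
  then have "0 \<le> (\<integral>\<xi>. spherical_radon (\<lambda>\<theta>. \<gamma> \<bar>\<theta> $ k'\<bar>) \<xi> \<partial>\<mu>)"
    using radon_nonneg by (intro integral_nonneg_AE AE_I2) auto
  also have "\<dots> = (\<integral>\<xi>. radial_fun K \<xi> * \<gamma> \<bar>\<xi> $ k'\<bar> \<partial>sphere_measure DIM(real^'m) lborel)"
    by (rule test[symmetric]) (intro continuous_intros continuous_on_compose2[OF c\<gamma>], auto)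
  also have "\<dots> = (\<integral>\<xi>. \<kappa> \<bar>\<xi> $ k'\<bar> * \<gamma> \<bar>\<xi> $ k'\<bar> \<partial>sphere_measure CARD('m) (lborel :: (real^'m) measure))"
  proof -
    have "space (sphere_measure CARD('m) (lborel :: (real^'m) measure)) = sphere 0 1"
      using sets_eq_imp_space_eq[OF sets_sphere_measure] by (simp add: space_restrict_space)
    then show ?thesis by (intro Bochner_Integration.integral_cong) (auto simp: rad)
  qed
  also have "\<dots> = C3 * \<Phi> \<gamma>" unfolding \<Phi>_def by (rule sph) measurable
  finally have "0 \<le> \<Phi> \<gamma>" using C3 by (simp add: zero_le_mult_iff)
  also have "\<Phi> \<gamma> = \<Phi> \<gamma>2 - \<Phi> \<gamma>1"
  proof -
    have i: "integrable lborel (\<lambda>t. indicator {0..1} t * (sqrt (1 - t\<^sup>2) ^ (2 * q + 1) * (\<kappa> t * h t)))"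
      if "continuous_on UNIV h" for h
      by (intro integrable_indicator_continuous continuous_intros continuous_on_subset[OF that] continuous_on_subset[OF c\<kappa>]) auto
    show ?thesis unfolding \<Phi>_def Bochner_Integration.integral_diff[OF i[OF c2(1)] i[OF c1(1)], symmetric]
      by (simp add: \<gamma>_def algebra_simps)
  qed
  also have "\<dots> \<le> C / (2 * q) * (U t + e) - C / (2 * q) * (U s - e)"
    using L1[of "U s - e"] L2[of "U t + e"] U1 U2 by (intro diff_mono) auto
  also have "\<dots> = C / (2 * q) * ((U t + e) - (U s - e))" by (rule right_diff_distrib[symmetric])
  finally have "0 \<le> C / (2 * q) * ((U t + e) - (U s - e))" .
  moreover have "(U t + e) - (U s - e) = - e" by (simp add: e_def field_simps)
  ultimately have "0 \<le> C / (2 * q) * - e" by simp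
  moreover have "C / (2 * q) * - e < 0" using C q e by (intro mult_pos_neg) auto
  ultimately show False by simp
qed

section \<open>Reduction of both implications to functions of the cosine\<close>

theorem theorem10:
  fixes k :: "'n::finite" and k' :: "'m::finite"
    and \<rho>K :: "real \<Rightarrow> real" and L :: "(real^'n) set"
  assumes "CARD('n) \<ge> 4" and "even CARD('n)" and "CARD('m) = CARD('n) + 2"
    and "\<forall>\<phi>\<in>{0..pi/2}. 0 \<le> \<rho>K \<phi>"
    and "intersection_body_of (revolution_body k \<rho>K) L"
    and "body_of_revolution k L"
  shows "(equator_convex k L \<and> C1_radial k L \<longrightarrow>
            (\<exists>M. intersection_body_of (revolution_body k' \<rho>K :: (real^'m) set) M)) \<and>
         (\<not> equator_convex k L \<longrightarrow>
            \<not> intersection_body (revolution_body k' \<rho>K :: (real^'m) set))"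
proof -
  let ?K = "revolution_body k \<rho>K :: (real^'n) set"
  let ?K' = "revolution_body k' \<rho>K :: (real^'m) set"
  have n2: "CARD('n) \<ge> 2" and m2: "CARD('m) \<ge> 2" using assms(1,3) by simp_all
  obtain q where q: "CARD('n) = 2 * q + 2"
  proof -
    obtain r where "CARD('n) = 2 * r" using assms(2) by (elim evenE)
    then show ?thesis using assms(1) by (intro that[of "r - 1"]) auto
  qed
  have q1: "q \<ge> 1" using q assms(1) by simp
  have N: "CARD('m) = 2 * q + 4" using q assms(3) by simp
  have K: "star_body ?K" and L: "star_body L"
    and vol: "\<And>\<xi>. norm \<xi> = 1 \<Longrightarrow> radial_fun ?K \<xi> = measure (hyperplane_measure \<xi>) (L \<inter> {x. x \<bullet> \<xi> = 0})"
    using assms(5) by (auto simp: intersection_body_of_def)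
  have radK: "radial_fun ?K \<xi> = \<rho>K (arccos \<bar>\<xi> $ k\<bar>)" if "norm \<xi> = 1" for \<xi>
    using radial_fun_revolution_body[OF assms(4)] that by simp
  obtain \<kappa> B1 where \<kappa>: "continuous_on UNIV \<kappa>" "\<And>v. 0 \<le> \<kappa> v" "\<And>v. \<kappa> v < B1"
    "\<And>\<xi>. norm \<xi> = 1 \<Longrightarrow> radial_fun ?K \<xi> = \<kappa> \<bar>\<xi> $ k\<bar>"
  proof (rule zonal_radial_fun[OF n2 K, of k])
    show "radial_fun ?K \<xi> = radial_fun ?K \<eta>" if "norm \<xi> = 1" "norm \<eta> = 1" "\<bar>\<xi> $ k\<bar> = \<bar>\<eta> $ k\<bar>" for \<xi> \<eta>
      using that by (simp add: radK)
  qed (rule that)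
  obtain f B where f: "continuous_on UNIV f" "\<And>v. 0 \<le> f v" "\<And>v. f v < B"
    "\<And>\<xi>. norm \<xi> = 1 \<Longrightarrow> radial_fun L \<xi> = f \<bar>\<xi> $ k\<bar>"
    by (rule zonal_radial_fun[OF n2 L body_of_revolution_zonal[OF L assms(6)]], assumption+) (rule that)
  have mem: "y \<in> L \<longleftrightarrow> norm y \<le> f (\<bar>y $ k\<bar> / norm y)" for y
    by (rule star_body_mem_iff[OF L f(4) f(2)])
  obtain j where j: "j \<noteq> k" using ex_other_index[OF n2] .
  have mer: "norm (meridian j k t) = 1" "\<bar>meridian j k t $ k\<bar> = t" "(meridian j k t $ k)\<^sup>2 = t\<^sup>2" if "t \<in> {0..1}" for t
    using norm_meridian[OF j, of t] meridian_nth[OF j, of t] that by auto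
  \<comment> \<open>\<open>\<kappa>\<close> was obtained in dimension \<open>n\<close>; this
    identity with the given function of the angle makes it the radial function in dimension
    \<open>n + 2\<close> as well.\<close>
  have \<rho>\<kappa>: "\<rho>K \<phi> = \<kappa> (cos \<phi>)" if \<phi>: "\<phi> \<in> {0..pi/2}" for \<phi>
  proof -
    have "cos \<phi> \<in> {0..1}" using \<phi> by (auto intro: cos_ge_zero)
    note m = mer[OF this]
    have "\<rho>K (arccos (cos \<phi>)) = \<kappa> (cos \<phi>)" using radK[OF m(1)] \<kappa>(4)[OF m(1)] by (simp add: m(2))
    then show ?thesis using \<phi> by (simp add: arccos_cos)
  qed
  have \<kappa>pos: "\<exists>t\<in>{0..1}. 0 < \<kappa> t" by (rule star_body_radial_pos[OF K \<kappa>(4)])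
  obtain C where C: "C > 0" and eq: "\<And>t. t \<in> {0..1} \<Longrightarrow> \<kappa> t =
      C * (\<integral>v. indicator {0..1} v * (sqrt (1 - v\<^sup>2) ^ (CARD('n) - 4) * f (sqrt (1 - t\<^sup>2) * v) ^ (CARD('n) - 1)) \<partial>lborel)"
  proof (rule section_volume[OF assms(1), of k], goal_cases)
    case (1 C)
    have cl: "closed L" using L by (simp add: star_body_def compact_imp_closed)
    have fm: "f \<in> borel_measurable borel" using f(1) by (rule borel_measurable_continuous_onI)
    show ?case
    proof (rule 1(1)[OF 1(2)])
      fix t :: real assume t: "t \<in> {0..1}"
      have "\<kappa> t = measure (hyperplane_measure (meridian j k t)) (L \<inter> {x. x \<bullet> meridian j k t = 0})"
        using vol[OF mer(1)[OF t]] \<kappa>(4)[OF mer(1)[OF t]] by (simp add: mer(2)[OF t])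
      then show "\<kappa> t = C * (\<integral>v. indicator {0..1} v * (sqrt (1 - v\<^sup>2) ^ (CARD('n) - 4) * f (sqrt (1 - t\<^sup>2) * v) ^ (CARD('n) - 1)) \<partial>lborel)"
        using 1(3)[OF cl fm, of B "meridian j k t"] f(2,3) mem mer[OF t] by simp
    qed
  qed
  note conv_iff = equator_convex_iff[OF n2 mem f(2)]
  show ?thesis
  proof (intro conjI impI)
    assume h: "equator_convex k L \<and> C1_radial k L"
    then obtain g g' where g0: "\<forall>\<xi>\<in>sphere 0 1. radial_fun L \<xi> = g \<bar>\<xi> $ k\<bar>"
      "\<forall>t\<in>{0..1}. (g has_real_derivative g' t) (at t within {0..1})" and g': "continuous_on {0..1} g'"
      unfolding C1_radial_def by blast
    have g: "radial_fun L \<xi> = g \<bar>\<xi> $ k\<bar>" if "norm \<xi> = 1" for \<xi>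
      using g0(1) that by simp
    \<comment> \<open>\<open>C1_radial\<close> supplies its own function \<open>g\<close>, which
      agrees with the clamped \<open>f\<close> on \<open>[0, 1]\<close>; this is enough to transfer
      derivatives within that interval.\<close>
    have gf: "g t = f t" if "t \<in> {0..1}" for t
      using g[OF mer(1)[OF that]] f(4)[OF mer(1)[OF that]] by (simp add: mer(2)[OF that])
    have f': "(f has_real_derivative g' t) (at t within {0..1})" if "t \<in> {0..1}" for t
      by (rule has_field_derivative_transform_within[OF g0(2)[rule_format, OF that], of 1]) (use that gf in auto)
    show "\<exists>M. intersection_body_of ?K' M"
      using h by (intro intersection_body_dimension_lift[OF assms(1-3) \<rho>\<kappa> \<kappa>(1,2) \<kappa>pos f(1,2) C eq _ f' g'])
        (auto simp: conv_iff)
  next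
    assume "\<not> equator_convex k L"
    then obtain s t where st: "0 < s" "s \<le> t" "t \<le> 1" "t * f t < s * f s"
      by (auto simp: conv_iff not_le)
    then have "s < t" by (cases "s = t") auto
    obtain t0 where t0: "t0 \<in> {0..1}" "0 < \<kappa> t0" using \<kappa>pos by blast
    have rad': "radial_fun ?K' \<xi> = \<kappa> \<bar>\<xi> $ k'\<bar>" if "norm \<xi> = 1" for \<xi>
      by (rule star_body_revolution_body(2)[OF m2 \<kappa>(1,2) \<rho>\<kappa> t0 that])
    have eq': "\<kappa> t = C * (\<integral>v. indicator {0..1} v * ((1 - v\<^sup>2) ^ (q - 1) * f (sqrt (1 - t\<^sup>2) * v) ^ (2 * q + 1)) \<partial>lborel)"
      if "t \<in> {0..1}" for t
    proof -
      have e: "CARD('n) - 4 = 2 * (q - 1)" "CARD('n) - 1 = 2 * q + 1" using q by simp_all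
      show ?thesis unfolding eq[OF that] e
        by (rule arg_cong[where f="\<lambda>x. C * x"], rule integral_indicator_cong) (simp only: even_section_weight)
    qed
    show "\<not> intersection_body ?K'"
      by (rule not_intersection_body_lift[OF N q1 rad' \<kappa>(1) f(1,2) C eq' st(1) \<open>s < t\<close> st(3,4)])
  qed
qed

end
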